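(* Let $n \ge 2$ be an integer with prime decomposition $n = p_1^{l_1}\cdots p_{\Omega(n)}^{l_{\Omega(n)}}$, where $\Omega(n)$ is the number of distinct primes dividing $n$ and all $l_i\ge 1$, and let $l = \gcd(l_1,\ldots,l_{\Omega(n)})$. Then the group $\mathcal{TO}_n \cap \mathcal{L}_n$ is isomorphic to $\mathbb{Z}/2\mathbb{Z} \times \mathbb{Z}^{\Omega(n)-1} \times \mathbb{Z}/l\mathbb{Z}$.
   Context: Words. $X_n=\{0,1,\ldots,n-1\}$; $X_n^*$ is the set of finite words over $X_n$ ($\varepsilon$ the empty word); $X_n^\omega$ is the set of infinite sequences with the product topology; $U_\gamma\subseteq X_n^\omega$ is the set of sequences with prefix $\gamma\in X_n^*$. The lexicographic order on $X_n^\omega$ is the usual one induced by $0<1<\cdots<n-1$. Transducers. A transducer is $T=(X_n,Q_T,\pi_T,\lambda_T)$ with $Q_T$ a countable set of states, $\pi_T:X_n\times Q_T\to Q_T$ and $\lambda_T:X_n\times Q_T\to X_n^*$. These are extended to finite words by $\pi_T(\varepsilon,q)=q$, $\lambda_T(\varepsilon,q)=\varepsilon$, $\pi_T(wa,q)=\pi_T(a,\pi_T(w,q))$, $\lambda_T(wa,q)=\lambda_T(w,q)\lambda_T(a,\pi_T(w,q))$, and $\lambda_T$ is extended to infinite words by concatenating outputs. It is always assumed that every infinite input, read from any state, gives an infinite output. For $q\in Q_T$ let $h_q:X_n^\omega\to X_n^\omega$, $h_q(w)=\lambda_T(w,q)$, and $\mathrm{im}(q)=h_q(X_n^\omega)$.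 Two states are $\omega$-equivalent if they induce the same map. A state $q$ is a state of incomplete response if the longest common prefix $\Lambda(\varepsilon,q)$ of $\mathrm{im}(q)$ is non-empty. $T$ is minimal if no two distinct states are $\omega$-equivalent, there are no states of incomplete response, and $T$ is strongly connected as a directed graph. Transducers that agree up to a bijection of states preserving the induced maps are identified. $T$ is strongly synchronizing if for some $k$, for every word $w$ of length $k$, $\pi_T(w,q)$ does not depend on $q$; the states of the form $\pi_T(w,q)$, $|w|=k$, form the core of $T$ (a subtransducer), and $T$ is core if it equals its core. The monoid $\mathcal{SO}_n$ and group $\mathcal{O}_n$. $\mathcal{SO}_n$ is the set of minimal, strongly synchronizing, core transducers $T$ such that for every $t\in Q_T$ the map $h_t$ is injective with clopen image. The product $T*U$ has state set $Q_T\times Q_U$, $\pi_{T*U}(x,(p,q))=(\pi_T(x,p),\pi_U(\lambda_T(x,p),q))$, $\lambda_{T*U}(x,(p,q))=\lambda_U(\lambda_T(x,p),q)$. For $T,U\in\mathcal{SO}_n$, $TU\in\mathcal{SO}_n$ is obtained from the core of $T*U$ by removing incomplete response (replacing each output $\lambda(a,q)$ by the word obtained from $\lambda(a,q)\Lambda(\varepsilon,\pi(a,q))$ by deleting its prefix $\Lambda(\varepsilon,q)$), identifying $\omega$-equivalent states, and taking the core. This makes $\mathcal{SO}_n$ a monoid whose identity is the single-state identity transducer, and $\mathcal{O}_n$ is its largest inverse-closed subset (its group of units). Subgroups. $\mathcal{TO}_n$ is the group of all $T\in\mathcal{O}_n$ such that either every $h_t$ ($t\in Q_T$) preserves the lexicographic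 order or every $h_t$ reverses it. $\mathcal{L}_n$ is the group of all $T\in\mathcal{O}_n$ such that $|\lambda_T(a,q)|=|a|$ for all $a\in X_n^*$ and $q\in Q_T$ with $\pi_T(a,q)=q$. *)

theory Defs
  imports
    "HOL-Analysis.Analysis"
    "HOL-Algebra.Algebra"
    "HOL-Computational_Algebra.Computational_Algebra"
    "HOL-Library.Fun_Lexorder"
begin

section \<open>Words and sequences\<close>

abbreviation words :: "nat \<Rightarrow> nat list set" where
  "words n \<equiv> lists {..<n}"

definition sequence_space :: "nat \<Rightarrow> (nat \<Rightarrow> nat) topology" where
  "sequence_space n = product_topology (\<lambda>_. discrete_topology {..<n}) UNIV"

abbreviation sequences :: "nat \<Rightarrow> (nat \<Rightarrow> nat) set" where
  "sequences n \<equiv> topspace (sequence_space n)"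

lemma sequences_eq: "sequences n = {x. \<forall>i. x i < n}"
  by (auto simp: sequence_space_def)

definition seq_take :: "nat \<Rightarrow> (nat \<Rightarrow> nat) \<Rightarrow> nat list" where
  "seq_take k x = map x [0..<k]"

definition is_prefix_of :: "nat list \<Rightarrow> (nat \<Rightarrow> nat) \<Rightarrow> bool" where
  "is_prefix_of u x \<longleftrightarrow> seq_take (length u) x = u"

section \<open>Transducers\<close>

text \<open>Only the values of \<open>next_state\<close> and \<open>out\<close> at letters of the alphabet and at members of
  \<open>states\<close> are meaningful.\<close>

record 'q transducer =
  states :: "'q set"
  next_state :: "nat \<Rightarrow> 'q \<Rightarrow> 'q"
  out :: "nat \<Rightarrow> 'q \<Rightarrow> nat list"

primrec next_state_word :: "'q transducer \<Rightarrow> nat list \<Rightarrow> 'q \<Rightarrow> 'q" where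
  "next_state_word T [] q = q"
| "next_state_word T (a # w) q = next_state_word T w (next_state T a q)"

primrec output_word :: "'q transducer \<Rightarrow> nat list \<Rightarrow> 'q \<Rightarrow> nat list" where
  "output_word T [] q = []"
| "output_word T (a # w) q = out T a q @ output_word T w (next_state T a q)"

lemma next_state_word_snoc:
  "next_state_word T (w @ [a]) q = next_state T a (next_state_word T w q)"
  by (induction w arbitrary: q) auto

lemma output_word_snoc:
  "output_word T (w @ [a]) q = output_word T w q @ out T a (next_state_word T w q)"
  by (induction w arbitrary: q) auto

definition is_transducer :: "nat \<Rightarrow> 'q transducer \<Rightarrow> bool" where
  "is_transducer n T \<longleftrightarrow>
     countable (states T) \<and> states T \<noteq> {} \<and>
     (\<forall>a<n. \<forall>q\<in>states T. next_state T a q \<in> states T \<and> out T a q \<in> words n) \<and>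
     (\<forall>q\<in>states T. \<forall>x\<in>sequences n. \<forall>N. \<exists>k. N \<le> length (output_word T (seq_take k x) q))"

text \<open>The outputs on the finite prefixes of \<open>x\<close> extend one another; the \<open>i\<close>-th letter of the
  infinite output is read off the first one that is long enough.\<close>

definition induced_map :: "'q transducer \<Rightarrow> 'q \<Rightarrow> (nat \<Rightarrow> nat) \<Rightarrow> nat \<Rightarrow> nat" where
  "induced_map T q x =
     (\<lambda>i. output_word T (seq_take (LEAST k. i < length (output_word T (seq_take k x) q)) x) q ! i)"

definition state_image :: "nat \<Rightarrow> 'q transducer \<Rightarrow> 'q \<Rightarrow> (nat \<Rightarrow> nat) set" where
  "state_image n T q = induced_map T q ` sequences n"

definition omega_equiv :: "nat \<Rightarrow> 'q transducer \<Rightarrow> 'q \<Rightarrow> 'q \<Rightarrow> bool" where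
  "omega_equiv n T p q \<longleftrightarrow> (\<forall>x\<in>sequences n. induced_map T p x = induced_map T q x)"

text \<open>A longest word exists unless \<open>state_image n T q\<close> is a single point, in which case the
  common prefix would be infinite. This does not occur for injective maps when \<open>n \<ge> 2\<close>.\<close>

definition common_prefix :: "nat \<Rightarrow> 'q transducer \<Rightarrow> 'q \<Rightarrow> nat list" where
  "common_prefix n T q = (ARG_MAX length u. \<forall>y\<in>state_image n T q. is_prefix_of u y)"

text \<open>Equivalent to \<open>common_prefix n T q \<noteq> []\<close> whenever the latter is meaningful, and correct
  also when the image is a single point.\<close>

definition incomplete_response :: "nat \<Rightarrow> 'q transducer \<Rightarrow> 'q \<Rightarrow> bool" where
  "incomplete_response n T q \<longleftrightarrow> (\<exists>u. u \<noteq> [] \<and> (\<forall>y\<in>state_image n T q. is_prefix_of u y))"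

definition strongly_connected :: "nat \<Rightarrow> 'q transducer \<Rightarrow> bool" where
  "strongly_connected n T \<longleftrightarrow>
     (\<forall>p\<in>states T. \<forall>q\<in>states T. \<exists>w\<in>words n. next_state_word T w p = q)"

definition minimal_transducer :: "nat \<Rightarrow> 'q transducer \<Rightarrow> bool" where
  "minimal_transducer n T \<longleftrightarrow>
     (\<forall>p\<in>states T. \<forall>q\<in>states T. omega_equiv n T p q \<longrightarrow> p = q) \<and>
     (\<forall>q\<in>states T. \<not> incomplete_response n T q) \<and>
     strongly_connected n T"

definition synchronizing_at_level :: "nat \<Rightarrow> 'q transducer \<Rightarrow> nat \<Rightarrow> bool" where
  "synchronizing_at_level n T k \<longleftrightarrow>
     (\<forall>w\<in>words n. length w = k \<longrightarrow>
        (\<forall>p\<in>states T. \<forall>q\<in>states T. next_state_word T w p = next_state_word T w q))"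

definition strongly_synchronizing :: "nat \<Rightarrow> 'q transducer \<Rightarrow> bool" where
  "strongly_synchronizing n T \<longleftrightarrow> (\<exists>k. synchronizing_at_level n T k)"

text \<open>The states reached by words of length \<open>k\<close> are the same for all synchronizing levels \<open>k\<close>
  (when \<open>n \<ge> 1\<close>), so no particular level needs to be singled out.\<close>

definition core_states :: "nat \<Rightarrow> 'q transducer \<Rightarrow> 'q set" where
  "core_states n T = {next_state_word T w q | w q k.
     synchronizing_at_level n T k \<and> w \<in> words n \<and> length w = k \<and> q \<in> states T}"

definition core :: "nat \<Rightarrow> 'q transducer \<Rightarrow> 'q transducer" where
  "core n T = T\<lparr>states := core_states n T\<rparr>"

definition is_core :: "nat \<Rightarrow> 'q transducer \<Rightarrow> bool" where
  "is_core n T \<longleftrightarrow> core n T = T"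

text \<open>Equality of transducers up to a bijection of states preserving the induced maps.\<close>

definition transducer_iso :: "nat \<Rightarrow> 'p transducer \<Rightarrow> 'q transducer \<Rightarrow> bool" where
  "transducer_iso n T U \<longleftrightarrow>
     (\<exists>f. bij_betw f (states T) (states U) \<and>
          (\<forall>q\<in>states T. \<forall>x\<in>sequences n. induced_map T q x = induced_map U (f q) x))"

section \<open>Products\<close>

definition product_transducer :: "'p transducer \<Rightarrow> 'q transducer \<Rightarrow> ('p \<times> 'q) transducer" where
  "product_transducer T U = \<lparr>
     states = states T \<times> states U,
     next_state = (\<lambda>a (p, q). (next_state T a p, next_state_word U (out T a p) q)),
     out = (\<lambda>a (p, q). output_word U (out T a p) q)\<rparr>"

definition remove_incomplete_response :: "nat \<Rightarrow> 'q transducer \<Rightarrow> 'q transducer" where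
  "remove_incomplete_response n T = T\<lparr>
     out := (\<lambda>a q. drop (length (common_prefix n T q))
                       (out T a q @ common_prefix n T (next_state T a q)))\<rparr>"

text \<open>Identifying \<open>\<omega>\<close>-equivalent states. In the absence of states of incomplete response, the
  output and the class of the next state do not depend on the chosen representative.\<close>

definition omega_equiv_rel :: "nat \<Rightarrow> 'q transducer \<Rightarrow> ('q \<times> 'q) set" where
  "omega_equiv_rel n T = {(p, q). p \<in> states T \<and> q \<in> states T \<and> omega_equiv n T p q}"

definition identify_states :: "nat \<Rightarrow> 'q transducer \<Rightarrow> 'q set transducer" where
  "identify_states n T = \<lparr>
     states = states T // omega_equiv_rel n T,
     next_state = (\<lambda>a C. omega_equiv_rel n T `` {next_state T a (SOME q. q \<in> C)}),
     out = (\<lambda>a C. out T a (SOME q. q \<in> C))\<rparr>"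

definition reduced_product ::
    "nat \<Rightarrow> 'p transducer \<Rightarrow> 'q transducer \<Rightarrow> ('p \<times> 'q) set transducer" where
  "reduced_product n T U =
     core n (identify_states n (remove_incomplete_response n (core n (product_transducer T U))))"

definition identity_transducer :: "nat transducer" where
  "identity_transducer = \<lparr>states = {0}, next_state = (\<lambda>a q. q), out = (\<lambda>a q. [a])\<rparr>"

section \<open>The monoid and its groups\<close>

definition is_SO_transducer :: "nat \<Rightarrow> 'q transducer \<Rightarrow> bool" where
  "is_SO_transducer n T \<longleftrightarrow>
     is_transducer n T \<and> minimal_transducer n T \<and> strongly_synchronizing n T \<and> is_core n T \<and>
     (\<forall>t\<in>states T. inj_on (induced_map T t) (sequences n) \<and>
        openin (sequence_space n) (state_image n T t) \<and>
        closedin (sequence_space n) (state_image n T t))"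

text \<open>Since state sets are countable, every transducer is isomorphic to one whose states are natural
  numbers. An element of the monoid is an isomorphism class of such transducers.\<close>

definition transducer_class :: "nat \<Rightarrow> 'q transducer \<Rightarrow> nat transducer set" where
  "transducer_class n T = {V. is_SO_transducer n V \<and> transducer_iso n V T}"

definition SO :: "nat \<Rightarrow> nat transducer set monoid" where
  "SO n = \<lparr>
     carrier = {transducer_class n T | T :: nat transducer. is_SO_transducer n T},
     mult = (\<lambda>A B. \<Union>T\<in>A. \<Union>U\<in>B. transducer_class n (reduced_product n T U)),
     one = transducer_class n identity_transducer\<rparr>"

definition O_group :: "nat \<Rightarrow> nat transducer set monoid" where
  "O_group n = units_of (SO n)"

definition preserves_lex :: "nat \<Rightarrow> ((nat \<Rightarrow> nat) \<Rightarrow> nat \<Rightarrow> nat) \<Rightarrow> bool" where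
  "preserves_lex n h \<longleftrightarrow>
     (\<forall>x\<in>sequences n. \<forall>y\<in>sequences n. less_fun x y \<longrightarrow> less_fun (h x) (h y))"

definition reverses_lex :: "nat \<Rightarrow> ((nat \<Rightarrow> nat) \<Rightarrow> nat \<Rightarrow> nat) \<Rightarrow> bool" where
  "reverses_lex n h \<longleftrightarrow>
     (\<forall>x\<in>sequences n. \<forall>y\<in>sequences n. less_fun x y \<longrightarrow> less_fun (h y) (h x))"

text \<open>The conditions in the next two definitions are invariant under isomorphism of the transducers
  involved, so quantifying over all members of a class amounts to testing one of them.\<close>

definition TO :: "nat \<Rightarrow> nat transducer set set" where
  "TO n = {A \<in> carrier (O_group n). \<forall>T\<in>A.
     (\<forall>t\<in>states T. preserves_lex n (induced_map T t)) \<or>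
     (\<forall>t\<in>states T. reverses_lex n (induced_map T t))}"

definition L :: "nat \<Rightarrow> nat transducer set set" where
  "L n = {A \<in> carrier (O_group n). \<forall>T\<in>A.
     \<forall>w\<in>words n. \<forall>q\<in>states T. next_state_word T w q = q \<longrightarrow> length (output_word T w q) = length w}"

definition TO_L_group :: "nat \<Rightarrow> nat transducer set monoid" where
  "TO_L_group n = (O_group n)\<lparr>carrier := TO n \<inter> L n\<rparr>"

end

theory Submission
  imports Defs "HOL-Library.Omega_Words_Fun"
begin

text \<open>
A sequence \<open>x\<close> over \<open>{0,...,n-1}\<close> is read as the base \<open>n\<close> expansion of a real number \<open>val n x\<close> in
\<open>[0,1]\<close>. The proof identifies the group in question with the quotient of the group of units of
\<open>\<int>[1/n]\<close>, negative units included, by the powers of \<open>n\<close>: a unit \<open>r\<close> corresponds to the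
transducers of \<^emph>\<open>slope\<close> \<open>r\<close>, all of whose state maps act on values as affine maps
\<open>t \<mapsto> \<alpha> + r n\<^sup>k t\<close>, with \<open>\<alpha>\<close> and \<open>k\<close> depending on the state. A positive slope means that the order is
preserved, a negative one that it is reversed. The power of \<open>n\<close> is lost because the removal of a common
prefix of length \<open>k\<close> multiplies a map by \<open>n\<^sup>k\<close>.

\<^emph>\<open>Every element has a slope\<close> (\<open>has_slope_if_adjacent\<close>, \<open>TO_L_slope\<close>). Let \<open>T\<close> represent an element and \<open>U\<close> its
inverse. For each state \<open>t\<close> there is a state \<open>u\<close> with \<open>h\<^sub>u (h\<^sub>t x) = \<gamma> x\<close>, and both maps are monotone in the
same direction. So \<open>h\<^sub>t\<close> sends the neighbours \<open>a(n-1)(n-1)...\<close> and \<open>(a+1)00...\<close> to neighbours in the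
lexicographic order, that is, to two expansions of one number. Hence the oscillation \<open>m t\<close> of \<open>val \<circ> h\<^sub>t\<close>, its
value at the last sequence minus that at the first, is additive:
\<open>m t = (\<Sum>a<n. m (\<pi> a t) / n ^ |\<lambda> a t|)\<close>. The condition that defines \<open>L\<close> says precisely that
\<open>|\<lambda> a t| - 1 = \<phi> (\<pi> a t) - \<phi> t\<close> for some integer function \<open>\<phi>\<close> on the states. So \<open>m t / n powi \<phi> t\<close> is the mean
of its values at the \<open>n\<close> successors of \<open>t\<close>, and by the maximum principle it is a constant \<open>r\<close>. Then every
letter receives the same share of \<open>m t\<close>, and this forces \<open>val \<circ> h\<^sub>t\<close> to be affine with slope \<open>m t = r n powi \<phi> t\<close>.

\<^emph>\<open>The slope determines the element\<close> (\<open>iso_if_same_slope\<close>). As images are clopen, the offsets \<open>\<alpha>\<close> lie in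
\<open>\<int>[1/n]\<close>. If two transducers have the same slope, then reading \<open>0...01\<close> with suitable numbers of zeros yields
two maps that, as functions of the rest of the input, take values in two short intervals which differ by a
translation and each lie inside a single cone. Without the prefixes of these cones the maps agree. So the
transducers have a state map in common, and being minimal they are isomorphic.

\<^emph>\<open>Slopes multiply\<close> (\<open>reduced_product\<close>, \<open>has_slope_reduced_product\<close>), because the state maps of a reduced product are
composites \<open>h\<^sub>u \<circ> h\<^sub>t\<close> without their common prefix. In particular the inverse of an element of slope \<open>r\<close> has
slope \<open>1/r\<close>; both are \<open>n\<close>-adic rationals, so \<open>r\<close> is a unit of \<open>\<int>[1/n]\<close>.

\<^emph>\<open>Every unit is a slope\<close> (\<open>slope_class_exists\<close>): long division by a proper divisor \<open>d\<close> of \<open>n\<close>, with the remainders as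
states, is a transducer of slope \<open>1/d\<close>; the reflection \<open>a \<mapsto> n-1-a\<close> of the alphabet has slope \<open>-1\<close>; and these
numbers generate all units modulo powers of \<open>n\<close>.

Finally, a unit is \<open>\<plusminus>1\<close> times a product of integer powers of the \<open>\<Omega>\<close> primes that divide \<open>n\<close>. Dividing by the
powers of \<open>n\<close> means dividing \<open>\<int>\<^sup>\<Omega>\<close> by the multiples of the vector of exponents of \<open>n\<close>, and some automorphism of
\<open>\<int>\<^sup>\<Omega>\<close> takes \<open>(0,...,0,l)\<close> to that vector (\<open>unimodular_completion\<close>). The factors of the theorem are thus the sign,
the first \<open>\<Omega> - 1\<close> coordinates and the last coordinate modulo \<open>l\<close>.
\<close>

section \<open>Finite prefixes of infinite words\<close>

lemma seq_take_eq_prefix: "seq_take k x = subsequence x 0 k"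
  by (simp add: seq_take_def subsequence_def)

lemma is_prefix_of_nth: "is_prefix_of u x \<longleftrightarrow> (\<forall>i<length u. x i = u ! i)"
proof -
  have "seq_take k x ! i = x i" if "i < k" for i k using that by (simp add: seq_take_def)
  moreover have "seq_take (length u) x = u \<longleftrightarrow> (\<forall>i<length u. seq_take (length u) x ! i = u ! i)"
    by (subst list_eq_iff_nth_eq) (simp add: seq_take_def)
  ultimately show ?thesis by (simp add: is_prefix_of_def)
qed

lemma is_prefix_of_iff: "is_prefix_of u x \<longleftrightarrow> (\<exists>y. x = u \<frown> y)"
proof
  assume "is_prefix_of u x"
  then have "x = u \<frown> (\<lambda>i. x (length u + i))"
    by (intro ext) (simp add: is_prefix_of_nth conc_def)
  then show "\<exists>y. x = u \<frown> y" by blast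
qed (auto simp: is_prefix_of_nth)

lemma is_prefix_of_conc [simp]: "is_prefix_of u (u \<frown> x)"
  by (auto simp: is_prefix_of_iff)

text \<open>The basic cancellation step for comparing outputs: of two prefixes of one sequence the shorter one is a
  prefix of the other.\<close>

lemma conc_eq_conc_longer:
  assumes "u \<frown> x = v \<frown> y" "length u \<le> length v"
  obtains w where "v = u @ w" "x = w \<frown> y"
proof -
  have "take (length u) v = subsequence (v \<frown> y) 0 (length u)"
    using assms(2) by simp
  also have "\<dots> = u" using assms(1)[symmetric] by simp
  finally have "u @ drop (length u) v = v" by (metis append_take_drop_id)
  then obtain w where w: "v = u @ w" by metis
  have "u \<frown> x = u \<frown> (w \<frown> y)" using assms(1) unfolding w conc_conc .
  then have "x = w \<frown> y" by (simp only: same_concat_eq)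
  with w show ?thesis by (rule that)
qed

lemma conc_in_sequences [simp]: "u \<frown> x \<in> sequences n \<longleftrightarrow> u \<in> words n \<and> x \<in> sequences n"
proof -
  have seq: "y \<in> sequences n \<longleftrightarrow> range y \<subseteq> {..<n}" for y
    unfolding sequences_eq by auto
  show ?thesis
    unfolding seq range_conc Un_subset_iff lists_eq_set by auto
qed

lemma build_in_sequences [simp]: "a ## x \<in> sequences n \<longleftrightarrow> a < n \<and> x \<in> sequences n"
  using conc_in_sequences[of "[a]" x n] by simp

lemma suffix_in_sequences [simp]: "x \<in> sequences n \<Longrightarrow> suffix k x \<in> sequences n"
  by (simp add: sequences_eq)

lemma seq_take_in_words [simp]: "x \<in> sequences n \<Longrightarrow> seq_take k x \<in> words n"
  by (auto simp: sequences_eq seq_take_def)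

lemma length_seq_take [simp]: "length (seq_take k x) = k"
  by (simp add: seq_take_def)

lemma const_in_sequences: "a < n \<Longrightarrow> (\<lambda>_. a) \<in> sequences n"
  by (simp add: sequences_eq)

lemma seq_cases:
  assumes "x \<in> sequences n"
  obtains a y where "x = a ## y" "a < n" "y \<in> sequences n"
proof -
  show ?thesis
  proof (rule that)
    show "x = x 0 ## suffix (Suc 0) x" by simp
    show "x 0 < n" using assms by (simp add: sequences_eq)
    show "suffix (Suc 0) x \<in> sequences n" using assms by simp
  qed
qed

lemma seq_take_Suc_build [simp]: "seq_take (Suc k) (a ## x) = a # seq_take k x"
  by (rule nth_equalityI) (auto simp: seq_take_def nth_Cons' nth_append less_Suc_eq_0_disj simp del: upt_Suc)

lemma seq_take_0 [simp]: "seq_take 0 x = []" by (simp add: seq_take_def)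

section \<open>Values of sequences and the lexicographic order\<close>

definition val :: "nat \<Rightarrow> (nat \<Rightarrow> nat) \<Rightarrow> real" where
  "val n x = suminf (\<lambda>i. real (x i) / real n ^ Suc i)"

fun num :: "nat \<Rightarrow> nat list \<Rightarrow> nat" where
  "num n [] = 0"
| "num n (a # w) = a * n ^ length w + num n w"

text \<open>The last sequence in the lexicographic order, all of whose digits are \<open>n - 1\<close>; it represents the number 1.\<close>

definition nines :: "nat \<Rightarrow> nat \<Rightarrow> nat" where
  "nines n = (\<lambda>_. n - 1)"

lemma nines_apply [simp]: "nines n i = n - 1"
  by (simp add: nines_def)

lemma num_less: "u \<in> words n \<Longrightarrow> num n u < n ^ length u"
proof (induction u)
  case (Cons a u)
  then have "a + 1 \<le> n" "num n u < n ^ length u" by auto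
  then have "num n (a # u) < (a + 1) * n ^ length u" by simp
  also have "\<dots> \<le> n * n ^ length u" using \<open>a + 1 \<le> n\<close> mult_le_mono1 by blast
  finally show ?case by simp
qed simp

lemma num_inj: "\<lbrakk>u \<in> words n; v \<in> words n; length u = length v; num n u = num n v\<rbrakk> \<Longrightarrow> u = v"
proof (induction u arbitrary: v)
  case (Cons a u)
  obtain b w where v: "v = b # w" using Cons.prems(3) by (cases v) auto
  let ?N = "n ^ length u"
  have "u \<in> words n" "w \<in> words n" and len: "length w = length u" using Cons.prems(1-3) v by auto
  then have "num n u < ?N" "num n w < ?N" using num_less[of u] num_less[of w] by (simp_all only:)
  moreover have "a * ?N + num n u = b * ?N + num n w" using Cons.prems(4) len unfolding v by simp
  moreover have div: "(c * ?N + x) div ?N = c" if "x < ?N" for c x :: nat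
  proof -
    have "?N \<noteq> 0" using that by (metis not_less0)
    then show ?thesis using div_mult_self3[of ?N x c] that by simp
  qed
  ultimately have "a = b" using div by metis
  moreover have "num n u = num n w"
    using \<open>a = b\<close> \<open>a * ?N + num n u = b * ?N + num n w\<close> by simp
  then show ?case using Cons.IH[of w] \<open>u \<in> words n\<close> \<open>w \<in> words n\<close> len \<open>a = b\<close> v by simp
qed simp

lemma less_fun_total: "less_fun x y \<or> x = y \<or> less_fun y (x :: nat \<Rightarrow> nat)"
proof (cases "x = y")
  case False
  then have "\<exists>i. x i \<noteq> y i" by auto
  define k where "k = (LEAST i. x i \<noteq> y i)"
  have k: "x k \<noteq> y k" "\<forall>j<k. x j = y j"
    using LeastI_ex[OF \<open>\<exists>i. x i \<noteq> y i\<close>] not_less_Least unfolding k_def by blast+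
  show ?thesis
  proof (cases "x k < y k")
    case True
    then have "less_fun x y" using k(2) unfolding less_fun_def by blast
    then show ?thesis by blast
  next
    case False
    then have "y k < x k" "\<forall>j<k. y j = x j" using k by simp_all
    then have "less_fun y x" unfolding less_fun_def by blast
    then show ?thesis by blast
  qed
qed simp

lemma less_fun_split:
  assumes "less_fun x (y :: nat \<Rightarrow> nat)" "x \<in> sequences n" "y \<in> sequences n"
  obtains u a b x' y' where "x = u \<frown> a ## x'" "y = u \<frown> b ## y'" "a < b"
    "u \<in> words n" "b < n" "x' \<in> sequences n" "y' \<in> sequences n"
proof -
  obtain k where k: "x k < y k" "\<forall>j<k. x j = y j" using assms(1) by (auto simp: less_fun_def)
  define u where "u = subsequence x 0 k"
  have u: "u = subsequence y 0 k" using k by (auto simp: u_def subsequence_def)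
  have dec: "z = subsequence z 0 k \<frown> z k ## suffix (Suc k) z" for z :: "nat \<Rightarrow> nat"
  proof -
    have "z k ## suffix (Suc k) z = suffix k z" by (rule ext) (case_tac x; simp)
    then show ?thesis by simp
  qed
  have X: "x = u \<frown> x k ## suffix (Suc k) x" and Y: "y = u \<frown> y k ## suffix (Suc k) y"
    using dec[of x] dec[of y] by (simp_all only: u_def[symmetric] u[symmetric])
  have "u \<in> words n" using assms(2) X by (metis conc_in_sequences)
  then show ?thesis using that[OF X Y k(1)] assms by (simp add: sequences_eq)
qed

lemma less_fun_conc [simp]: "less_fun (u \<frown> x) (u \<frown> y) \<longleftrightarrow> less_fun x (y :: nat \<Rightarrow> nat)"
proof
  assume "less_fun (u \<frown> x) (u \<frown> y)"
  then obtain k where k: "(u \<frown> x) k < (u \<frown> y) k" "\<forall>j<k. (u \<frown> x) j = (u \<frown> y) j"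
    by (auto simp: less_fun_def)
  then have "k \<ge> length u" by (metis conc_fst less_irrefl not_le_imp_less)
  then have "x (k - length u) < y (k - length u)" using k(1) by simp
  moreover have "x j = y j" if "j < k - length u" for j
    using k(2)[rule_format, of "j + length u"] that by simp
  ultimately show "less_fun x y" by (auto simp: less_fun_def)
next
  assume "less_fun x y"
  then obtain k where k: "x k < y k" "\<forall>j<k. x j = y j" by (auto simp: less_fun_def)
  have "(u \<frown> x) (k + length u) < (u \<frown> y) (k + length u)" using k by simp
  moreover have "(u \<frown> x) j = (u \<frown> y) j" if "j < k + length u" for j
    using k that by (cases "j < length u") auto
  ultimately show "less_fun (u \<frown> x) (u \<frown> y)" unfolding less_fun_def by blast
qed

lemma less_fun_build [simp]: "less_fun (a ## x) (b ## y) \<longleftrightarrow> a < b \<or> a = b \<and> less_fun x (y :: nat \<Rightarrow> nat)"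
proof -
  have "less_fun (a ## x) (a ## y) = less_fun x y" using less_fun_conc[of "[a]" x y] by simp
  moreover have "a < b \<Longrightarrow> less_fun (a ## x) (b ## y)" for a b x and y :: "nat \<Rightarrow> nat"
    unfolding less_fun_def by (rule exI[of _ 0]) simp
  ultimately show ?thesis
    by (cases "a < b"; cases "b < a") (use less_fun_asym in \<open>auto dest: less_fun_asym\<close>)
qed

lemma less_fun_zeros:
  assumes "less_fun x (\<lambda>_. 0 :: nat)" shows False
  using assms by (auto simp: less_fun_def)

lemma less_fun_nines:
  assumes "less_fun (nines n) x" "x \<in> sequences n" shows False
proof -
  obtain k where "n - 1 < x k" using assms by (auto simp: less_fun_def)
  moreover have "x k < n" using assms by (simp add: sequences_eq)
  ultimately show False by simp
qed

context
  fixes n :: nat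
  assumes n2: "n \<ge> 2"
begin

lemma summable_val:
  assumes "x \<in> sequences n" shows "summable (\<lambda>i. real (x i) / real n ^ Suc i)"
proof (rule summable_comparison_test')
  show "summable (\<lambda>i. (1 / real n) ^ i)" using n2 by (simp add: summable_geometric)
  show "norm (real (x i) / real n ^ Suc i) \<le> (1 / real n) ^ i" if "i \<ge> 0" for i
  proof -
    have "real (x i) \<le> n" using assms by (simp add: sequences_eq less_imp_le)
    then have "real (x i) / real n ^ Suc i \<le> n / real n ^ Suc i"
      by (rule divide_right_mono) simp
    also have "\<dots> = (1 / real n) ^ i" using n2 by (simp add: power_one_over)
    finally show ?thesis by simp
  qed
qed

lemma val_build:
  assumes "a ## x \<in> sequences n"
  shows "val n (a ## x) = (real a + val n x) / n"
proof -
  have "val n (a ## x) = suminf (\<lambda>i. real ((a ## x) (Suc i)) / real n ^ Suc (Suc i)) + real a / n"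
    unfolding val_def by (subst suminf_split_head[OF summable_val[OF assms], unfolded]) simp
  also have "suminf (\<lambda>i. real ((a ## x) (Suc i)) / real n ^ Suc (Suc i))
     = suminf (\<lambda>i. real (x i) / real n ^ Suc i / real n)" by (simp add: mult.commute)
  also have "\<dots> = val n x / n"
    unfolding val_def by (rule suminf_divide) (use assms summable_val in simp)
  finally show ?thesis by (simp add: add_divide_distrib)
qed

lemma val_conc:
  assumes "u \<in> words n" "x \<in> sequences n"
  shows "val n (u \<frown> x) = (real (num n u) + val n x) / real n ^ length u"
  using assms(1)
proof (induction u)
  case (Cons a u)
  then have "a ## (u \<frown> x) \<in> sequences n" using assms by simp
  from val_build[OF this] Cons show ?case using n2
    by (simp add: field_simps)
qed simp

lemma val_zeros: "val n (\<lambda>_. 0) = 0"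
  by (simp add: val_def)

lemma nines_in_sequences [simp]: "nines n \<in> sequences n"
  using n2 by (simp add: sequences_eq)

lemma zeros_in_sequences [simp]: "(\<lambda>_. 0) \<in> sequences n"
  using n2 by (simp add: sequences_eq)

lemma val_nines: "val n (nines n) = 1"
proof -
  have e: "nines n = (n - 1) ## nines n" by (rule ext) (case_tac x; simp)
  have "val n ((n - 1) ## nines n) = (real (n - 1) + val n (nines n)) / n"
    by (rule val_build) (use n2 in simp)
  then have "val n (nines n) = (real (n - 1) + val n (nines n)) / n" by (simp only: e[symmetric])
  then have "(real n - 1) * (val n (nines n) - 1) = 0" using n2 by (simp add: field_simps of_nat_diff)
  then show ?thesis using n2 by simp
qed

lemma val_ge_0: "x \<in> sequences n \<Longrightarrow> 0 \<le> val n x"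
  unfolding val_def by (rule suminf_nonneg[OF summable_val]) auto

lemma val_le_1: assumes "x \<in> sequences n" shows "val n x \<le> 1"
proof -
  have "val n x \<le> val n (nines n)"
    unfolding val_def
  proof (rule suminf_le[OF _ summable_val[OF assms] summable_val[OF nines_in_sequences]])
    fix i
    have "x i < n" using assms by (simp add: sequences_eq)
    then show "real (x i) / real n ^ Suc i \<le> real (nines n i) / real n ^ Suc i"
      by (intro divide_right_mono) auto
  qed
  then show ?thesis by (simp add: val_nines)
qed

text \<open>Only weakly monotone: the two expansions of an \<open>n\<close>-adic number have equal values.\<close>

lemma less_fun_val_le:
  assumes "less_fun x y" "x \<in> sequences n" "y \<in> sequences n"
  shows "val n x \<le> val n y"
  using assms
proof (cases rule: less_fun_split)
  case (1 u a b x' y')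
  have "val n (a ## x') \<le> val n (b ## y')"
    using val_build[of a x'] val_build[of b y'] val_le_1[of x'] val_ge_0[of y'] 1
    by (simp add: divide_right_mono)
  then show ?thesis using 1 n2 by (simp add: val_conc divide_right_mono)
qed

text \<open>Neighbours in the lexicographic order represent the same number. If \<open>x\<close> is not followed by
  \<open>(n-1)(n-1)...\<close> after the first difference, or \<open>y\<close> not by \<open>00...\<close>, or if the letters at the first
  difference are not consecutive, then something fits between; otherwise the values agree.\<close>

lemma less_fun_gap:
  assumes xy: "less_fun x y" "x \<in> sequences n" "y \<in> sequences n" and ne: "val n x \<noteq> val n y"
  obtains z where "z \<in> sequences n" "less_fun x z" "less_fun z y"
  using xy
proof (cases rule: less_fun_split)
  case (1 u a b x' y')
  have "a + 1 < b \<or> b = a + 1" using 1(3) by linarith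
  then consider "x' \<noteq> (nines n)" | "y' \<noteq> (\<lambda>_. 0)" | "x' = (nines n)" "y' = (\<lambda>_. 0)" "a + 1 < b"
    | "x' = (nines n)" "y' = (\<lambda>_. 0)" "b = a + 1"
    by blast
  then show ?thesis
  proof cases
    case A: 1
    then have "less_fun x' (nines n)" using less_fun_total less_fun_nines 1 by blast
    then show ?thesis using 1 by (intro that[of "u \<frown> a ## (nines n)"]) auto
  next
    case 2
    then have "less_fun (\<lambda>_. 0) y'" using less_fun_total less_fun_zeros by blast
    then show ?thesis using 1 by (intro that[of "u \<frown> b ## (\<lambda>_. 0)"]) auto
  next
    case 3
    then show ?thesis using 1 by (intro that[of "u \<frown> (a + 1) ## (\<lambda>_. 0)"]) auto
  next
    case 4
    then have "val n (a ## x') = val n (b ## y')"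
      using 1 by (simp add: val_build val_zeros val_nines)
    then have "val n x = val n y" using 1 by (simp add: val_conc)
    with ne show ?thesis by simp
  qed
qed

end

lemma no_seq_between_adjacent:
  assumes "less_fun (a ## (nines n)) z" "less_fun z ((a + 1) ## (\<lambda>_. 0))" "z \<in> sequences n"
  shows False
proof -
  obtain b y where z: "z = b ## y" "y \<in> sequences n" using assms(3) by (cases rule: seq_cases) auto
  have "a < b \<or> a = b \<and> less_fun (nines n) y" "b < a + 1 \<or> b = a + 1 \<and> less_fun y (\<lambda>_. 0)"
    using assms(1,2) by (simp_all only: z less_fun_build)
  moreover have "\<not> less_fun (nines n) y" "\<not> less_fun y (\<lambda>_. 0)"
    using less_fun_nines[OF _ z(2)] less_fun_zeros by blast+
  ultimately show False by linarith
qed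

section \<open>Open sets of sequences\<close>

lemma seq_take_eq_iff: "seq_take N y = seq_take N x \<longleftrightarrow> (\<forall>i<N. y i = x i)"
  by (auto simp: seq_take_def)

text \<open>Cones form a basis of the topology, so that openness can be tested on finite prefixes.\<close>

lemma openin_sequence_space:
  "openin (sequence_space n) S \<longleftrightarrow>
     S \<subseteq> sequences n \<and> (\<forall>x\<in>S. \<exists>N. \<forall>y\<in>sequences n. seq_take N y = seq_take N x \<longrightarrow> y \<in> S)"
    (is "?L \<longleftrightarrow> ?R")
proof
  assume L: ?L
  have "\<exists>N. \<forall>y\<in>sequences n. seq_take N y = seq_take N x \<longrightarrow> y \<in> S" if xS: "x \<in> S" for x
  proof -
    obtain U where U: "finite {i. U i \<noteq> {..<n}}" "x \<in> Pi\<^sub>E UNIV U" "Pi\<^sub>E UNIV U \<subseteq> S"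
      using bspec[OF L[unfolded sequence_space_def openin_product_topology_alt] xS] by auto
    obtain N where N: "{i. U i \<noteq> {..<n}} \<subseteq> {..<N}" using finite_nat_bounded[OF U(1)] by blast
    have "y \<in> S" if y: "y \<in> sequences n" "seq_take N y = seq_take N x" for y
    proof -
      have "y i \<in> U i" for i
      proof (cases "i < N")
        case True
        then have "y i = x i" using y by (simp add: seq_take_eq_iff)
        then show ?thesis using U(2) by (auto simp: PiE_iff)
      next
        case False
        then have "U i = {..<n}" using N by auto
        then show ?thesis using y by (simp add: sequences_eq)
      qed
      then show ?thesis using U(3) by (auto simp: PiE_iff)
    qed
    then show ?thesis by blast
  qed
  then show ?R using openin_subset[OF L] by blast
next
  assume R: ?R
  have "\<exists>U. finite {i \<in> UNIV. U i \<noteq> topspace (discrete_topology {..<n})} \<and>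
      (\<forall>i\<in>UNIV. openin (discrete_topology {..<n}) (U i)) \<and> x \<in> Pi\<^sub>E UNIV U \<and> Pi\<^sub>E UNIV U \<subseteq> S"
    if xS: "x \<in> S" for x
  proof -
    obtain N where N: "\<forall>y\<in>sequences n. seq_take N y = seq_take N x \<longrightarrow> y \<in> S" using R xS by blast
    have x: "x i < n" for i using R xS by (auto simp: sequences_eq)
    define U where "U i = (if i < N then {x i} else {..<n})" for i
    have "{i \<in> UNIV. U i \<noteq> topspace (discrete_topology {..<n})} \<subseteq> {..<N}" by (auto simp: U_def)
    then have "finite {i \<in> UNIV. U i \<noteq> topspace (discrete_topology {..<n})}"
      using finite_subset by blast
    moreover have "\<forall>i\<in>UNIV. openin (discrete_topology {..<n}) (U i)" using x by (auto simp: U_def)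
    moreover have "x \<in> Pi\<^sub>E UNIV U" using x by (auto simp: U_def)
    moreover have "Pi\<^sub>E UNIV U \<subseteq> S"
    proof
      fix y assume "y \<in> Pi\<^sub>E UNIV U"
      then have y: "y i \<in> U i" for i by auto
      have "y i < n" for i using y[of i] x[of i] by (auto simp: U_def split: if_splits)
      moreover have "y i = x i" if "i < N" for i using y[of i] that by (simp add: U_def)
      ultimately show "y \<in> S" using N by (simp add: sequences_eq seq_take_eq_iff)
    qed
    ultimately show ?thesis by blast
  qed
  then show ?L unfolding sequence_space_def openin_product_topology_alt by blast
qed

lemma openin_conc_preimage:
  assumes "openin (sequence_space n) S" "u \<in> words n"
  shows "openin (sequence_space n) {y \<in> sequences n. u \<frown> y \<in> S}"
  unfolding openin_sequence_space
proof (intro conjI ballI)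
  fix x assume x: "x \<in> {y \<in> sequences n. u \<frown> y \<in> S}"
  then obtain N where N: "\<forall>y\<in>sequences n. seq_take N y = seq_take N (u \<frown> x) \<longrightarrow> y \<in> S"
    using assms unfolding openin_sequence_space by blast
  have "y \<in> {y \<in> sequences n. u \<frown> y \<in> S}" if y: "y \<in> sequences n" "seq_take N y = seq_take N x" for y
  proof -
    have "(u \<frown> y) i = (u \<frown> x) i" if "i < N" for i
      using that y by (cases "i < length u") (auto simp: seq_take_eq_iff)
    then show ?thesis using y N assms by (simp add: seq_take_eq_iff del: not_less)
  qed
  then show "\<exists>N. \<forall>y\<in>sequences n. seq_take N y = seq_take N x \<longrightarrow> y \<in> {y \<in> sequences n. u \<frown> y \<in> S}"
    by blast
qed auto

lemma openin_conc_image: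
  assumes "openin (sequence_space n) S" "u \<in> words n"
  shows "openin (sequence_space n) ((\<frown>) u ` S)"
  unfolding openin_sequence_space
proof (intro conjI ballI)
  show "(\<frown>) u ` S \<subseteq> sequences n" using assms openin_subset by fastforce
  fix z assume "z \<in> (\<frown>) u ` S"
  then obtain x where x: "x \<in> S" "z = u \<frown> x" by blast
  then obtain N where N: "\<forall>y\<in>sequences n. seq_take N y = seq_take N x \<longrightarrow> y \<in> S"
    using assms unfolding openin_sequence_space by blast
  have "y \<in> (\<frown>) u ` S" if y: "y \<in> sequences n" "seq_take (length u + N) y = seq_take (length u + N) z" for y
  proof -
    have "y i = u ! i" if "i < length u" for i using y x that by (simp add: seq_take_eq_iff)
    then obtain y' where y': "y = u \<frown> y'" using is_prefix_of_nth is_prefix_of_iff by metis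
    have "y' i = x i" if "i < N" for i
      using y(2) that unfolding seq_take_eq_iff x y' by (auto dest!: spec[of _ "length u + i"])
    then have "y' \<in> S" using N y(1) y' by (simp add: seq_take_eq_iff)
    then show ?thesis using y' by blast
  qed
  then show "\<exists>N. \<forall>y\<in>sequences n. seq_take N y = seq_take N z \<longrightarrow> y \<in> (\<frown>) u ` S" by blast
qed

section \<open>Maps induced by transducers\<close>

lemma next_state_word_append [simp]:
  "next_state_word T (u @ v) q = next_state_word T v (next_state_word T u q)"
  by (induction u arbitrary: q) auto

lemma output_word_append [simp]:
  "output_word T (u @ v) q = output_word T u q @ output_word T v (next_state_word T u q)"
  by (induction u arbitrary: q) auto

lemma seq_take_add: "\<exists>v. seq_take (k + m) x = seq_take k x @ v"
  unfolding seq_take_def upt_add_eq_append[OF le0] by auto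

lemma output_word_seq_take_mono:
  assumes "k \<le> m" obtains v where "output_word T (seq_take m x) q = output_word T (seq_take k x) q @ v"
  using seq_take_add[of k "m - k" x] assms that by auto

lemma transducer_step:
  assumes "is_transducer n T" "q \<in> states T" "a < n"
  shows "next_state T a q \<in> states T" "out T a q \<in> words n"
  using assms by (auto simp: is_transducer_def)

lemma transducer_word:
  assumes "is_transducer n T" "q \<in> states T" "w \<in> words n"
  shows "next_state_word T w q \<in> states T" "output_word T w q \<in> words n"
proof -
  have "next_state_word T w q \<in> states T \<and> output_word T w q \<in> words n"
    using assms(2,3)
  proof (induction w arbitrary: q)
    case (Cons a w)
    then show ?case using transducer_step[OF assms(1) Cons.prems(1), of a] by simp
  qed simp
  then show "next_state_word T w q \<in> states T" "output_word T w q \<in> words n" by blast+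
qed

text \<open>The choice of the first long enough prefix in the definition of the induced map is immaterial, since the outputs
  extend one another.\<close>

lemma is_prefix_of_induced_map:
  assumes "is_transducer n T" "q \<in> states T" "x \<in> sequences n"
  shows "is_prefix_of (output_word T (seq_take k x) q) (induced_map T q x)"
  unfolding is_prefix_of_nth
proof (intro allI impI)
  fix i assume i: "i < length (output_word T (seq_take k x) q)"
  define K where "K = (LEAST k. i < length (output_word T (seq_take k x) q))"
  have K: "i < length (output_word T (seq_take K x) q)" unfolding K_def
    using i by (rule LeastI[of "\<lambda>k. i < length (output_word T (seq_take k x) q)"])
  have "K \<le> k" unfolding K_def
    using i by (rule Least_le[of "\<lambda>k. i < length (output_word T (seq_take k x) q)"])
  then obtain v where "output_word T (seq_take k x) q = output_word T (seq_take K x) q @ v"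
    by (rule output_word_seq_take_mono)
  then show "induced_map T q x i = output_word T (seq_take k x) q ! i"
    using K by (simp add: induced_map_def K_def[symmetric] nth_append)
qed

text \<open>The outputs are prefixes of unbounded length of the induced map, hence determine it.\<close>

lemma induced_map_unique:
  assumes "is_transducer n T" "q \<in> states T" "x \<in> sequences n"
    and "\<And>k. is_prefix_of (output_word T (seq_take k x) q) y"
  shows "induced_map T q x = y"
proof
  fix i
  obtain k where "Suc i \<le> length (output_word T (seq_take k x) q)"
    using assms(1-3) unfolding is_transducer_def by blast
  then show "induced_map T q x i = y i"
    using assms(4)[of k] is_prefix_of_induced_map[OF assms(1-3), of k]
    by (simp add: is_prefix_of_nth)
qed

lemma induced_map_in_sequences [simp]:
  assumes "is_transducer n T" "q \<in> states T" "x \<in> sequences n"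
  shows "induced_map T q x \<in> sequences n"
  unfolding sequences_eq
proof safe
  fix i
  obtain k where k: "Suc i \<le> length (output_word T (seq_take k x) q)"
    using assms(1-3) unfolding is_transducer_def by blast
  have "output_word T (seq_take k x) q \<in> words n" by (rule transducer_word(2)[OF assms(1,2)]) (use assms(3) in auto)
  then have "output_word T (seq_take k x) q ! i < n" using k by (auto simp: in_lists_conv_set)
  then show "induced_map T q x i < n"
    using k is_prefix_of_induced_map[OF assms(1-3), of k] by (simp add: is_prefix_of_nth)
qed

lemma induced_map_build:
  assumes "is_transducer n T" "q \<in> states T" "a < n" "x \<in> sequences n"
  shows "induced_map T q (a ## x) = out T a q \<frown> induced_map T (next_state T a q) x"
proof (rule induced_map_unique[OF assms(1,2)])
  show "a ## x \<in> sequences n" using assms by simp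
  fix k
  show "is_prefix_of (output_word T (seq_take k (a ## x)) q) (out T a q \<frown> induced_map T (next_state T a q) x)"
  proof (cases k)
    case 0
    then show ?thesis by (simp add: is_prefix_of_nth)
  next
    case (Suc j)
    obtain z where "induced_map T (next_state T a q) x = output_word T (seq_take j x) (next_state T a q) \<frown> z"
      using is_prefix_of_induced_map[OF assms(1) transducer_step(1)[OF assms(1-3)] assms(4)]
      unfolding is_prefix_of_iff by blast
    then show ?thesis using Suc by (auto simp: is_prefix_of_iff)
  qed
qed

lemma induced_map_conc:
  assumes "is_transducer n T" "q \<in> states T" "w \<in> words n" "x \<in> sequences n"
  shows "induced_map T q (w \<frown> x) = output_word T w q \<frown> induced_map T (next_state_word T w q) x"
  using assms(2,3)
proof (induction w arbitrary: q)
  case (Cons a w)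
  then show ?case using assms(1,4)
    by (simp add: induced_map_build[OF assms(1)] transducer_step[OF assms(1)])
qed simp

lemma induced_map_continuous:
  assumes "is_transducer n T" "q \<in> states T" "x \<in> sequences n"
  obtains K where "\<And>y. y \<in> sequences n \<Longrightarrow> seq_take K y = seq_take K x \<Longrightarrow>
     seq_take N (induced_map T q y) = seq_take N (induced_map T q x)"
proof -
  obtain k where k: "N \<le> length (output_word T (seq_take k x) q)"
    using assms(1-3) unfolding is_transducer_def by blast
  have "seq_take N (induced_map T q y) = seq_take N (induced_map T q x)"
    if "y \<in> sequences n" "seq_take k y = seq_take k x" for y
    using is_prefix_of_induced_map[OF assms(1,2) that(1), of k]
      is_prefix_of_induced_map[OF assms(1-3), of k] that(2) k
    by (simp add: is_prefix_of_nth seq_take_eq_iff[of N])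
  then show ?thesis using that by blast
qed

lemma next_state_word_update_states [simp]:
  "next_state_word (T\<lparr>states := S\<rparr>) w q = next_state_word T w q"
  by (induction w arbitrary: q) auto

lemma output_word_update_states [simp]:
  "output_word (T\<lparr>states := S\<rparr>) w q = output_word T w q"
  by (induction w arbitrary: q) auto

lemma induced_map_update_states [simp]: "induced_map (T\<lparr>states := S\<rparr>) = induced_map T"
  by (intro ext) (simp add: induced_map_def)

text \<open>Two different points of the image bound the length of common prefixes, so that the maximum is attained.\<close>

lemma common_prefix_longest:
  assumes "y \<in> state_image n T q" "z \<in> state_image n T q" "y \<noteq> z"
  shows "\<forall>y\<in>state_image n T q. is_prefix_of (common_prefix n T q) y"
    and "\<forall>y\<in>state_image n T q. is_prefix_of u y \<Longrightarrow> length u \<le> length (common_prefix n T q)"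
proof -
  let ?P = "\<lambda>u. \<forall>y\<in>state_image n T q. is_prefix_of u y"
  obtain i where i: "y i \<noteq> z i" using assms by auto
  have "length u < Suc i" if "?P u" for u
  proof (rule ccontr)
    assume "\<not> length u < Suc i"
    then have "y i = u ! i" "z i = u ! i"
      using bspec[OF that assms(1)] bspec[OF that assms(2)] by (simp_all add: is_prefix_of_nth)
    with i show False by simp
  qed
  moreover have "?P []" by (simp add: is_prefix_of_nth)
  ultimately have *: "?P (common_prefix n T q) \<and> (\<forall>u. ?P u \<longrightarrow> length u \<le> length (common_prefix n T q))"
    unfolding common_prefix_def using arg_max_nat_lemma[of ?P "[]" length "Suc i"] by blast
  then show "?P (common_prefix n T q)" by blast
  show "?P u \<Longrightarrow> length u \<le> length (common_prefix n T q)" using * by blast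
qed

section \<open>Synchronization and cores\<close>

lemma synchronizing_at_levelD:
  "synchronizing_at_level n T k \<Longrightarrow> w \<in> words n \<Longrightarrow> length w = k \<Longrightarrow> p \<in> states T \<Longrightarrow> q \<in> states T
    \<Longrightarrow> next_state_word T w p = next_state_word T w q"
  unfolding synchronizing_at_level_def by blast

lemma synchronizing_word:
  assumes "synchronizing_at_level n T k" "is_transducer n T" "w \<in> words n" "k \<le> length w"
    "p \<in> states T" "q \<in> states T"
  shows "next_state_word T w p = next_state_word T w q"
proof -
  let ?u = "take (length w - k) w" and ?v = "drop (length w - k) w"
  have *: "?u \<in> words n" "?v \<in> words n" "length ?v = k"
    using assms(3,4) by (auto dest: in_set_takeD in_set_dropD)
  have "next_state_word T ?v (next_state_word T ?u p) = next_state_word T ?v (next_state_word T ?u q)"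
    using assms(1) * transducer_word(1)[OF assms(2) _ *(1)] assms(5,6)
    unfolding synchronizing_at_level_def by blast
  then show ?thesis by (simp only: next_state_word_append[symmetric] append_take_drop_id)
qed

lemma synchronizing_at_level_mono:
  assumes "synchronizing_at_level n T k" "is_transducer n T" "k \<le> m"
  shows "synchronizing_at_level n T m"
  unfolding synchronizing_at_level_def
proof (intro ballI impI)
  fix w p q assume "w \<in> words n" "length w = m" "p \<in> states T" "q \<in> states T"
  then show "next_state_word T w p = next_state_word T w q"
    using assms(3) by (intro synchronizing_word[OF assms(1,2)]) simp_all
qed

lemma finite_words_length: "finite {w \<in> words n. length w = k}"
  using finite_lists_length_eq[of "{..<n}" k] by (simp add: lists_eq_set)

text \<open>One synchronizing level suffices to compute the core. A word of any other level can be padded on the left without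
  changing the state that it leads to, and then only its last \<open>k\<close> letters matter.\<close>

lemma core_states_eq:
  assumes "synchronizing_at_level n T k" "is_transducer n T" "n > 0"
  shows "core_states n T = {next_state_word T w q | w q. w \<in> words n \<and> length w = k \<and> q \<in> states T}"
proof (intro equalityI subsetI)
  fix s assume "s \<in> core_states n T"
  then obtain w q m where w: "synchronizing_at_level n T m" "w \<in> words n" "length w = m" "q \<in> states T"
    "s = next_state_word T w q" unfolding core_states_def by blast
  \<comment> \<open>Padding on the left with \<open>k\<close> zeros makes the word long enough.\<close>
  define v where "v = replicate k 0 @ w"
  have v: "v \<in> words n" "length v \<ge> k" "length v \<ge> m" using w assms(3) by (auto simp: v_def)
  have "s = next_state_word T v q"
  proof -
    have "next_state_word T (replicate k 0) q \<in> states T"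
      by (rule transducer_word(1)[OF assms(2) w(4)]) (use assms(3) in auto)
    then have "next_state_word T w (next_state_word T (replicate k 0) q) = next_state_word T w q"
      using w(3) by (intro synchronizing_word[OF w(1) assms(2) w(2) _ _ w(4)]) simp_all
    then show ?thesis using w(5) by (simp add: v_def)
  qed
  also have "\<dots> = next_state_word T (take (length v - k) v @ drop (length v - k) v) q"
    by (simp only: append_take_drop_id)
  finally have "s = next_state_word T (drop (length v - k) v) (next_state_word T (take (length v - k) v) q)"
    by (simp only: next_state_word_append)
  moreover have "take (length v - k) v \<in> words n" "drop (length v - k) v \<in> words n"
      "length (drop (length v - k) v) = k"
    using v by (auto dest: in_set_takeD in_set_dropD)
  ultimately show "s \<in> {next_state_word T w q | w q. w \<in> words n \<and> length w = k \<and> q \<in> states T}"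
    using transducer_word(1)[OF assms(2) w(4)] by blast
qed (use assms in \<open>auto simp: core_states_def\<close>)

lemma finite_core_states:
  assumes "strongly_synchronizing n T" "is_transducer n T" "n > 0"
  shows "finite (core_states n T)"
proof -
  obtain k where k: "synchronizing_at_level n T k" using assms by (auto simp: strongly_synchronizing_def)
  obtain p where p: "p \<in> states T" using assms by (auto simp: is_transducer_def)
  have "core_states n T \<subseteq> (\<lambda>w. next_state_word T w p) ` {w \<in> words n. length w = k}"
  proof
    fix t assume "t \<in> core_states n T"
    then obtain w q where w: "w \<in> words n" "length w = k" "q \<in> states T" "t = next_state_word T w q"
      unfolding core_states_eq[OF k assms(2,3)] by blast
    have "t = next_state_word T w p"
      unfolding w(4) by (rule synchronizing_at_levelD[OF k w(1-3) p])
    then show "t \<in> (\<lambda>w. next_state_word T w p) ` {w \<in> words n. length w = k}" using w(1,2) by blast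
  qed
  then show ?thesis by (rule finite_subset) (intro finite_imageI finite_words_length)
qed

lemma core_simps [simp]:
  "states (core n T) = core_states n T" "next_state (core n T) = next_state T" "out (core n T) = out T"
  "next_state_word (core n T) w q = next_state_word T w q" "output_word (core n T) w q = output_word T w q"
  "induced_map (core n T) = induced_map T" "state_image n (core n T) = state_image n T"
  "common_prefix n (core n T) = common_prefix n T"
  by (simp_all add: core_def state_image_def[abs_def] common_prefix_def[abs_def])

text \<open>The core is closed under transitions because one more letter gives a word of level \<open>k + 1\<close>, and it is strongly
  connected because the word that defines a state leads there from everywhere.\<close>

lemma core_is_transducer:
  assumes "strongly_synchronizing n T" "is_transducer n T" "n > 0"
  shows "is_transducer n (core n T)" "core_states n T \<subseteq> states T"
    "strongly_synchronizing n (core n T)" "strongly_connected n (core n T)" "is_core n (core n T)"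
proof -
  obtain k where k: "synchronizing_at_level n T k" using assms by (auto simp: strongly_synchronizing_def)
  have k': "synchronizing_at_level n T (Suc k)" by (rule synchronizing_at_level_mono[OF k assms(2)]) simp
  obtain p where p: "p \<in> states T" using assms by (auto simp: is_transducer_def)
  note eq = core_states_eq[OF k assms(2,3)] and eq' = core_states_eq[OF k' assms(2,3)]
  show sub: "core_states n T \<subseteq> states T"
    unfolding eq using transducer_word(1)[OF assms(2)] by blast
  have "replicate k 0 \<in> words n" "length (replicate k (0::nat)) = k" using assms(3) by auto
  then have "next_state_word T (replicate k 0) p \<in> core_states n T" unfolding eq using p by blast
  then have ne: "core_states n T \<noteq> {}" by blast
  have step: "next_state T a s \<in> core_states n T" if s: "s \<in> core_states n T" and a: "a < n" for s a
  proof -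
    obtain w q where w: "w \<in> words n" "length w = k" "q \<in> states T" "s = next_state_word T w q"
      using s unfolding eq by blast
    have "next_state T a s = next_state_word T (w @ [a]) q" using w by simp
    moreover have "w @ [a] \<in> words n" "length (w @ [a]) = Suc k" using w a by auto
    ultimately show ?thesis using w(3) unfolding eq' by blast
  qed
  show tr: "is_transducer n (core n T)"
    using assms(2) ne step sub countable_subset[OF sub] unfolding is_transducer_def
    by (auto simp: subset_iff)
  have kc: "synchronizing_at_level n (core n T) k"
    unfolding synchronizing_at_level_def
  proof (intro ballI impI)
    fix w p q assume "w \<in> words n" "length w = k" "p \<in> states (core n T)" "q \<in> states (core n T)"
    then show "next_state_word (core n T) w p = next_state_word (core n T) w q"
      using synchronizing_at_levelD[OF k, of w p q] sub by auto
  qed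
  then show "strongly_synchronizing n (core n T)" by (auto simp: strongly_synchronizing_def)
  show "strongly_connected n (core n T)"
    unfolding strongly_connected_def
  proof (intro ballI)
    fix s t assume s: "s \<in> states (core n T)" and t: "t \<in> states (core n T)"
    obtain w q where w: "w \<in> words n" "length w = k" "q \<in> states T" "t = next_state_word T w q"
      using t unfolding core_simps eq by blast
    have "next_state_word (core n T) w s = t"
      using synchronizing_at_levelD[OF k w(1,2) _ w(3), of s] s sub w(4) by auto
    then show "\<exists>w\<in>words n. next_state_word (core n T) w s = t" using w by blast
  qed
  have "core_states n (core n T) = core_states n T"
  proof (intro equalityI subsetI)
    fix t assume "t \<in> core_states n (core n T)"
    then show "t \<in> core_states n T"
      unfolding core_states_eq[OF kc tr assms(3)] using transducer_word(1)[OF tr] by auto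
  next
    fix t assume "t \<in> core_states n T"
    then obtain w q where w: "w \<in> words n" "length w = k" "q \<in> states T" "t = next_state_word T w q"
      unfolding eq by blast
    obtain s where s: "s \<in> core_states n T" using ne by blast
    have "t = next_state_word (core n T) w s"
      using synchronizing_at_levelD[OF k w(1,2) _ w(3), of s] s sub w(4) by auto
    then show "t \<in> core_states n (core n T)"
      unfolding core_states_eq[OF kc tr assms(3)] using w(1,2) s by auto
  qed
  then show "is_core n (core n T)" unfolding is_core_def by (simp add: core_def)
qed

section \<open>Injective maps with clopen images\<close>

lemma SO_D:
  assumes "is_SO_transducer n T"
  shows "is_transducer n T" "strongly_synchronizing n T" "is_core n T" "strongly_connected n T"
    "\<And>q. q \<in> states T \<Longrightarrow> \<not> incomplete_response n T q"
    "\<And>p q. p \<in> states T \<Longrightarrow> q \<in> states T \<Longrightarrow> omega_equiv n T p q \<Longrightarrow> p = q"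
    "\<And>q. q \<in> states T \<Longrightarrow> inj_on (induced_map T q) (sequences n)"
    "\<And>q. q \<in> states T \<Longrightarrow> openin (sequence_space n) (state_image n T q)"
    "\<And>q. q \<in> states T \<Longrightarrow> closedin (sequence_space n) (state_image n T q)"
  using assms unfolding is_SO_transducer_def minimal_transducer_def by blast+

lemma is_core_iff: "is_core n T \<longleftrightarrow> core_states n T = states T"
proof
  assume "is_core n T"
  then have "states (core n T) = states T" by (simp only: is_core_def)
  then show "core_states n T = states T" by (simp only: core_simps)
qed (simp add: is_core_def core_def)

lemma SO_finite_states:
  assumes "is_SO_transducer n T" "n > 0" shows "finite (states T)"
  using finite_core_states[OF SO_D(2,1)[OF assms(1)] assms(2)] SO_D(3)[OF assms(1)]
  by (simp add: is_core_iff)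

lemma transducer_state_ex: "is_transducer n T \<Longrightarrow> \<exists>q. q \<in> states T"
  by (auto simp: is_transducer_def)

lemma compact_sequence_space: "compact_space (sequence_space n)"
  unfolding sequence_space_def
  by (rule compact_space_product_topology[THEN iffD2]) (simp add: compact_space_discrete_topology)

text \<open>Every infinite input has infinite output, and by compactness of the sequence space long inputs have uniformly long
  outputs. This is what makes products synchronizing.\<close>

lemma output_length_uniform:
  assumes "is_transducer n T" "q \<in> states T" "n > 0"
  obtains k where "\<And>w. w \<in> words n \<Longrightarrow> k \<le> length w \<Longrightarrow> N \<le> length (output_word T w q)"
proof -
  define V where "V k = {x \<in> sequences n. N \<le> length (output_word T (seq_take k x) q)}" for k
  have V: "openin (sequence_space n) (V k)" for k
    unfolding openin_sequence_space
  proof (intro conjI ballI)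
    fix x assume "x \<in> V k"
    then show "\<exists>M. \<forall>y\<in>sequences n. seq_take M y = seq_take M x \<longrightarrow> y \<in> V k"
      by (intro exI[of _ k]) (simp add: V_def)
  qed (auto simp: V_def)
  have mono: "V k \<subseteq> V m" if km: "k \<le> m" for k m
  proof
    fix x assume x: "x \<in> V k"
    obtain v where "output_word T (seq_take m x) q = output_word T (seq_take k x) q @ v"
      using output_word_seq_take_mono[OF km] .
    then show "x \<in> V m" using x by (simp add: V_def)
  qed
  have "topspace (sequence_space n) \<subseteq> \<Union>(range V)"
    using assms(1,2) unfolding is_transducer_def V_def by blast
  then obtain F where F: "finite F" "F \<subseteq> range V" "topspace (sequence_space n) \<subseteq> \<Union>F"
    using compact_sequence_space[of n] V unfolding compact_space_alt by (metis (no_types, lifting) imageE)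
  then obtain K where K: "finite K" "F = V ` K" by (meson finite_subset_image)
  obtain k where k: "\<And>i. i \<in> K \<Longrightarrow> i \<le> k" using K(1) by (meson finite_nat_set_iff_bounded_le)
  have *: "sequences n \<subseteq> V k" using F(3) mono k K by blast
  have "N \<le> length (output_word T w q)" if w: "w \<in> words n" "k \<le> length w" for w
  proof -
    have "w \<frown> (\<lambda>_. 0) \<in> sequences n" using w assms(3) const_in_sequences[of 0 n] by simp
    then have "w \<frown> (\<lambda>_. 0) \<in> V k" using * by (rule rev_subsetD)
    then have "N \<le> length (output_word T (take k w) q)" using w(2) by (simp add: V_def seq_take_eq_prefix)
    also have "output_word T w q = output_word T (take k w @ drop k w) q" by simp
    then have "length (output_word T (take k w) q) \<le> length (output_word T w q)"
      by (simp only: output_word_append length_append)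
    finally show ?thesis .
  qed
  then show ?thesis using that by blast
qed

lemma complete_response_cancel_shorter:
  assumes len: "length u \<le> length v"
    and eq: "\<And>x. x \<in> sequences n \<Longrightarrow> u \<frown> induced_map T p x = v \<frown> induced_map T' q x"
    and cp: "\<not> incomplete_response n T p" and ne: "sequences n \<noteq> {}"
  shows "u = v"
proof -
  have *: "is_prefix_of (drop (length u) v) (induced_map T p x) \<and> u @ drop (length u) v = v"
    if x: "x \<in> sequences n" for x
  proof -
    from conc_eq_conc_longer[OF eq[OF x] len] obtain w
      where "v = u @ w" "induced_map T p x = w \<frown> induced_map T' q x" .
    then show "is_prefix_of (drop (length u) v) (induced_map T p x) \<and> u @ drop (length u) v = v"
      by simp
  qed
  then have "drop (length u) v = []"
    using cp unfolding incomplete_response_def state_image_def by blast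
  then show "u = v" using ne * by (metis append_Nil2 ex_in_conv)
qed

text \<open>A state of complete response remembers no prefix: if its map agrees with another one up to prefixes, then the
  prefixes agree as well, since any excess would be a common prefix of one of the images.\<close>

lemma complete_response_cancel:
  assumes eq: "\<And>x. x \<in> sequences n \<Longrightarrow> u \<frown> induced_map T p x = v \<frown> induced_map T' q x"
    and cp: "\<not> incomplete_response n T p" and cq: "\<not> incomplete_response n T' q"
    and ne: "sequences n \<noteq> {}"
  shows "u = v" "\<And>x. x \<in> sequences n \<Longrightarrow> induced_map T p x = induced_map T' q x"
proof -
  show uv: "u = v"
  proof (cases "length u \<le> length v")
    case True
    then show ?thesis using complete_response_cancel_shorter[OF True eq cp ne] by blast
  next
    case False
    then have "length v \<le> length u" by simp
    from complete_response_cancel_shorter[OF this eq[symmetric] cq ne] show ?thesis by blast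
  qed
  show "induced_map T p x = induced_map T' q x" if "x \<in> sequences n" for x
    using eq[OF that] unfolding uv by (simp only: same_concat_eq)
qed

text \<open>Induced maps are open, because the image of a cone is a prefix attached to the image of another state.\<close>

lemma openin_induced_map_image:
  assumes "is_transducer n T" "\<And>q. q \<in> states T \<Longrightarrow> openin (sequence_space n) (state_image n T q)"
    "q \<in> states T" "openin (sequence_space n) S"
  shows "openin (sequence_space n) (induced_map T q ` S)"
proof (subst openin_subopen, intro ballI)
  fix y assume "y \<in> induced_map T q ` S"
  then obtain x where x: "x \<in> S" "y = induced_map T q x" by blast
  obtain N where N: "\<And>z. z \<in> sequences n \<Longrightarrow> seq_take N z = seq_take N x \<Longrightarrow> z \<in> S"
    using assms(4) x(1) unfolding openin_sequence_space by blast
  have xs: "x \<in> sequences n" using assms(4) x(1) openin_subset by blast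
  let ?w = "seq_take N x"
  let ?I = "(\<frown>) (output_word T ?w q) ` state_image n T (next_state_word T ?w q)"
  have w: "?w \<in> words n" using xs by simp
  note p = transducer_word[OF assms(1,3) w]
  have "openin (sequence_space n) ?I" by (rule openin_conc_image[OF assms(2)[OF p(1)] p(2)])
  moreover have "y \<in> ?I"
  proof -
    have "x = ?w \<frown> suffix N x" by (simp add: seq_take_eq_prefix)
    then have "y = output_word T ?w q \<frown> induced_map T (next_state_word T ?w q) (suffix N x)"
      using induced_map_conc[OF assms(1,3) w suffix_in_sequences[OF xs, of N]] x(2) by metis
    then show ?thesis using xs by (auto simp: state_image_def)
  qed
  moreover have "?I \<subseteq> induced_map T q ` S"
  proof
    fix z assume "z \<in> ?I"
    then obtain x' where x': "x' \<in> sequences n"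
      "z = output_word T ?w q \<frown> induced_map T (next_state_word T ?w q) x'" by (auto simp: state_image_def)
    have "z = induced_map T q (?w \<frown> x')" using induced_map_conc[OF assms(1,3) w x'(1)] x'(2) by simp
    moreover have "?w \<frown> x' \<in> S" by (rule N) (use x' w in \<open>simp_all add: seq_take_eq_prefix\<close>)
    ultimately show "z \<in> induced_map T q ` S" by blast
  qed
  ultimately show "\<exists>A. openin (sequence_space n) A \<and> y \<in> A \<and> A \<subseteq> induced_map T q ` S" by blast
qed

text \<open>The complement of the image of \<open>S\<close> consists of the complement of the image of the map and, by injectivity, of
  the image of the complement of \<open>S\<close>; both are open.\<close>

lemma closedin_induced_map_image:
  assumes "is_SO_transducer n T" "q \<in> states T" "openin (sequence_space n) S" "closedin (sequence_space n) S"
  shows "closedin (sequence_space n) (induced_map T q ` S)"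
proof -
  have S: "S \<subseteq> sequences n" using assms(3) openin_subset by blast
  note op = openin_induced_map_image[OF SO_D(1)[OF assms(1)] SO_D(8)[OF assms(1)] assms(2)]
  have "sequences n - induced_map T q ` S
      = (sequences n - state_image n T q) \<union> induced_map T q ` (sequences n - S)"
    using inj_onD[OF SO_D(7)[OF assms(1,2)]] S induced_map_in_sequences[OF SO_D(1)[OF assms(1)] assms(2)]
    unfolding state_image_def by blast
  moreover have "openin (sequence_space n) \<dots>"
    using SO_D(9)[OF assms(1,2)] op[of "sequences n - S"] assms(4) unfolding closedin_def by blast
  moreover have "induced_map T q ` S \<subseteq> sequences n"
    using S induced_map_in_sequences[OF SO_D(1)[OF assms(1)] assms(2)] by blast
  ultimately show ?thesis by (simp add: closedin_def)
qed

lemma SO_image_nontrivial: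
  assumes "n \<ge> 2" "is_transducer n T" "q \<in> states T" "inj_on (induced_map T q) (sequences n)"
  obtains y z where "y \<in> state_image n T q" "z \<in> state_image n T q" "y \<noteq> z"
proof -
  have *: "(\<lambda>_. 0) \<in> sequences n" "(\<lambda>_. 1) \<in> sequences n" using assms(1) by (simp_all add: sequences_eq)
  have "(\<lambda>_::nat. 0::nat) \<noteq> (\<lambda>_. 1)" by (simp add: fun_eq_iff)
  then have "induced_map T q (\<lambda>_. 0) \<noteq> induced_map T q (\<lambda>_. 1)"
    using inj_onD[OF assms(4) _ *] by blast
  then show ?thesis using that * unfolding state_image_def by blast
qed

section \<open>Products\<close>

lemma product_transducer_simps [simp]:
  "states (product_transducer T U) = states T \<times> states U"
  "next_state (product_transducer T U) a (p, q) = (next_state T a p, next_state_word U (out T a p) q)"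
  "out (product_transducer T U) a (p, q) = output_word U (out T a p) q"
  by (simp_all add: product_transducer_def)

lemma product_word:
  "next_state_word (product_transducer T U) w (p, q)
    = (next_state_word T w p, next_state_word U (output_word T w p) q)"
  "output_word (product_transducer T U) w (p, q) = output_word U (output_word T w p) q"
  by (induction w arbitrary: p q) simp_all

lemma product_is_transducer:
  assumes T: "is_transducer n T" and U: "is_transducer n U"
  shows "is_transducer n (product_transducer T U)"
proof -
  have "\<exists>k. N \<le> length (output_word (product_transducer T U) (seq_take k x) s)"
    if s: "s \<in> states T \<times> states U" and x: "x \<in> sequences n" for s x N
  proof -
    obtain p q where pq: "s = (p, q)" "p \<in> states T" "q \<in> states U" using s by blast
    let ?y = "induced_map T p x"
    have "?y \<in> sequences n" using T pq x by simp
    then obtain k where k: "N \<le> length (output_word U (seq_take k ?y) q)"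
      using U pq unfolding is_transducer_def by blast
    obtain m where m: "k \<le> length (output_word T (seq_take m x) p)"
      using T pq x unfolding is_transducer_def by blast
    have "output_word T (seq_take m x) p = seq_take (length (output_word T (seq_take m x) p)) ?y"
      using is_prefix_of_induced_map[OF T pq(2) x, of m] by (simp add: is_prefix_of_def)
    then obtain v where "output_word U (output_word T (seq_take m x) p) q = output_word U (seq_take k ?y) q @ v"
      using output_word_seq_take_mono[OF m] by metis
    then show ?thesis using k by (intro exI[of _ m]) (simp add: pq product_word)
  qed
  moreover have "countable (states T \<times> states U)" "states T \<times> states U \<noteq> {}"
    using T U by (auto simp: is_transducer_def)
  moreover have "next_state (product_transducer T U) a s \<in> states T \<times> states U
      \<and> out (product_transducer T U) a s \<in> words n" if "a < n" "s \<in> states T \<times> states U" for a s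
    using that transducer_step[OF T] transducer_word[OF U] by (cases s) simp
  ultimately show ?thesis unfolding is_transducer_def product_transducer_simps by blast
qed

lemma product_induced_map:
  assumes T: "is_transducer n T" and U: "is_transducer n U" and pq: "p \<in> states T" "q \<in> states U"
    and x: "x \<in> sequences n"
  shows "induced_map (product_transducer T U) (p, q) x = induced_map U q (induced_map T p x)"
proof (rule induced_map_unique[OF product_is_transducer[OF T U] _ x])
  show "(p, q) \<in> states (product_transducer T U)" using pq by simp
  fix k
  let ?u = "output_word T (seq_take k x) p"
  obtain z where z: "induced_map T p x = ?u \<frown> z"
    using is_prefix_of_induced_map[OF T pq(1) x] unfolding is_prefix_of_iff by blast
  have "?u \<frown> z \<in> sequences n" using induced_map_in_sequences[OF T pq(1) x] unfolding z .
  then have "induced_map U q (?u \<frown> z) = output_word U ?u q \<frown> induced_map U (next_state_word U ?u q) z"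
    by (intro induced_map_conc[OF U pq(2)]) simp_all
  then show "is_prefix_of (output_word (product_transducer T U) (seq_take k x) (p, q))
      (induced_map U q (induced_map T p x))"
    by (simp add: product_word z)
qed

text \<open>A word that synchronizes \<open>T\<close>, followed by one that is long enough for its output to synchronize \<open>U\<close> whatever
  state \<open>T\<close> is in, synchronizes the product.\<close>

lemma product_strongly_synchronizing:
  assumes T: "is_transducer n T" and U: "is_transducer n U" and fin: "finite (states T)"
    and sT: "strongly_synchronizing n T" and sU: "strongly_synchronizing n U" and n: "n > 0"
  shows "strongly_synchronizing n (product_transducer T U)"
proof -
  obtain j where j: "synchronizing_at_level n T j" using sT by (auto simp: strongly_synchronizing_def)
  obtain k where k: "synchronizing_at_level n U k" using sU by (auto simp: strongly_synchronizing_def)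
  have "\<exists>m. \<forall>w\<in>words n. m \<le> length w \<longrightarrow> k \<le> length (output_word T w p)" if "p \<in> states T" for p
    using output_length_uniform[OF T that n] by metis
  then obtain f where f: "\<And>p w. p \<in> states T \<Longrightarrow> w \<in> words n \<Longrightarrow> f p \<le> length w \<Longrightarrow> k \<le> length (output_word T w p)"
    by metis
  obtain m where m: "\<And>p. p \<in> states T \<Longrightarrow> f p \<le> m"
    using fin by (metis finite_imageI finite_nat_set_iff_bounded_le imageI)
  have "synchronizing_at_level n (product_transducer T U) (j + m)"
    unfolding synchronizing_at_level_def
  proof (intro ballI impI)
    fix w s t assume w: "w \<in> words n" "length w = j + m"
      and s: "s \<in> states (product_transducer T U)" and t: "t \<in> states (product_transducer T U)"
    obtain p q p' q' where st: "s = (p, q)" "t = (p', q')" "p \<in> states T" "p' \<in> states T"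
      "q \<in> states U" "q' \<in> states U" using s t by auto
    define u v where "u = take j w" and "v = drop j w"
    have uv: "w = u @ v" "length u = j" "length v = m" using w by (simp_all add: u_def v_def)
    have uw: "u \<in> words n" "v \<in> words n" using w uv(1) by auto
    have r: "next_state_word T u p = next_state_word T u p'"
      by (rule synchronizing_at_levelD[OF j uw(1) uv(2) st(3,4)])
    define r where "r = next_state_word T u p"
    have rT: "r \<in> states T" unfolding r_def by (rule transducer_word(1)[OF T st(3) uw(1)])
    have "k \<le> length (output_word T v r)" by (rule f[OF rT uw(2)]) (use m[OF rT] uv in simp)
    then have "next_state_word U (output_word T v r) (next_state_word U (output_word T u p) q)
        = next_state_word U (output_word T v r) (next_state_word U (output_word T u p') q')"
      by (intro synchronizing_word[OF k U transducer_word(2)[OF T rT uw(2)]]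
          transducer_word(1)[OF U] transducer_word(2)[OF T] st uw)
    then show "next_state_word (product_transducer T U) w s = next_state_word (product_transducer T U) w t"
      unfolding st product_word uv(1) next_state_word_append output_word_append r[symmetric] r_def by simp
  qed
  then show ?thesis by (auto simp: strongly_synchronizing_def)
qed

section \<open>Removing incomplete response\<close>

lemma remove_incomplete_response_simps [simp]:
  "states (remove_incomplete_response n T) = states T"
  "next_state (remove_incomplete_response n T) = next_state T"
  by (simp_all add: remove_incomplete_response_def)

lemma next_state_word_cong: "next_state T = next_state T' \<Longrightarrow> next_state_word T w q = next_state_word T' w q"
  by (induction w arbitrary: q) simp_all

lemma remove_incomplete_response_next_word [simp]:
  "next_state_word (remove_incomplete_response n T) w q = next_state_word T w q"
  by (rule next_state_word_cong) simp

text \<open>The new output along a word \<open>w\<close>, prefixed with \<open>\<Lambda>(q)\<close>, is the old output followed by \<open>\<Lambda>(\<pi>(w,q))\<close>. For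
  one letter \<open>a\<close> this says that \<open>\<Lambda>(q)\<close> is a prefix of \<open>\<lambda>(a,q) \<Lambda>(\<pi>(a,q))\<close>: what remains of \<open>\<Lambda>(q)\<close> after the
  output is a common prefix of the image of the next state.\<close>

lemma remove_incomplete_response:
  assumes T: "is_transducer n T" and n: "n > 0"
    and nt: "\<forall>q\<in>states T. \<exists>y\<in>state_image n T q. \<exists>z\<in>state_image n T q. y \<noteq> z"
  shows "is_transducer n (remove_incomplete_response n T)" (is "is_transducer n ?V")
    and "q \<in> states T \<Longrightarrow> x \<in> sequences n \<Longrightarrow>
       common_prefix n T q \<frown> induced_map (remove_incomplete_response n T) q x = induced_map T q x"
    and "q \<in> states T \<Longrightarrow> \<not> incomplete_response n (remove_incomplete_response n T) q"
    and "q \<in> states T \<Longrightarrow> common_prefix n T q \<in> words n"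
proof -
  let ?L = "common_prefix n T"
  have pre: "is_prefix_of (?L q) (induced_map T q x)" if "q \<in> states T" "x \<in> sequences n" for q x
    using bspec[OF nt that(1)] common_prefix_longest(1)[of _ n T q] that(2) unfolding state_image_def by blast
  have longest: "length u \<le> length (?L q)"
    if "q \<in> states T" "\<And>x. x \<in> sequences n \<Longrightarrow> is_prefix_of u (induced_map T q x)" for q u
    using bspec[OF nt that(1)] common_prefix_longest(2)[of _ n T q _ u] that(2) unfolding state_image_def by blast
  have zero: "(\<lambda>_. 0) \<in> sequences n" using n by (simp add: sequences_eq)
  have Lw: "?L q \<in> words n" if q: "q \<in> states T" for q
  proof -
    obtain z where "induced_map T q (\<lambda>_. 0) = ?L q \<frown> z" using pre[OF q zero] is_prefix_of_iff by blast
    then show ?thesis using induced_map_in_sequences[OF T q zero] by simp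
  qed
  then show "q \<in> states T \<Longrightarrow> ?L q \<in> words n" .
  have step: "out T a q @ ?L (next_state T a q) = ?L q @ out ?V a q" if q: "q \<in> states T" and a: "a < n" for a q
  proof -
    let ?q = "next_state T a q"
    have q': "?q \<in> states T" by (rule transducer_step[OF T q a])
    have "length (drop (length (out T a q)) (?L q)) \<le> length (?L ?q)"
    proof (rule longest[OF q'])
      fix x assume x: "x \<in> sequences n"
      obtain z where z: "induced_map T q (a ## x) = ?L q \<frown> z"
        using pre[OF q, of "a ## x"] a x is_prefix_of_iff by auto
      then have e: "out T a q \<frown> induced_map T ?q x = ?L q \<frown> z"
        using induced_map_build[OF T q a x] by simp
      show "is_prefix_of (drop (length (out T a q)) (?L q)) (induced_map T ?q x)"
      proof (cases "length (out T a q) \<le> length (?L q)")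
        case True
        from conc_eq_conc_longer[OF e True] obtain w where "?L q = out T a q @ w" "induced_map T ?q x = w \<frown> z" .
        then show ?thesis by simp
      qed (simp add: is_prefix_of_nth)
    qed
    then have len: "length (?L q) \<le> length (out T a q @ ?L ?q)" by simp
    obtain z z' where z: "induced_map T q (a ## (\<lambda>_. 0)) = ?L q \<frown> z" "induced_map T ?q (\<lambda>_. 0) = ?L ?q \<frown> z'"
      using pre[OF q, of "a ## (\<lambda>_. 0)"] pre[OF q' zero] a zero is_prefix_of_iff by auto
    have "?L q \<frown> z = (out T a q @ ?L ?q) \<frown> z'"
      using induced_map_build[OF T q a zero] z by simp
    from conc_eq_conc_longer[OF this len] obtain w where "out T a q @ ?L ?q = ?L q @ w" .
    moreover have "out ?V a q = drop (length (?L q)) (out T a q @ ?L ?q)"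
      by (simp add: remove_incomplete_response_def)
    ultimately show ?thesis by (metis append_eq_conv_conj)
  qed
  have word: "output_word T w q @ ?L (next_state_word T w q) = ?L q @ output_word ?V w q"
    if "q \<in> states T" "w \<in> words n" for w q
    using that
  proof (induction w arbitrary: q)
    case (Cons a w)
    then have a: "a < n" "w \<in> words n" by auto
    have "out T a q @ output_word T w (next_state T a q) @ ?L (next_state_word T w (next_state T a q))
       = out T a q @ ?L (next_state T a q) @ output_word ?V w (next_state T a q)"
      using Cons.IH[OF transducer_step(1)[OF T Cons.prems(1) a(1)] a(2)] by simp
    also have "\<dots> = ?L q @ out ?V a q @ output_word ?V w (next_state T a q)"
      using step[OF Cons.prems(1) a(1)] by (metis append_assoc)
    finally show ?case by simp
  qed simp
  have outV: "out ?V a q \<in> words n" if "q \<in> states T" "a < n" for a q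
  proof -
    have "out T a q @ ?L (next_state T a q) \<in> words n"
      using transducer_step[OF T that] Lw by simp
    then show ?thesis unfolding step[OF that] by simp
  qed
  show V: "is_transducer n ?V"
    unfolding is_transducer_def remove_incomplete_response_simps
  proof (intro conjI ballI allI impI)
    fix q x N assume q: "q \<in> states T" and x: "x \<in> sequences n"
    obtain k where k: "N + length (?L q) \<le> length (output_word T (seq_take k x) q)"
      using T q x unfolding is_transducer_def by blast
    have "length (output_word T (seq_take k x) q) \<le> length (?L q) + length (output_word ?V (seq_take k x) q)"
      using arg_cong[OF word[OF q seq_take_in_words[OF x, of k]], of length] by simp
    then show "\<exists>k. N \<le> length (output_word ?V (seq_take k x) q)" using k by (intro exI[of _ k]) simp
  qed (use T outV transducer_step[OF T] in \<open>auto simp: is_transducer_def\<close>)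
  have map: "?L q \<frown> induced_map ?V q x = induced_map T q x" if q: "q \<in> states T" and x: "x \<in> sequences n" for q x
  proof -
    obtain y where y: "induced_map T q x = ?L q \<frown> y" using pre[OF q x] is_prefix_of_iff by blast
    have "induced_map ?V q x = y"
    proof (rule induced_map_unique[OF V _ x])
      show "q \<in> states ?V" using q by simp
      fix k
      let ?w = "seq_take k x" let ?q = "next_state_word T ?w q"
      have w: "?w \<in> words n" using x by simp
      have sx: "suffix k x \<in> sequences n" using x by simp
      obtain z where z: "induced_map T ?q (suffix k x) = ?L ?q \<frown> z"
        using pre[OF transducer_word(1)[OF T q w] sx] is_prefix_of_iff by blast
      have "?w \<frown> suffix k x = x" by (simp add: seq_take_eq_prefix)
      then have "?L q \<frown> y = (output_word T ?w q @ ?L ?q) \<frown> z"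
        using induced_map_conc[OF T q w sx] y z by simp
      then have "?L q \<frown> y = ?L q \<frown> (output_word ?V ?w q \<frown> z)" unfolding word[OF q w] by simp
      then have "y = output_word ?V ?w q \<frown> z" by (simp only: same_concat_eq)
      then show "is_prefix_of (output_word ?V ?w q) y" by simp
    qed
    then show ?thesis using y by simp
  qed
  then show "q \<in> states T \<Longrightarrow> x \<in> sequences n \<Longrightarrow> ?L q \<frown> induced_map ?V q x = induced_map T q x" .
  show "\<not> incomplete_response n ?V q" if q: "q \<in> states T"
  proof
    assume "incomplete_response n ?V q"
    then obtain u where u: "u \<noteq> []" "\<And>x. x \<in> sequences n \<Longrightarrow> is_prefix_of u (induced_map ?V q x)"
      unfolding incomplete_response_def state_image_def by blast
    have "length (?L q @ u) \<le> length (?L q)"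
    proof (rule longest[OF q])
      fix x assume x: "x \<in> sequences n"
      obtain z where "induced_map ?V q x = u \<frown> z" using u(2)[OF x] is_prefix_of_iff by blast
      then have "induced_map T q x = (?L q @ u) \<frown> z" using map[OF q x] by simp
      then show "is_prefix_of (?L q @ u) (induced_map T q x)" by simp
    qed
    then show False using u(1) by simp
  qed
qed

section \<open>Identifying equivalent states\<close>

lemma equiv_omega_equiv_rel: "equiv (states T) (omega_equiv_rel n T)"
  unfolding equiv_def refl_on_def sym_on_def trans_def omega_equiv_rel_def omega_equiv_def by auto

abbreviation omega_class :: "nat \<Rightarrow> 'q transducer \<Rightarrow> 'q \<Rightarrow> 'q set" where
  "omega_class n T q \<equiv> omega_equiv_rel n T `` {q}"

lemma identify_states_eq: "states (identify_states n T) = omega_class n T ` states T"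
  by (auto simp: identify_states_def quotient_def)

lemma omega_class_eq_iff:
  "p \<in> states T \<Longrightarrow> q \<in> states T \<Longrightarrow> omega_class n T p = omega_class n T q \<longleftrightarrow> omega_equiv n T p q"
  using eq_equiv_class_iff[OF equiv_omega_equiv_rel[of T n]] unfolding omega_equiv_rel_def by blast

text \<open>Equivalent states of complete response have equal outputs and equivalent successors, so that passing to
  equivalence classes is independent of representatives.\<close>

lemma omega_equiv_step:
  assumes T: "is_transducer n T" and c: "\<forall>q\<in>states T. \<not> incomplete_response n T q"
    and p: "p \<in> states T" and q: "q \<in> states T" and eq: "omega_equiv n T p q" and a: "a < n"
  shows "out T a p = out T a q" "omega_equiv n T (next_state T a p) (next_state T a q)"
proof -
  have ne: "sequences n \<noteq> {}" using a by (auto simp: sequences_eq)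
  have e: "out T a p \<frown> induced_map T (next_state T a p) x = out T a q \<frown> induced_map T (next_state T a q) x"
    if "x \<in> sequences n" for x
  proof -
    have "a ## x \<in> sequences n" using a that by simp
    then have "induced_map T p (a ## x) = induced_map T q (a ## x)" using eq unfolding omega_equiv_def by blast
    then show ?thesis unfolding induced_map_build[OF T p a that] induced_map_build[OF T q a that] .
  qed
  note cancel = complete_response_cancel[OF e bspec[OF c transducer_step(1)[OF T p a]] bspec[OF c transducer_step(1)[OF T q a]] ne]
  show "out T a p = out T a q" by (rule cancel(1))
  show "omega_equiv n T (next_state T a p) (next_state T a q)"
    unfolding omega_equiv_def by (intro ballI) (rule cancel(2))
qed

lemma identify_states_step:
  assumes T: "is_transducer n T" and c: "\<forall>q\<in>states T. \<not> incomplete_response n T q"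
    and q: "q \<in> states T" and a: "a < n"
  shows "next_state (identify_states n T) a (omega_class n T q) = omega_class n T (next_state T a q)"
    "out (identify_states n T) a (omega_class n T q) = out T a q"
proof -
  define r where "r = (SOME r. r \<in> omega_class n T q)"
  have "r \<in> omega_class n T q" unfolding r_def
    by (rule someI[of "\<lambda>r. r \<in> omega_class n T q"])
       (rule equiv_class_self[OF equiv_omega_equiv_rel q])
  then have r: "r \<in> states T" "omega_equiv n T q r" unfolding omega_equiv_rel_def by auto
  note st = omega_equiv_step[OF T c q r(1) r(2) a]
  have "out (identify_states n T) a (omega_class n T q) = out T a r"
    "next_state (identify_states n T) a (omega_class n T q) = omega_class n T (next_state T a r)"
    by (simp_all add: identify_states_def r_def)
  then show "out (identify_states n T) a (omega_class n T q) = out T a q"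
    "next_state (identify_states n T) a (omega_class n T q) = omega_class n T (next_state T a q)"
    using st(1) omega_class_eq_iff[OF transducer_step(1)[OF T q a] transducer_step(1)[OF T r(1) a], of n] st(2)
    by metis+
qed

lemma identify_states_word:
  assumes T: "is_transducer n T" and c: "\<forall>q\<in>states T. \<not> incomplete_response n T q"
    and "q \<in> states T" "w \<in> words n"
  shows "next_state_word (identify_states n T) w (omega_class n T q) = omega_class n T (next_state_word T w q)
     \<and> output_word (identify_states n T) w (omega_class n T q) = output_word T w q"
  using assms(3,4)
proof (induction w arbitrary: q)
  case (Cons a w)
  then have a: "a < n" "w \<in> words n" by auto
  show ?case
    using identify_states_step[OF T c Cons.prems(1) a(1)]
      Cons.IH[OF transducer_step(1)[OF T Cons.prems(1) a(1)] a(2)] by simp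
qed simp

text \<open>The last equation shows that the quotient of a core transducer is again core; the final core in the reduced product
  therefore removes no states.\<close>

lemma identify_states:
  assumes T: "is_transducer n T" and c: "\<forall>q\<in>states T. \<not> incomplete_response n T q"
    and s: "strongly_synchronizing n T" and core: "is_core n T" and n: "n > 0"
  shows "is_transducer n (identify_states n T)" "strongly_synchronizing n (identify_states n T)"
    "q \<in> states T \<Longrightarrow> x \<in> sequences n \<Longrightarrow> induced_map (identify_states n T) (omega_class n T q) x = induced_map T q x"
    "core_states n (identify_states n T) = omega_class n T ` states T"
proof -
  let ?I = "identify_states n T"
  note word = identify_states_word[OF T c]
  have "countable (states ?I) \<and> states ?I \<noteq> {}"
    using T unfolding identify_states_eq is_transducer_def by auto
  moreover have "next_state ?I a C \<in> states ?I \<and> out ?I a C \<in> words n" if C: "C \<in> states ?I" and a: "a < n" for C a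
  proof -
    obtain q where q: "q \<in> states T" "C = omega_class n T q" using C unfolding identify_states_eq by blast
    show ?thesis
      unfolding q(2) identify_states_step[OF T c q(1) a] identify_states_eq
      using transducer_step[OF T q(1) a] by blast
  qed
  moreover have "\<exists>k. N \<le> length (output_word ?I (seq_take k x) C)" if C: "C \<in> states ?I" and x: "x \<in> sequences n" for C x N
  proof -
    obtain q where q: "q \<in> states T" "C = omega_class n T q" using C unfolding identify_states_eq by blast
    show ?thesis using word[OF q(1) seq_take_in_words[OF x]] T q x unfolding is_transducer_def by auto
  qed
  ultimately show I: "is_transducer n ?I" unfolding is_transducer_def by blast
  obtain k where k: "synchronizing_at_level n T k" using s by (auto simp: strongly_synchronizing_def)
  have kI: "synchronizing_at_level n ?I k"
    unfolding synchronizing_at_level_def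
  proof (intro ballI impI)
    fix w C D assume w: "w \<in> words n" "length w = k" and C: "C \<in> states ?I" and D: "D \<in> states ?I"
    obtain p where p: "p \<in> states T" "C = omega_class n T p" using C unfolding identify_states_eq by blast
    obtain q where q: "q \<in> states T" "D = omega_class n T q" using D unfolding identify_states_eq by blast
    have "next_state_word ?I w C = omega_class n T (next_state_word T w p)"
      using word[OF p(1) w(1)] p(2) by blast
    also have "next_state_word T w p = next_state_word T w q"
      by (rule synchronizing_at_levelD[OF k w p(1) q(1)])
    also have "omega_class n T (next_state_word T w q) = next_state_word ?I w D"
      using word[OF q(1) w(1)] q(2) by blast
    finally show "next_state_word ?I w C = next_state_word ?I w D" .
  qed
  then show "strongly_synchronizing n ?I" by (auto simp: strongly_synchronizing_def)
  show "induced_map ?I (omega_class n T q) x = induced_map T q x" if q: "q \<in> states T" and x: "x \<in> sequences n" for q x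
    unfolding induced_map_def using word[OF q seq_take_in_words[OF x]] by simp
  show "core_states n ?I = omega_class n T ` states T"
  proof (intro equalityI subsetI)
    fix C assume "C \<in> core_states n ?I"
    then show "C \<in> omega_class n T ` states T"
      unfolding core_states_eq[OF kI I n] identify_states_eq[symmetric] using transducer_word(1)[OF I] by blast
  next
    fix C assume "C \<in> omega_class n T ` states T"
    then obtain t where t: "t \<in> states T" "C = omega_class n T t" by blast
    then have "t \<in> core_states n T" using core by (simp add: is_core_iff)
    then obtain w q where w: "w \<in> words n" "length w = k" "q \<in> states T" "t = next_state_word T w q"
      unfolding core_states_eq[OF k T n] by blast
    have "C = next_state_word ?I w (omega_class n T q)" using word[OF w(3,1)] w(4) t(2) by simp
    then show "C \<in> core_states n ?I" unfolding core_states_eq[OF kI I n] identify_states_eq using w(1-3) by blast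
  qed
qed

section \<open>Reduced products\<close>

lemma core_states_cong:
  assumes "states T = states T'" "next_state T = next_state T'"
  shows "core_states n T = core_states n T'"
  unfolding core_states_def synchronizing_at_level_def
  using assms(1) next_state_word_cong[OF assms(2)] by simp

text \<open>The facts about the product operation that are needed below: it stays within the monoid, its state maps are
  composites of state maps of the factors with a prefix removed, and every state of the first factor occurs in it.\<close>

lemma reduced_product:
  assumes n: "n \<ge> 2" and T: "is_SO_transducer n T" and U: "is_SO_transducer n U"
  shows "is_SO_transducer n (reduced_product n T U)"
    and "C \<in> states (reduced_product n T U) \<Longrightarrow> \<exists>p\<in>states T. \<exists>q\<in>states U. \<exists>u\<in>words n. \<forall>x\<in>sequences n.
       u \<frown> induced_map (reduced_product n T U) C x = induced_map U q (induced_map T p x)"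
    and "p \<in> states T \<Longrightarrow> \<exists>q\<in>states U. \<exists>C\<in>states (reduced_product n T U). \<exists>u\<in>words n. \<forall>x\<in>sequences n.
       u \<frown> induced_map (reduced_product n T U) C x = induced_map U q (induced_map T p x)"
proof -
  have n0: "n > 0" using n by simp
  note TD = SO_D[OF T] and UD = SO_D[OF U]
  let ?P = "product_transducer T U"
  define K where "K = core n ?P"
  define V where "V = remove_incomplete_response n K"
  define I where "I = identify_states n V"
  define R where "R = core n I"
  have R: "reduced_product n T U = R" by (simp add: reduced_product_def R_def I_def V_def K_def)
  note P = product_is_transducer[OF TD(1) UD(1)]
  note Ps = product_strongly_synchronizing[OF TD(1) UD(1) SO_finite_states[OF T n0] TD(2) UD(2) n0]
  note K = core_is_transducer[OF Ps P n0, folded K_def]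
  have KP: "states K \<subseteq> states T \<times> states U" using K(2) by (simp add: K_def)
  have Kmap: "induced_map K (p, q) x = induced_map U q (induced_map T p x)"
    if "(p, q) \<in> states K" "x \<in> sequences n" for p q x
  proof -
    have "p \<in> states T" "q \<in> states U" using that(1) KP by auto
    from product_induced_map[OF TD(1) UD(1) this that(2)] show ?thesis by (simp only: K_def core_simps)
  qed
  have Kinj: "inj_on (induced_map K s) (sequences n)" if sK: "s \<in> states K" for s
  proof (rule inj_onI)
    obtain p q where s: "s = (p, q)" by (cases s)
    have pq: "p \<in> states T" "q \<in> states U" using sK KP s by auto
    fix x y assume x: "x \<in> sequences n" and y: "y \<in> sequences n" and e: "induced_map K s x = induced_map K s y"
    have "induced_map U q (induced_map T p x) = induced_map U q (induced_map T p y)"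
      using e unfolding s Kmap[OF sK[unfolded s] x] Kmap[OF sK[unfolded s] y] .
    then have "induced_map T p x = induced_map T p y"
      by (rule inj_onD[OF UD(7)[OF pq(2)]]) (rule induced_map_in_sequences[OF TD(1) pq(1)], fact)+
    then show "x = y" by (rule inj_onD[OF TD(7)[OF pq(1)] _ x y])
  qed
  have Knt: "\<forall>s\<in>states K. \<exists>y\<in>state_image n K s. \<exists>z\<in>state_image n K s. y \<noteq> z"
  proof
    fix s assume s: "s \<in> states K"
    obtain y z where "y \<in> state_image n K s" "z \<in> state_image n K s" "y \<noteq> z"
      by (rule SO_image_nontrivial[OF n K(1) s Kinj[OF s]])
    then show "\<exists>y\<in>state_image n K s. \<exists>z\<in>state_image n K s. y \<noteq> z" by blast
  qed
  note V = remove_incomplete_response[OF K(1) n0 Knt, folded V_def]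
  have Vs: "states V = states K" and Vn: "next_state V = next_state K" by (simp_all add: V_def)
  have Vw: "next_state_word V w s = next_state_word K w s" for w s by (rule next_state_word_cong[OF Vn])
  have Vsync: "strongly_synchronizing n V"
    using K(3) unfolding strongly_synchronizing_def synchronizing_at_level_def Vw Vs .
  have Vcore: "is_core n V" using K(5) core_states_cong[OF Vs Vn] Vs by (simp add: is_core_iff)
  have Vc: "\<forall>s\<in>states V. \<not> incomplete_response n V s" using V(3) Vs by blast
  note I = identify_states[OF V(1) Vc Vsync Vcore n0, folded I_def]
  note RR = core_is_transducer[OF I(2,1) n0, folded R_def]
  have Rst: "states R = omega_class n V ` states K" using I(4) Vs by (simp add: R_def)
  have Rmap: "induced_map R (omega_class n V s) x = induced_map V s x" if "s \<in> states K" "x \<in> sequences n" for s x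
    using I(3) that Vs by (simp add: R_def)
  have Rprod: "common_prefix n K (p, q) \<frown> induced_map R (omega_class n V (p, q)) x = induced_map U q (induced_map T p x)"
    if "(p, q) \<in> states K" "x \<in> sequences n" for p q x
    using Rmap[OF that] V(2)[OF that] Kmap[OF that] by simp
  have Rim: "state_image n R (omega_class n V s) = state_image n V s" if "s \<in> states K" for s
    using Rmap[OF that] unfolding state_image_def by (intro image_cong) auto
  have Vim: "state_image n V s = {y \<in> sequences n. common_prefix n K s \<frown> y \<in> state_image n K s}"
    if "s \<in> states K" for s
  proof (intro equalityI subsetI)
    fix y assume "y \<in> state_image n V s"
    then show "y \<in> {y \<in> sequences n. common_prefix n K s \<frown> y \<in> state_image n K s}"
      using V(2)[OF that] induced_map_in_sequences[OF V(1) that[folded Vs]] unfolding state_image_def by auto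
  next
    fix y assume "y \<in> {y \<in> sequences n. common_prefix n K s \<frown> y \<in> state_image n K s}"
    then obtain x where x: "x \<in> sequences n" "common_prefix n K s \<frown> y = induced_map K s x"
      unfolding state_image_def by auto
    then have "common_prefix n K s \<frown> y = common_prefix n K s \<frown> induced_map V s x" using V(2)[OF that] by simp
    then have "y = induced_map V s x" by (simp only: same_concat_eq)
    then show "y \<in> state_image n V s" using x unfolding state_image_def by blast
  qed
  have Kim: "openin (sequence_space n) (state_image n K s)" "closedin (sequence_space n) (state_image n K s)"
    if s: "s \<in> states K" for s
  proof -
    obtain p q where pq: "s = (p, q)" "p \<in> states T" "q \<in> states U" using KP s by auto
    have "state_image n K s = induced_map U q ` state_image n T p"
      using Kmap[of p q] s pq(1) unfolding state_image_def image_image by (intro image_cong) auto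
    then show "openin (sequence_space n) (state_image n K s)" "closedin (sequence_space n) (state_image n K s)"
      using openin_induced_map_image[OF UD(1) UD(8) pq(3) TD(8)[OF pq(2)]]
        closedin_induced_map_image[OF U pq(3) TD(8,9)[OF pq(2)]] by simp_all
  qed
  show "is_SO_transducer n (reduced_product n T U)"
    unfolding R is_SO_transducer_def minimal_transducer_def
  proof (intro conjI ballI impI)
    show "is_transducer n R" "strongly_connected n R" "strongly_synchronizing n R" "is_core n R"
      using RR by blast+
  next
    fix C D assume C: "C \<in> states R" and D: "D \<in> states R" and eq: "omega_equiv n R C D"
    obtain s t where st: "s \<in> states K" "t \<in> states K" "C = omega_class n V s" "D = omega_class n V t"
      using C D unfolding Rst by blast
    have "omega_equiv n V s t" using eq Rmap[OF st(1)] Rmap[OF st(2)] unfolding omega_equiv_def st(3,4) by simp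
    then show "C = D" using omega_class_eq_iff[of s V t n] st Vs by simp
  next
    fix C assume C: "C \<in> states R"
    obtain s where s: "s \<in> states K" "C = omega_class n V s" using C unfolding Rst by blast
    show "\<not> incomplete_response n R C"
      using V(3)[OF s(1)] unfolding incomplete_response_def s(2) Rim[OF s(1)] .
    show "openin (sequence_space n) (state_image n R C)"
      unfolding s(2) Rim[OF s(1)] Vim[OF s(1)] by (rule openin_conc_preimage[OF Kim(1)[OF s(1)] V(4)[OF s(1)]])
    have "sequences n - {y \<in> sequences n. common_prefix n K s \<frown> y \<in> state_image n K s}
       = {y \<in> sequences n. common_prefix n K s \<frown> y \<in> sequences n - state_image n K s}"
      using V(4)[OF s(1)] by auto
    moreover have "openin (sequence_space n) (sequences n - state_image n K s)"
      using Kim(2)[OF s(1)] unfolding closedin_def by blast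
    then have "openin (sequence_space n) {y \<in> sequences n. common_prefix n K s \<frown> y \<in> sequences n - state_image n K s}"
      by (rule openin_conc_preimage[OF _ V(4)[OF s(1)]])
    ultimately show "closedin (sequence_space n) (state_image n R C)"
      unfolding s(2) Rim[OF s(1)] Vim[OF s(1)] closedin_def by auto
    show "inj_on (induced_map R C) (sequences n)"
    proof (rule inj_onI)
      fix x y assume x: "x \<in> sequences n" and y: "y \<in> sequences n" and e: "induced_map R C x = induced_map R C y"
      then have "induced_map K s x = induced_map K s y"
        using V(2)[OF s(1) x] V(2)[OF s(1) y] Rmap[OF s(1) x] Rmap[OF s(1) y] s(2) by metis
      then show "x = y" by (rule inj_onD[OF Kinj[OF s(1)] _ x y])
    qed
  qed
  show "\<exists>p\<in>states T. \<exists>q\<in>states U. \<exists>u\<in>words n. \<forall>x\<in>sequences n.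
       u \<frown> induced_map (reduced_product n T U) C x = induced_map U q (induced_map T p x)"
    if C: "C \<in> states (reduced_product n T U)"
  proof -
    obtain s where s: "s \<in> states K" "C = omega_class n V s" using C unfolding R Rst by blast
    obtain p q where "s = (p, q)" by (cases s)
    with s have pq: "(p, q) \<in> states K" "C = omega_class n V (p, q)" by blast+
    then have "p \<in> states T" "q \<in> states U" using KP by auto
    then show ?thesis unfolding R pq(2) using Rprod[OF pq(1)] V(4)[OF pq(1)] by blast
  qed
  show "\<exists>q\<in>states U. \<exists>C\<in>states (reduced_product n T U). \<exists>u\<in>words n. \<forall>x\<in>sequences n.
       u \<frown> induced_map (reduced_product n T U) C x = induced_map U q (induced_map T p x)"
    if p: "p \<in> states T"
  proof -
    obtain p0 q0 where p0: "(p0, q0) \<in> states K" using transducer_state_ex[OF K(1)] by auto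
    then have "p0 \<in> states T" using KP by auto
    then obtain w where w: "w \<in> words n" "next_state_word T w p0 = p"
      using TD(4) p unfolding strongly_connected_def by blast
    obtain q where q: "next_state_word K w (p0, q0) = (p, q)"
      using w(2) by (simp add: K_def product_word)
    then have pq: "(p, q) \<in> states K" using transducer_word(1)[OF K(1) p0 w(1)] by simp
    then have "q \<in> states U" "omega_class n V (p, q) \<in> states R" using KP Rst by auto
    then show ?thesis unfolding R using Rprod[OF pq] V(4)[OF pq] by blast
  qed
qed

section \<open>Slopes of transducers\<close>

text \<open>The exponent \<open>k\<close> and the offset \<open>\<alpha>\<close> may vary with the state, so that \<open>r\<close> is only determined up to powers of
  \<open>n\<close>; see \<open>has_slope_scale\<close> and \<open>has_slope_unique\<close>.\<close>

definition has_slope :: "nat \<Rightarrow> 'q transducer \<Rightarrow> real \<Rightarrow> bool" where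
  "has_slope n T r \<longleftrightarrow> (\<forall>q\<in>states T. \<exists>\<alpha>. \<exists>k::int. \<forall>x\<in>sequences n.
     val n (induced_map T q x) = \<alpha> + r * real n powi k * val n x)"

lemma val_induced_map_build:
  assumes n: "n \<ge> 2" and T: "is_transducer n T" and q: "q \<in> states T" and a: "a < n" and x: "x \<in> sequences n"
  shows "val n (induced_map T q (a ## x))
    = (real (num n (out T a q)) + val n (induced_map T (next_state T a q) x)) / real n ^ length (out T a q)"
  unfolding induced_map_build[OF T q a x]
  by (rule val_conc[OF n transducer_step(2)[OF T q a] induced_map_in_sequences[OF T transducer_step(1)[OF T q a] x]])

lemma val_induced_map_conc:
  assumes n: "n \<ge> 2" and T: "is_transducer n T" and q: "q \<in> states T" and w: "w \<in> words n" and x: "x \<in> sequences n"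
  shows "val n (induced_map T q (w \<frown> x))
    = (real (num n (output_word T w q)) + val n (induced_map T (next_state_word T w q) x)) / real n ^ length (output_word T w q)"
  unfolding induced_map_conc[OF T q w x]
  by (rule val_conc[OF n transducer_word(2)[OF T q w] induced_map_in_sequences[OF T transducer_word(1)[OF T q w] x]])

text \<open>Both sides of the claim satisfy the same recursion over the first letter of the input. Hence their difference is
  divided by \<open>n ^ |\<lambda>(w,q)|\<close> when the prefix \<open>w\<close> is read; as the differences are bounded and the output is
  infinite, it vanishes.\<close>

lemma affine_by_recursion:
  fixes \<alpha> m :: "'q \<Rightarrow> real"
  assumes n: "n \<ge> 2" and T: "is_transducer n T" and fin: "finite (states T)"
    and step: "\<And>q a. q \<in> states T \<Longrightarrow> a < n \<Longrightarrow>
        (real (num n (out T a q)) + \<alpha> (next_state T a q)) / real n ^ length (out T a q) = \<alpha> q + real a / real n * m q"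
      "\<And>q a. q \<in> states T \<Longrightarrow> a < n \<Longrightarrow> m (next_state T a q) / real n ^ length (out T a q) = m q / real n"
    and q: "q \<in> states T" and x: "x \<in> sequences n"
  shows "val n (induced_map T q x) = \<alpha> q + m q * val n x"
proof -
  \<comment> \<open>The defect of the claim.\<close>
  define e where "e q x = val n (induced_map T q x) - \<alpha> q - m q * val n x" for q x
  have e_step: "e q (a ## x) = e (next_state T a q) x / real n ^ length (out T a q)"
    if q: "q \<in> states T" and a: "a < n" and x: "x \<in> sequences n" for q a x
  proof -
    let ?N = "real n ^ length (out T a q)" and ?q = "next_state T a q"
    have "val n (a ## x) = (real a + val n x) / n" by (rule val_build[OF n]) (use a x in simp)
    then have "e q (a ## x) = (real (num n (out T a q)) + val n (induced_map T ?q x)) / ?N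
        - (\<alpha> q + real a / real n * m q) - m q / real n * val n x"
      unfolding e_def val_induced_map_build[OF n T q a x] by (simp add: add_divide_distrib algebra_simps)
    also have "\<dots> = e ?q x / ?N"
      unfolding step[OF q a, symmetric] e_def by (simp add: add_divide_distrib diff_divide_distrib)
    finally show ?thesis .
  qed
  have e_word: "e q (w \<frown> x) = e (next_state_word T w q) x / real n ^ length (output_word T w q)"
    if "q \<in> states T" "w \<in> words n" "x \<in> sequences n" for q w x
    using that
  proof (induction w arbitrary: q)
    case (Cons a w)
    then have a: "a < n" "w \<in> words n" "w \<frown> x \<in> sequences n" by auto
    show ?case
      using e_step[OF Cons.prems(1) a(1,3)]
        Cons.IH[OF transducer_step(1)[OF T Cons.prems(1) a(1)] a(2) Cons.prems(3)]
      by (simp add: power_add mult.commute)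
  qed simp
  obtain B where B: "\<And>q. q \<in> states T \<Longrightarrow> \<bar>\<alpha> q\<bar> + \<bar>m q\<bar> \<le> B"
    using finite_imageI[OF fin, of "\<lambda>q. \<bar>\<alpha> q\<bar> + \<bar>m q\<bar>"]
    by (metis (mono_tags, lifting) bdd_above_finite bdd_above.unfold imageI)
  have bound: "\<bar>e q x\<bar> \<le> 1 + B" if q: "q \<in> states T" and x: "x \<in> sequences n" for q x
  proof -
    have y: "induced_map T q x \<in> sequences n" by (rule induced_map_in_sequences[OF T q x])
    have "\<bar>m q * val n x\<bar> \<le> \<bar>m q\<bar>"
      using val_ge_0[OF n x] val_le_1[OF n x] by (simp add: abs_mult mult_left_le)
    then show ?thesis
      using val_ge_0[OF n y] val_le_1[OF n y] B[OF q] unfolding e_def by linarith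
  qed
  have "e q x = 0"
  proof (rule ccontr)
    assume ne: "e q x \<noteq> 0"
    have B0: "1 + B \<ge> 1" using B[OF q] by linarith
    obtain N where N: "(1 / real n) ^ N < \<bar>e q x\<bar> / (1 + B)"
      using real_arch_pow_inv[of "\<bar>e q x\<bar> / (1 + B)" "1 / real n"] ne B0 n by auto
    obtain k where k: "N \<le> length (output_word T (seq_take k x) q)"
      using T q x unfolding is_transducer_def by blast
    let ?w = "seq_take k x"
    have w: "?w \<in> words n" using x by simp
    have sx: "suffix k x \<in> sequences n" using x by simp
    have "?w \<frown> suffix k x = x" by (simp add: seq_take_eq_prefix)
    then have "\<bar>e q x\<bar> = \<bar>e (next_state_word T ?w q) (suffix k x)\<bar> / real n ^ length (output_word T ?w q)"
      using e_word[OF q w sx] by simp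
    also have "\<dots> \<le> (1 + B) / real n ^ length (output_word T ?w q)"
      by (intro divide_right_mono bound transducer_word(1)[OF T q w] sx) simp
    also have "\<dots> \<le> (1 + B) / real n ^ N"
      using n k B0 by (intro divide_left_mono power_increasing) auto
    also have "\<dots> = (1 + B) * (1 / real n) ^ N" by (simp add: power_one_over)
    also have "\<dots> < \<bar>e q x\<bar>" using N B0 by (simp add: pos_less_divide_eq mult.commute)
    finally show False by simp
  qed
  then show ?thesis by (simp add: e_def)
qed

text \<open>The excess of the output length over the input length vanishes on loops, so on a strongly connected transducer its
  value along a path depends on the end points only. The potential of \<open>q\<close> is the excess along any path
  from a base state to \<open>q\<close>.\<close>

lemma loop_potential:
  assumes T: "is_transducer n T" and sc: "strongly_connected n T"
    and L: "\<forall>w\<in>words n. \<forall>q\<in>states T. next_state_word T w q = q \<longrightarrow> length (output_word T w q) = length w"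
  obtains \<phi> :: "'q \<Rightarrow> int" where "\<And>q a. q \<in> states T \<Longrightarrow> a < n \<Longrightarrow>
    int (length (out T a q)) = 1 + \<phi> (next_state T a q) - \<phi> q"
proof -
  obtain p where p: "p \<in> states T" using transducer_state_ex[OF T] by blast
  define d where "d w q = int (length (output_word T w q)) - int (length w)" for w q
  have d_append: "d (u @ v) q = d u q + d v (next_state_word T u q)" for u v q by (simp add: d_def)
  have d_loop: "d w q = 0" if "w \<in> words n" "q \<in> states T" "next_state_word T w q = q" for w q
    using L that by (simp add: d_def)
  define W where "W q = (SOME w. w \<in> words n \<and> next_state_word T w p = q)" for q
  have W: "W q \<in> words n" "next_state_word T (W q) p = q" if "q \<in> states T" for q
    using sc p that someI_ex[of "\<lambda>w. w \<in> words n \<and> next_state_word T w p = q"]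
    unfolding strongly_connected_def W_def by blast+
  have indep: "d w p = d (W q) p" if w: "w \<in> words n" and wq: "next_state_word T w p = q" for w q
  proof -
    have q: "q \<in> states T" using transducer_word(1)[OF T p w] wq by simp
    obtain v where v: "v \<in> words n" "next_state_word T v q = p"
      using sc p q unfolding strongly_connected_def by blast
    have "d (w @ v) p = 0" "d (W q @ v) p = 0"
      using v w wq W[OF q] p by (auto intro!: d_loop)
    then show ?thesis using wq W(2)[OF q] by (simp add: d_append)
  qed
  have "int (length (out T a q)) = 1 + d (W (next_state T a q)) p - d (W q) p"
    if q: "q \<in> states T" and a: "a < n" for q a
  proof -
    have "W q @ [a] \<in> words n" "next_state_word T (W q @ [a]) p = next_state T a q" using W[OF q] a by auto
    from indep[OF this] show ?thesis using W(2)[OF q] by (simp add: d_append) (simp add: d_def)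
  qed
  then show ?thesis using that[of "\<lambda>q. d (W q) p"] by blast
qed

text \<open>Maximum principle: where the maximum is attained it is also attained at all successors, and these reach all
  states.\<close>

lemma harmonic_constant:
  fixes M :: "'q \<Rightarrow> real"
  assumes T: "is_transducer n T" and sc: "strongly_connected n T" and fin: "finite (states T)"
    and M: "\<And>q. q \<in> states T \<Longrightarrow> (\<Sum>a<n. M (next_state T a q)) = real n * M q"
    and p: "p \<in> states T" and q: "q \<in> states T"
  shows "M p = M q"
proof -
  define m where "m = Max (M ` states T)"
  have le: "M s \<le> m" if "s \<in> states T" for s unfolding m_def using fin that by simp
  have "m \<in> M ` states T" unfolding m_def using fin p by (intro Max_in) auto
  then obtain t where t: "t \<in> states T" "M t = m" by blast
  have step: "M (next_state T a s) = m" if s: "s \<in> states T" "M s = m" and a: "a < n" for s a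
  proof -
    have "(\<Sum>a<n. m - M (next_state T a s)) = 0" using M[OF s(1)] s(2) by (simp add: sum_subtractf)
    moreover have "\<forall>a\<in>{..<n}. 0 \<le> m - M (next_state T a s)" using le transducer_step(1)[OF T s(1)] by simp
    ultimately show ?thesis using sum_nonneg_eq_0_iff[of "{..<n}" "\<lambda>a. m - M (next_state T a s)"] a by auto
  qed
  have "M (next_state_word T w s) = m" if "s \<in> states T" "M s = m" "w \<in> words n" for s w
    using that
  proof (induction w arbitrary: s)
    case (Cons a w)
    then have a: "a < n" "w \<in> words n" by auto
    show ?case
      using Cons.IH[OF transducer_step(1)[OF T Cons.prems(1) a(1)] step[OF Cons.prems(1,2) a(1)] a(2)] by simp
  qed simp
  then have "M s = m" if "s \<in> states T" for s using sc t that unfolding strongly_connected_def by metis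
  then show ?thesis using p q by simp
qed

text \<open>The image contains a cone, and on a cone the value is not constant.\<close>

lemma image_val_nonconstant:
  assumes n: "n \<ge> 2" and T: "is_SO_transducer n T" and q: "q \<in> states T"
  obtains x y where "x \<in> sequences n" "y \<in> sequences n" "val n (induced_map T q x) \<noteq> val n (induced_map T q y)"
proof -
  let ?S = "state_image n T q"
  have "induced_map T q (\<lambda>_. 0) \<in> ?S" using zeros_in_sequences[OF n] by (simp add: state_image_def)
  moreover define z where "z = induced_map T q (\<lambda>_. 0)"
  ultimately obtain N where N: "\<And>y. y \<in> sequences n \<Longrightarrow> seq_take N y = seq_take N z \<Longrightarrow> y \<in> ?S"
    using SO_D(8)[OF T q] unfolding openin_sequence_space by blast
  have z: "z \<in> sequences n" unfolding z_def
    by (rule induced_map_in_sequences[OF SO_D(1)[OF T] q zeros_in_sequences[OF n]])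
  let ?u = "seq_take N z"
  have u: "?u \<in> words n" using z by simp
  have "?u \<frown> (\<lambda>_. 0) \<in> ?S" "?u \<frown> nines n \<in> ?S"
    using u zeros_in_sequences[OF n] nines_in_sequences[OF n] by (auto intro!: N simp: seq_take_eq_prefix)
  then obtain x y where xy: "x \<in> sequences n" "y \<in> sequences n"
    "induced_map T q x = ?u \<frown> (\<lambda>_. 0)" "induced_map T q y = ?u \<frown> nines n" unfolding state_image_def by auto
  have "val n (?u \<frown> (\<lambda>_. 0)) \<noteq> val n (?u \<frown> nines n)"
    using n val_conc[OF n u zeros_in_sequences[OF n]] val_conc[OF n u nines_in_sequences[OF n]]
    by (simp add: val_zeros[OF n] val_nines[OF n])
  then show ?thesis using that[OF xy(1,2)] xy(3,4) by simp
qed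

lemma zeros_build: "(\<lambda>_. 0 :: nat) = 0 ## (\<lambda>_. 0)"
proof
  show "0 = (0 ## (\<lambda>_. 0 :: nat)) i" for i by (cases i) simp_all
qed

lemma nines_build: "nines n = (n - 1) ## nines n"
  by (rule ext) (case_tac x; simp)

text \<open>The hypothesis \<open>adj\<close> makes the oscillations of \<open>val \<circ> h\<close> over the \<open>n\<close> cones of length one add up; the potential of
  \<open>loop_potential\<close> turns this into harmonicity of the rescaled oscillation \<open>M\<close>. So all \<open>n\<close> cones contribute
  equally, which is the recursion required by \<open>affine_by_recursion\<close>.\<close>

lemma has_slope_if_adjacent:
  assumes n: "n \<ge> 2" and T: "is_SO_transducer n T"
    and L: "\<forall>w\<in>words n. \<forall>q\<in>states T. next_state_word T w q = q \<longrightarrow> length (output_word T w q) = length w"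
    and adj: "\<And>q a. q \<in> states T \<Longrightarrow> a + 1 < n \<Longrightarrow>
       val n (induced_map T q (a ## nines n)) = val n (induced_map T q ((a + 1) ## (\<lambda>_. 0)))"
  obtains r where "has_slope n T r"
proof -
  note TD = SO_D[OF T]
  have fin: "finite (states T)" using SO_finite_states[OF T] n by simp
  have n0: "real n > 0" using n by simp
  note zs = zeros_in_sequences[OF n] and ns = nines_in_sequences[OF n]
  obtain \<phi> where \<phi>: "\<And>q a. q \<in> states T \<Longrightarrow> a < n \<Longrightarrow>
    int (length (out T a q)) = 1 + \<phi> (next_state T a q) - \<phi> q"
    using loop_potential[OF TD(1,4) L] by blast
  define A where "A q = val n (induced_map T q (\<lambda>_. 0))" for q
  define m where "m q = val n (induced_map T q (nines n)) - A q" for q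
  define M where "M q = m q / real n powi (\<phi> q)" for q
  define D where "D q a = m (next_state T a q) / real n ^ length (out T a q)" for q a
  have zero: "val n (induced_map T q (a ## (\<lambda>_. 0))) = A q + (\<Sum>b<a. D q b)"
    and nine: "val n (induced_map T q (a ## nines n)) = A q + (\<Sum>b<Suc a. D q b)"
    if q: "q \<in> states T" and a: "a < n" for q a
  proof -
    have diff: "val n (induced_map T q (a ## nines n)) = val n (induced_map T q (a ## (\<lambda>_. 0))) + D q a"
      if "a < n" for a
      unfolding val_induced_map_build[OF n TD(1) q that zs] val_induced_map_build[OF n TD(1) q that ns] D_def m_def A_def
      by (simp add: add_divide_distrib diff_divide_distrib)
    have "val n (induced_map T q (a ## (\<lambda>_. 0))) = A q + (\<Sum>b<a. D q b)" using a
    proof (induction a)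
      case 0
      then show ?case by (simp add: A_def zeros_build[symmetric])
    next
      case (Suc a)
      then show ?case using diff[of a] adj[OF q, of a] by simp
    qed
    then show "val n (induced_map T q (a ## (\<lambda>_. 0))) = A q + (\<Sum>b<a. D q b)"
      "val n (induced_map T q (a ## nines n)) = A q + (\<Sum>b<Suc a. D q b)" using diff[OF a] by simp_all
  qed
  have DM: "D q a = real n powi (\<phi> q) / real n * M (next_state T a q)" if q: "q \<in> states T" and a: "a < n" for q a
  proof -
    have "real n ^ length (out T a q) = real n powi (1 + \<phi> (next_state T a q) - \<phi> q)"
      using \<phi>[OF q a] by (metis power_int_of_nat)
    also have "\<dots> = real n * real n powi \<phi> (next_state T a q) / real n powi \<phi> q"
      using n0 by (simp add: power_int_diff power_int_add)
    finally show ?thesis unfolding D_def M_def using n0 by (simp add: field_simps)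
  qed
  have msum: "m q = (\<Sum>b<n. D q b)" if q: "q \<in> states T" for q
    using nine[OF q, of "n - 1"] n nines_build[of n] by (simp add: m_def)
  have M_const: "M p = M q" if "p \<in> states T" "q \<in> states T" for p q
  proof (rule harmonic_constant[OF TD(1,4) fin _ that])
    fix q assume q: "q \<in> states T"
    have "M q * real n powi \<phi> q = (\<Sum>b<n. D q b)" using msum[OF q] n0 by (simp add: M_def)
    also have "\<dots> = real n powi (\<phi> q) / real n * (\<Sum>b<n. M (next_state T b q))"
      using DM[OF q] by (simp add: sum_distrib_left)
    finally show "(\<Sum>b<n. M (next_state T b q)) = real n * M q" using n0 by (simp add: field_simps)
  qed
  have D: "D q a = m q / real n" if q: "q \<in> states T" and a: "a < n" for q a
    using DM[OF q a] n0 unfolding M_const[OF transducer_step(1)[OF TD(1) q a] q] by (simp add: M_def)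
  have aff: "val n (induced_map T q x) = A q + m q * val n x" if "q \<in> states T" "x \<in> sequences n" for q x
  proof (rule affine_by_recursion[OF n TD(1) fin _ _ that])
    fix q a assume q: "q \<in> states T" and a: "a < n"
    have "(real (num n (out T a q)) + A (next_state T a q)) / real n ^ length (out T a q)
        = val n (induced_map T q (a ## (\<lambda>_. 0)))"
      unfolding val_induced_map_build[OF n TD(1) q a zs] A_def ..
    also have "\<dots> = A q + (\<Sum>b<a. m q / real n)" using zero[OF q a] D[OF q] a by simp
    finally show "(real (num n (out T a q)) + A (next_state T a q)) / real n ^ length (out T a q)
        = A q + real a / real n * m q" by simp
    show "m (next_state T a q) / real n ^ length (out T a q) = m q / real n"
      using D[OF q a] unfolding D_def .
  qed
  obtain p where p: "p \<in> states T" using transducer_state_ex[OF TD(1)] by blast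
  have "has_slope n T (M p)"
    unfolding has_slope_def
  proof
    fix q assume q: "q \<in> states T"
    have "m q = M p * real n powi \<phi> q" using M_const[OF p q] n0 by (simp add: M_def)
    then show "\<exists>\<alpha>. \<exists>k::int. \<forall>x\<in>sequences n. val n (induced_map T q x) = \<alpha> + M p * real n powi k * val n x"
      using aff[OF q] by metis
  qed
  then show ?thesis using that by blast
qed

lemma has_slope_nonzero:
  assumes n: "n \<ge> 2" and T: "is_SO_transducer n T" and r: "has_slope n T r"
  shows "r \<noteq> 0"
proof
  assume "r = 0"
  obtain q where q: "q \<in> states T" using transducer_state_ex[OF SO_D(1)[OF T]] by blast
  obtain x y where xy: "x \<in> sequences n" "y \<in> sequences n" "val n (induced_map T q x) \<noteq> val n (induced_map T q y)"
    by (rule image_val_nonconstant[OF n T q])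
  obtain \<alpha> where "\<forall>x\<in>sequences n. val n (induced_map T q x) = \<alpha>"
    using r q \<open>r = 0\<close> unfolding has_slope_def by auto
  then show False using xy by simp
qed

section \<open>Offsets and slopes are n-adic rationals\<close>

definition nadic :: "nat \<Rightarrow> real \<Rightarrow> bool" where
  "nadic n r \<longleftrightarrow> (\<exists>k::nat. r * real n ^ k \<in> \<int>)"

lemma nadic_mult_power: "r * real n ^ k \<in> \<int> \<Longrightarrow> k \<le> m \<Longrightarrow> r * real n ^ m \<in> \<int>"
proof -
  assume "r * real n ^ k \<in> \<int>" and km: "k \<le> m"
  then have "(r * real n ^ k) * real n ^ (m - k) \<in> \<int>" by simp
  also have "(r * real n ^ k) * real n ^ (m - k) = r * real n ^ m"
    using km by (simp add: power_add[symmetric] mult.assoc)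
  finally show ?thesis .
qed

lemma nadic_diff:
  assumes "nadic n r" "nadic n s" shows "nadic n (r - s)"
proof -
  obtain k m where km: "r * real n ^ k \<in> \<int>" "s * real n ^ m \<in> \<int>" using assms by (auto simp: nadic_def)
  have "r * real n ^ (k + m) \<in> \<int>" "s * real n ^ (k + m) \<in> \<int>"
    using nadic_mult_power[OF km(1), of "k + m"] nadic_mult_power[OF km(2), of "k + m"] by simp_all
  then have "(r - s) * real n ^ (k + m) \<in> \<int>" by (simp add: left_diff_distrib)
  then show ?thesis unfolding nadic_def by blast
qed

lemma nadic_mult:
  assumes "nadic n r" "nadic n s" shows "nadic n (r * s)"
proof -
  obtain k m where km: "r * real n ^ k \<in> \<int>" "s * real n ^ m \<in> \<int>" using assms by (auto simp: nadic_def)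
  have "r * s * real n ^ (k + m) = (r * real n ^ k) * (s * real n ^ m)" by (simp add: power_add)
  then have "r * s * real n ^ (k + m) \<in> \<int>" using Ints_mult[OF km] by (simp only:)
  then show ?thesis unfolding nadic_def by blast
qed

lemma nadic_powi:
  assumes "n > 0" shows "nadic n (real n powi k)"
proof (cases "k \<ge> 0")
  case True
  then have "real n powi k * real n ^ 0 \<in> \<int>" by (simp add: power_int_def)
  then show ?thesis unfolding nadic_def by blast
next
  case False
  then have "real n powi k * real n ^ nat (- k) = 1" using assms
    by (simp add: power_int_def field_simps)
  then have "real n powi k * real n ^ nat (- k) \<in> \<int>" by simp
  then show ?thesis unfolding nadic_def by blast
qed

lemma nadic_divide: "n > 0 \<Longrightarrow> c \<in> \<int> \<Longrightarrow> nadic n (c / real n ^ k)"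
  unfolding nadic_def by (intro exI[of _ k]) simp

text \<open>If \<open>y\<close> minimizes the value on an open set that contains the cone of a prefix of \<open>y\<close>, then continuing this
  prefix with zeros cannot lower the value; so \<open>y\<close> has the value of a finite word. Maxima are reached by
  continuing with the digit \<open>n - 1\<close>.\<close>

lemma nadic_extremal_val:
  assumes n: "n \<ge> 2" and S: "openin (sequence_space n) S" and y: "y \<in> S"
    and ext: "(\<forall>z\<in>S. val n y \<le> val n z) \<or> (\<forall>z\<in>S. val n z \<le> val n y)"
  shows "nadic n (val n y)"
proof -
  obtain N where N: "\<And>z. z \<in> sequences n \<Longrightarrow> seq_take N z = seq_take N y \<Longrightarrow> z \<in> S"
    using S y unfolding openin_sequence_space by blast
  have ys: "y \<in> sequences n" using S y openin_subset by blast
  let ?u = "seq_take N y"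
  have u: "?u \<in> words n" and sy: "suffix N y \<in> sequences n" using ys by simp_all
  note zs = zeros_in_sequences[OF n] and ns = nines_in_sequences[OF n]
  have S': "?u \<frown> (\<lambda>_. 0) \<in> S" "?u \<frown> nines n \<in> S"
    using u zs ns by (auto intro!: N simp: seq_take_eq_prefix)
  have "?u \<frown> suffix N y = y" by (simp add: seq_take_eq_prefix)
  then have vy: "val n y = (real (num n ?u) + val n (suffix N y)) / real n ^ N"
    using val_conc[OF n u sy] by simp
  have v0: "val n (?u \<frown> (\<lambda>_. 0)) = real (num n ?u) / real n ^ N"
    and v9: "val n (?u \<frown> nines n) = (real (num n ?u) + 1) / real n ^ N"
    using val_conc[OF n u zs] val_conc[OF n u ns] by (simp_all add: val_zeros[OF n] val_nines[OF n])
  have n0: "real n ^ N > 0" using n by simp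
  from ext show ?thesis
  proof
    assume "\<forall>z\<in>S. val n y \<le> val n z"
    then have "val n y \<le> real (num n ?u) / real n ^ N" using S'(1) v0 by auto
    moreover have "real (num n ?u) / real n ^ N \<le> val n y"
      unfolding vy using val_ge_0[OF n sy] n0 by (intro divide_right_mono) auto
    ultimately have "val n y = real (num n ?u) / real n ^ N" by simp
    then show ?thesis using nadic_divide[of n "real (num n ?u)" N] n by simp
  next
    assume "\<forall>z\<in>S. val n z \<le> val n y"
    then have "(real (num n ?u) + 1) / real n ^ N \<le> val n y" using S'(2) v9 by auto
    moreover have "val n y \<le> (real (num n ?u) + 1) / real n ^ N"
      unfolding vy using val_le_1[OF n sy] n0 by (intro divide_right_mono) auto
    ultimately have "val n y = (real (num n ?u) + 1) / real n ^ N" by simp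
    then show ?thesis using nadic_divide[of n "real (num n ?u) + 1" N] n by simp
  qed
qed

text \<open>The two end points of the range of an affine map are the extreme values on its open image.\<close>

lemma affine_nadic:
  assumes n: "n \<ge> 2" and T: "is_SO_transducer n T" and q: "q \<in> states T"
    and aff: "\<forall>x\<in>sequences n. val n (induced_map T q x) = \<alpha> + s * val n x"
  shows "nadic n \<alpha>" "nadic n s"
proof -
  note zs = zeros_in_sequences[OF n] and ns = nines_in_sequences[OF n]
  let ?S = "state_image n T q"
  have v: "val n (induced_map T q (\<lambda>_. 0)) = \<alpha>" "val n (induced_map T q (nines n)) = \<alpha> + s"
    using aff zs ns by (simp_all add: val_zeros[OF n] val_nines[OF n])
  have mem: "induced_map T q (\<lambda>_. 0) \<in> ?S" "induced_map T q (nines n) \<in> ?S"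
    using zs ns unfolding state_image_def by blast+
  have range: "\<exists>t. 0 \<le> t \<and> t \<le> 1 \<and> val n z = \<alpha> + s * t" if "z \<in> ?S" for z
    using that aff val_ge_0[OF n] val_le_1[OF n] unfolding state_image_def by blast
  have "(\<forall>z\<in>?S. \<alpha> \<le> val n z) \<and> (\<forall>z\<in>?S. val n z \<le> \<alpha> + s)
      \<or> (\<forall>z\<in>?S. val n z \<le> \<alpha>) \<and> (\<forall>z\<in>?S. \<alpha> + s \<le> val n z)"
  proof (cases "s \<ge> 0")
    case True
    then have "s * t \<le> s" "0 \<le> s * t" if "0 \<le> t" "t \<le> 1" for t using that by (simp_all add: mult_left_le)
    then show ?thesis using range by (metis add_left_mono add.right_neutral)
  next
    case False
    then have "s \<le> s * t" "s * t \<le> 0" if "0 \<le> t" "t \<le> 1" for t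
      using that by (simp_all add: mult_le_cancel_left mult_nonpos_nonneg)
    then show ?thesis using range by (metis add_left_mono add.right_neutral)
  qed
  then have "nadic n \<alpha>" "nadic n (\<alpha> + s)"
    using nadic_extremal_val[OF n SO_D(8)[OF T q] mem(1)] nadic_extremal_val[OF n SO_D(8)[OF T q] mem(2)]
    unfolding v by blast+
  then show "nadic n \<alpha>" "nadic n s" using nadic_diff[of n "\<alpha> + s" \<alpha>] by simp_all
qed

lemma val_cone:
  assumes n: "n \<ge> 2" and y: "y \<in> sequences n"
  shows "val n y * real n ^ N = real (num n (seq_take N y)) + val n (suffix N y)"
proof -
  have "seq_take N y \<frown> suffix N y = y" by (simp add: seq_take_eq_prefix)
  then show ?thesis
    using val_conc[OF n seq_take_in_words[OF y, of N] suffix_in_sequences[OF y, of N]] n by simp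
qed

text \<open>The values of two different cones of the same length lie in intervals with at most one common point, so two maps into
  different cones can only have the same values if these are constant.\<close>

lemma cone_values_disjoint:
  assumes n: "n \<ge> 2" and K: "w \<in> words n"
    and uv: "u \<in> words n" "v \<in> words n" "length u = N" "length v = N" "u \<noteq> v"
    and h: "\<And>y. y \<in> sequences n \<Longrightarrow> h (w \<frown> y) \<in> sequences n \<and> seq_take N (h (w \<frown> y)) = u"
    and h': "\<And>y. y \<in> sequences n \<Longrightarrow> h' (w \<frown> y) \<in> sequences n \<and> seq_take N (h' (w \<frown> y)) = v"
    and aff: "\<And>x. x \<in> sequences n \<Longrightarrow> val n (h x) = \<alpha> + s * val n x"
      "\<And>x. x \<in> sequences n \<Longrightarrow> val n (h' x) = \<alpha> + s * val n x"
  shows "s = 0"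
proof -
  have main: "s = 0" if lt: "num n u < num n v"
    and h: "\<And>y. y \<in> sequences n \<Longrightarrow> h (w \<frown> y) \<in> sequences n \<and> seq_take N (h (w \<frown> y)) = u"
    and h': "\<And>y. y \<in> sequences n \<Longrightarrow> h' (w \<frown> y) \<in> sequences n \<and> seq_take N (h' (w \<frown> y)) = v"
    and aff: "\<And>x. x \<in> sequences n \<Longrightarrow> val n (h x) = \<alpha> + s * val n x"
      "\<And>x. x \<in> sequences n \<Longrightarrow> val n (h' x) = \<alpha> + s * val n x"
    for u v h h'
  proof -
    have c: "(\<alpha> + s * val n (w \<frown> y)) * real n ^ N = real (num n v)" if y: "y \<in> sequences n" for y
    proof -
      have wy: "w \<frown> y \<in> sequences n" using K y by simp
      have "val n (h (w \<frown> y)) * real n ^ N \<le> real (num n u) + 1"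
        using val_cone[OF n conjunct1[OF h[OF y]], of N] h[OF y] val_le_1[OF n suffix_in_sequences[OF conjunct1[OF h[OF y]]], of N] by simp
      moreover have "val n (h' (w \<frown> y)) * real n ^ N \<ge> real (num n v)"
        using val_cone[OF n conjunct1[OF h'[OF y]], of N] h'[OF y] val_ge_0[OF n suffix_in_sequences[OF conjunct1[OF h'[OF y]]], of N] by simp
      ultimately show ?thesis unfolding aff(1)[OF wy] aff(2)[OF wy] using lt by linarith
    qed
    have "s * val n (w \<frown> (\<lambda>_. 0)) = s * val n (w \<frown> nines n)"
    proof -
      have "real n ^ N \<noteq> 0" using n by simp
      moreover have "(\<alpha> + s * val n (w \<frown> (\<lambda>_. 0))) * real n ^ N = (\<alpha> + s * val n (w \<frown> nines n)) * real n ^ N"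
        unfolding c[OF zeros_in_sequences[OF n]] c[OF nines_in_sequences[OF n]] ..
      ultimately show ?thesis by (simp only: mult_cancel_right add_left_cancel) simp
    qed
    moreover have "val n (w \<frown> (\<lambda>_. 0)) \<noteq> val n (w \<frown> nines n)"
      using n val_conc[OF n K zeros_in_sequences[OF n]] val_conc[OF n K nines_in_sequences[OF n]]
      by (simp add: val_zeros[OF n] val_nines[OF n])
    ultimately show "s = 0" by simp
  qed
  have "num n u \<noteq> num n v" using num_inj[OF uv(1,2)] uv by auto
  then consider "num n u < num n v" | "num n v < num n u" by linarith
  then show ?thesis
  proof cases
    case 1
    show ?thesis by (rule main[OF 1 h h' aff])
  next
    case 2
    show ?thesis by (rule main[OF 2 h' h aff(2,1)])
  qed
qed

text \<open>Continuity on the sequence space, stated for the maps that occur as induced maps, possibly after a change of finite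
  prefixes of input or output.\<close>

definition seq_continuous :: "nat \<Rightarrow> ((nat \<Rightarrow> nat) \<Rightarrow> nat \<Rightarrow> nat) \<Rightarrow> bool" where
  "seq_continuous n h \<longleftrightarrow> (\<forall>x\<in>sequences n. h x \<in> sequences n \<and>
     (\<forall>N. \<exists>K. \<forall>y\<in>sequences n. seq_take K y = seq_take K x \<longrightarrow> seq_take N (h y) = seq_take N (h x)))"

lemma seq_continuousD:
  assumes "seq_continuous n h" "x \<in> sequences n"
  shows "h x \<in> sequences n"
    "\<exists>K. \<forall>y\<in>sequences n. seq_take K y = seq_take K x \<longrightarrow> seq_take N (h y) = seq_take N (h x)"
  using assms unfolding seq_continuous_def by blast+

lemma seq_continuous_induced_map:
  assumes T: "is_transducer n T" and q: "q \<in> states T" shows "seq_continuous n (induced_map T q)"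
  unfolding seq_continuous_def
proof (intro ballI conjI allI)
  fix x N assume x: "x \<in> sequences n"
  show "induced_map T q x \<in> sequences n" by (rule induced_map_in_sequences[OF T q x])
  obtain K where "\<And>y. y \<in> sequences n \<Longrightarrow> seq_take K y = seq_take K x \<Longrightarrow>
     seq_take N (induced_map T q y) = seq_take N (induced_map T q x)"
    using induced_map_continuous[OF T q x] by blast
  then show "\<exists>K. \<forall>y\<in>sequences n. seq_take K y = seq_take K x \<longrightarrow> seq_take N (induced_map T q y) = seq_take N (induced_map T q x)"
    by blast
qed

lemma seq_continuous_suffix:
  assumes "seq_continuous n h" shows "seq_continuous n (\<lambda>x. suffix J (h x))"
  unfolding seq_continuous_def
proof (intro ballI conjI allI)
  fix x N assume x: "x \<in> sequences n"
  show "suffix J (h x) \<in> sequences n" using seq_continuousD(1)[OF assms x] by simp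
  obtain K where "\<forall>y\<in>sequences n. seq_take K y = seq_take K x \<longrightarrow> seq_take (J + N) (h y) = seq_take (J + N) (h x)"
    using seq_continuousD(2)[OF assms x] by blast
  moreover have "seq_take N (suffix J y) = seq_take N (suffix J z)" if "seq_take (J + N) y = seq_take (J + N) z" for y z
    using that by (simp add: seq_take_eq_iff)
  ultimately show "\<exists>K. \<forall>y\<in>sequences n. seq_take K y = seq_take K x \<longrightarrow> seq_take N (suffix J (h y)) = seq_take N (suffix J (h x))"
    by metis
qed

lemma seq_continuous_conc:
  assumes h: "seq_continuous n h" and w: "w \<in> words n" shows "seq_continuous n (\<lambda>x. h (w \<frown> x))"
  unfolding seq_continuous_def
proof (intro ballI conjI allI)
  fix x N assume x: "x \<in> sequences n"
  have wx: "w \<frown> x \<in> sequences n" using x w by simp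
  show "h (w \<frown> x) \<in> sequences n" by (rule seq_continuousD(1)[OF h wx])
  obtain K where K: "\<forall>y\<in>sequences n. seq_take K y = seq_take K (w \<frown> x) \<longrightarrow> seq_take N (h y) = seq_take N (h (w \<frown> x))"
    using seq_continuousD(2)[OF h wx] by blast
  have "seq_take N (h (w \<frown> y)) = seq_take N (h (w \<frown> x))"
    if y: "y \<in> sequences n" "seq_take K y = seq_take K x" for y
  proof -
    have "(w \<frown> y) i = (w \<frown> x) i" if "i < K" for i
      using that y(2) by (cases "i < length w") (simp_all add: seq_take_eq_iff)
    then have "seq_take K (w \<frown> y) = seq_take K (w \<frown> x)" by (simp add: seq_take_eq_iff)
    moreover have "w \<frown> y \<in> sequences n" using y(1) w by simp
    ultimately show ?thesis using K by blast
  qed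
  then show "\<exists>K. \<forall>y\<in>sequences n. seq_take K y = seq_take K x \<longrightarrow> seq_take N (h (w \<frown> y)) = seq_take N (h (w \<frown> x))"
    by blast
qed

text \<open>Values do not determine sequences, because \<open>n\<close>-adic numbers have two expansions. Continuity resolves the ambiguity: if
  the maps differ at \<open>x\<close>, they send a whole cone around \<open>x\<close> into two different cones.\<close>

lemma affine_determines_map:
  assumes n: "n \<ge> 2" and h: "seq_continuous n h" and h': "seq_continuous n h'"
    and aff: "\<And>x. x \<in> sequences n \<Longrightarrow> val n (h x) = \<alpha> + s * val n x"
      "\<And>x. x \<in> sequences n \<Longrightarrow> val n (h' x) = \<alpha> + s * val n x"
    and s: "s \<noteq> 0" and x: "x \<in> sequences n"
  shows "h x = h' x"
proof (rule ccontr)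
  assume "h x \<noteq> h' x"
  then obtain i where i: "h x i \<noteq> h' x i" by auto
  let ?N = "Suc i"
  obtain K where K: "\<forall>y\<in>sequences n. seq_take K y = seq_take K x \<longrightarrow> seq_take ?N (h y) = seq_take ?N (h x)"
    using seq_continuousD(2)[OF h x] by blast
  obtain K' where K': "\<forall>y\<in>sequences n. seq_take K' y = seq_take K' x \<longrightarrow> seq_take ?N (h' y) = seq_take ?N (h' x)"
    using seq_continuousD(2)[OF h' x] by blast
  let ?w = "seq_take (max K K') x"
  have w: "?w \<in> words n" using x by simp
  have cone: "?w \<frown> y \<in> sequences n \<and> seq_take K (?w \<frown> y) = seq_take K x \<and> seq_take K' (?w \<frown> y) = seq_take K' x"
    if "y \<in> sequences n" for y
    using that w by (auto simp: seq_take_eq_iff) (simp_all add: seq_take_def)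
  have "s = 0"
  proof (rule cone_values_disjoint[OF n w _ _ _ _ _ _ _ aff])
    show "seq_take ?N (h x) \<in> words n" "seq_take ?N (h' x) \<in> words n"
      using seq_continuousD(1)[OF h x] seq_continuousD(1)[OF h' x] by simp_all
    show "seq_take ?N (h x) \<noteq> seq_take ?N (h' x)" using i by (auto simp: seq_take_eq_iff simp del: seq_take_in_words)
    show "h (?w \<frown> y) \<in> sequences n \<and> seq_take ?N (h (?w \<frown> y)) = seq_take ?N (h x)" if "y \<in> sequences n" for y
      using cone[OF that] seq_continuousD(1)[OF h] K by blast
    show "h' (?w \<frown> y) \<in> sequences n \<and> seq_take ?N (h' (?w \<frown> y)) = seq_take ?N (h' x)" if "y \<in> sequences n" for y
      using cone[OF that] seq_continuousD(1)[OF h'] K' by blast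
  qed simp_all
  with s show False by simp
qed

section \<open>Transducers of equal slope are isomorphic\<close>

definition same_map :: "nat \<Rightarrow> 'p transducer \<Rightarrow> 'p \<Rightarrow> 'q transducer \<Rightarrow> 'q \<Rightarrow> bool" where
  "same_map n T p U q \<longleftrightarrow> (\<forall>x\<in>sequences n. induced_map T p x = induced_map U q x)"

lemma same_map_sym: "same_map n T p U q \<Longrightarrow> same_map n U q T p"
  by (simp add: same_map_def)

lemma same_map_trans: "same_map n T p U q \<Longrightarrow> same_map n U q V r \<Longrightarrow> same_map n T p V r"
  by (simp add: same_map_def)

lemma same_map_imp_eq:
  assumes "is_SO_transducer n T" "p \<in> states T" "q \<in> states T" "same_map n T p T q" shows "p = q"
  using SO_D(6)[OF assms(1-3)] assms(4) by (simp add: same_map_def omega_equiv_def)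

lemma same_map_step:
  assumes T: "is_SO_transducer n T" and U: "is_SO_transducer n U" and p: "p \<in> states T" and q: "q \<in> states U"
    and eq: "same_map n T p U q" and a: "a < n"
  shows "same_map n T (next_state T a p) U (next_state U a q)"
proof -
  have ne: "sequences n \<noteq> {}" using a by (auto simp: sequences_eq)
  note pT = transducer_step(1)[OF SO_D(1)[OF T] p a] and qU = transducer_step(1)[OF SO_D(1)[OF U] q a]
  have e: "out T a p \<frown> induced_map T (next_state T a p) x = out U a q \<frown> induced_map U (next_state U a q) x"
    if "x \<in> sequences n" for x
  proof -
    have "a ## x \<in> sequences n" using a that by simp
    then have "induced_map T p (a ## x) = induced_map U q (a ## x)" using eq unfolding same_map_def by blast
    then show ?thesis
      unfolding induced_map_build[OF SO_D(1)[OF T] p a that] induced_map_build[OF SO_D(1)[OF U] q a that] .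
  qed
  show ?thesis
    unfolding same_map_def
    by (intro ballI) (rule complete_response_cancel(2)[OF e SO_D(5)[OF T pT] SO_D(5)[OF U qU] ne])
qed

lemma same_map_word:
  assumes T: "is_SO_transducer n T" and U: "is_SO_transducer n U" and "p \<in> states T" "q \<in> states U"
    "same_map n T p U q" "w \<in> words n"
  shows "same_map n T (next_state_word T w p) U (next_state_word U w q)"
  using assms(3-6)
proof (induction w arbitrary: p q)
  case (Cons a w)
  then have a: "a < n" "w \<in> words n" by auto
  note pT = transducer_step(1)[OF SO_D(1)[OF T] Cons.prems(1) a(1)]
    and qU = transducer_step(1)[OF SO_D(1)[OF U] Cons.prems(2) a(1)]
  show ?case
    using Cons.IH[OF pT qU same_map_step[OF T U Cons.prems(1-3) a(1)] a(2)] by simp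
qed simp

text \<open>From a pair of states with equal maps the same input leads to another such pair; strong connectedness reaches all
  states, and minimality makes the correspondence a bijection.\<close>

lemma transducer_iso_if_common_state:
  assumes T: "is_SO_transducer n T" and U: "is_SO_transducer n U" and p: "p \<in> states T" and q: "q \<in> states U"
    and eq: "same_map n T p U q"
  shows "transducer_iso n T U"
proof -
  have TU: "\<exists>u\<in>states U. same_map n T t U u" if t: "t \<in> states T" for t
  proof -
    obtain w where w: "w \<in> words n" "next_state_word T w p = t"
      using SO_D(4)[OF T] p t unfolding strongly_connected_def by blast
    show ?thesis using same_map_word[OF T U p q eq w(1)] transducer_word(1)[OF SO_D(1)[OF U] q w(1)] w(2) by blast
  qed
  have UT: "\<exists>t\<in>states T. same_map n T t U u" if u: "u \<in> states U" for u
  proof -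
    obtain w where w: "w \<in> words n" "next_state_word U w q = u"
      using SO_D(4)[OF U] q u unfolding strongly_connected_def by blast
    show ?thesis using same_map_word[OF T U p q eq w(1)] transducer_word(1)[OF SO_D(1)[OF T] p w(1)] w(2) by blast
  qed
  obtain f where f: "\<And>t. t \<in> states T \<Longrightarrow> f t \<in> states U" "\<And>t. t \<in> states T \<Longrightarrow> same_map n T t U (f t)"
    using TU by metis
  have "bij_betw f (states T) (states U)"
    unfolding bij_betw_def
  proof
    show "inj_on f (states T)"
    proof (rule inj_onI)
      fix s t assume s: "s \<in> states T" and t: "t \<in> states T" and e: "f s = f t"
      have "same_map n T s T t"
        using same_map_trans[OF f(2)[OF s] same_map_sym[OF f(2)[OF t, folded e]]] .
      then show "s = t" by (rule same_map_imp_eq[OF T s t])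
    qed
    have "u \<in> f ` states T" if u: "u \<in> states U" for u
    proof -
      obtain t where t: "t \<in> states T" "same_map n T t U u" using UT[OF u] by blast
      have "same_map n U (f t) U u" using same_map_trans[OF same_map_sym[OF f(2)[OF t(1)]] t(2)] .
      then have "f t = u" by (rule same_map_imp_eq[OF U f(1)[OF t(1)] u])
      then show ?thesis using t(1) by blast
    qed
    then show "f ` states T = states U" using f(1) by blast
  qed
  then show ?thesis using f(2) unfolding transducer_iso_def same_map_def by blast
qed

lemma drop_common_prefix:
  assumes "\<And>x. x \<in> sequences n \<Longrightarrow> u \<frown> induced_map T q x = v \<frown> g x" "\<not> incomplete_response n T q"
    "sequences n \<noteq> {}"
  obtains w where "\<And>x. x \<in> sequences n \<Longrightarrow> g x = w \<frown> induced_map T q x"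
proof (cases "length v \<le> length u")
  case True
  have "g x = drop (length v) u \<frown> induced_map T q x" if "x \<in> sequences n" for x
  proof -
    from conc_eq_conc_longer[OF assms(1)[OF that, symmetric] True] obtain w
      where "u = v @ w" "g x = w \<frown> induced_map T q x" .
    then show ?thesis by simp
  qed
  then show ?thesis using that by blast
next
  case False
  have "is_prefix_of (drop (length u) v) (induced_map T q x)" if "x \<in> sequences n" for x
  proof -
    have "length u \<le> length v" using False by simp
    from conc_eq_conc_longer[OF assms(1)[OF that] this] obtain w
      where "v = u @ w" "induced_map T q x = w \<frown> g x" .
    then show ?thesis by simp
  qed
  moreover have "drop (length u) v \<noteq> []" using False by simp
  ultimately have "incomplete_response n T q" unfolding incomplete_response_def state_image_def by blast
  with assms(2) show ?thesis by simp
qed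

text \<open>A state map normalized so that its values depend only on \<open>r\<close>, \<open>J\<close> and \<open>E\<close>. Reading
  \<open>0...01\<close> with \<open>k + E\<close> zeros turns the slope \<open>r n\<^sup>k\<close> into \<open>r / n ^ Suc E\<close>, whatever \<open>k\<close> is. The final letter 1
  keeps the values strictly away from \<open>\<alpha>\<close>, which is a multiple of \<open>1 / n ^ J\<close>; as the range is short they stay
  strictly between two consecutive multiples of \<open>1 / n ^ J\<close>, above \<open>\<alpha>\<close> if \<open>r > 0\<close> and below it otherwise.
  So the first \<open>J\<close> output letters are constant, and \<open>g\<close> is what remains without them.\<close>

lemma slope_state_normal_form:
  assumes n: "n \<ge> 2" and T: "is_SO_transducer n T" and q: "q \<in> states T"
    and aff: "\<And>x. x \<in> sequences n \<Longrightarrow> val n (induced_map T q x) = \<alpha> + r * real n powi k * val n x"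
    and J: "\<alpha> * real n ^ J \<in> \<int>" and E: "k + int E \<ge> 0" and small: "2 * \<bar>r\<bar> * real n ^ J < real n ^ Suc E"
    and r: "r \<noteq> 0"
  obtains p g where "p \<in> states T" "seq_continuous n g"
    "\<forall>x\<in>sequences n. val n (g x) = (if r > 0 then 0 else 1) + r * real n ^ J / real n ^ Suc E * (1 + val n x)"
    "\<exists>w. \<forall>x\<in>sequences n. g x = w \<frown> induced_map T p x"
proof -
  define w where "w = replicate (nat (k + int E)) (0::nat) @ [1]"
  have w: "w \<in> words n" using n by (auto simp: w_def)
  have n0: "real n > 0" using n by simp
  have numw: "num n (replicate j 0 @ [1]) = 1" for j by (induction j) simp_all
  define F where "F x = induced_map T q (w \<frown> x)" for x
  have ws: "w \<frown> x \<in> sequences n" if "x \<in> sequences n" for x using that w by simp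
  have Fc: "seq_continuous n F" unfolding F_def
    by (rule seq_continuous_conc[OF seq_continuous_induced_map[OF SO_D(1)[OF T] q] w])
  have lw: "length w = Suc (nat (k + int E))" by (simp add: w_def)
  have pw: "real n powi k / real n ^ length w = 1 / real n ^ Suc E"
  proof -
    have "real n ^ length w = real n powi (k + int (Suc E))"
      unfolding lw using E by (simp add: power_int_def nat_add_distrib algebra_simps)
    also have "\<dots> = real n powi k * real n powi int (Suc E)" by (rule power_int_add) (use n0 in simp)
    also have "\<dots> = real n powi k * real n ^ Suc E" by (simp only: power_int_of_nat)
    finally show ?thesis using n0 by simp
  qed
  have vF: "val n (F x) = \<alpha> + r / real n ^ Suc E * (1 + val n x)" if x: "x \<in> sequences n" for x
  proof -
    have "val n (w \<frown> x) = (1 + val n x) / real n ^ length w"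
      using val_conc[OF n w x] numw by (simp add: w_def)
    then have "val n (F x) = \<alpha> + r * (real n powi k / real n ^ length w) * (1 + val n x)"
      unfolding F_def aff[OF ws[OF x]] by simp
    then show ?thesis unfolding pw by simp
  qed
  obtain c where c: "\<alpha> * real n ^ J = of_int c" using J by (auto elim: Ints_cases)
  \<comment> \<open>The constant prefix of length \<open>J\<close> has the number \<open>d\<close>.\<close>
  define d where "d = (if r > 0 then c else c - 1)"
  define \<epsilon> where "\<epsilon> = r * real n ^ J / real n ^ Suc E"
  have eps: "\<bar>\<epsilon>\<bar> * 2 < 1" "\<epsilon> \<noteq> 0" "\<epsilon> > 0 \<longleftrightarrow> r > 0"
    using small n0 r by (auto simp: \<epsilon>_def abs_mult field_simps zero_less_divide_iff zero_less_mult_iff)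
  have vFJ: "val n (F x) * real n ^ J = of_int c + \<epsilon> * (1 + val n x)" if x: "x \<in> sequences n" for x
    unfolding vF[OF x] \<epsilon>_def c[symmetric] by (simp add: algebra_simps)
  have Fs: "F x \<in> sequences n" if "x \<in> sequences n" for x by (rule seq_continuousD(1)[OF Fc that])
  have numF: "int (num n (seq_take J (F x))) = d" if x: "x \<in> sequences n" for x
  proof -
    have e: "real (num n (seq_take J (F x))) + val n (suffix J (F x)) = of_int c + \<epsilon> * (1 + val n x)"
      using val_cone[OF n Fs[OF x], of J] vFJ[OF x] by simp
    have v: "0 \<le> val n (suffix J (F x))" "val n (suffix J (F x)) \<le> 1"
      using val_ge_0[OF n] val_le_1[OF n] suffix_in_sequences[OF Fs[OF x]] by blast+
    have x1: "1 \<le> 1 + val n x" "1 + val n x \<le> 2" using val_ge_0[OF n x] val_le_1[OF n x] by simp_all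
    have b: "\<bar>\<epsilon> * (1 + val n x)\<bar> < 1"
    proof -
      have "\<bar>\<epsilon> * (1 + val n x)\<bar> \<le> \<bar>\<epsilon>\<bar> * 2" unfolding abs_mult using x1 by (intro mult_left_mono) auto
      then show ?thesis using eps(1) by simp
    qed
    show ?thesis
    proof (cases "r > 0")
      case True
      then have "\<epsilon> * (1 + val n x) > 0" using eps(3) x1 by simp
      then have "real (num n (seq_take J (F x))) < of_int c + 1" "of_int c < real (num n (seq_take J (F x))) + 1"
        using e v b by linarith+
      then show ?thesis using True by (simp add: d_def)
    next
      case False
      then have "\<epsilon> < 0" using eps(2,3) by linarith
      then have "\<epsilon> * (1 + val n x) < 0" using x1 by (simp add: mult_less_0_iff)
      then have "real (num n (seq_take J (F x))) < of_int c" "of_int c - 1 < real (num n (seq_take J (F x))) + 1"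
        using e v b by linarith+
      then show ?thesis using False by (simp add: d_def)
    qed
  qed
  define \<gamma> where "\<gamma> = seq_take J (F (\<lambda>_. 0))"
  have \<gamma>: "seq_take J (F x) = \<gamma>" if x: "x \<in> sequences n" for x
  proof (rule num_inj)
    show "seq_take J (F x) \<in> words n" "\<gamma> \<in> words n"
      using Fs[OF x] Fs[OF zeros_in_sequences[OF n]] by (simp_all add: \<gamma>_def)
    show "num n (seq_take J (F x)) = num n \<gamma>"
      using numF[OF x] numF[OF zeros_in_sequences[OF n]] by (simp add: \<gamma>_def)
  qed (simp add: \<gamma>_def)
  define g where "g x = suffix J (F x)" for x
  have gc: "seq_continuous n g" unfolding g_def by (rule seq_continuous_suffix[OF Fc])
  have gv: "val n (g x) = (if r > 0 then 0 else 1) + r * real n ^ J / real n ^ Suc E * (1 + val n x)"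
    if x: "x \<in> sequences n" for x
  proof -
    have "real (num n (seq_take J (F x))) = of_int d" using numF[OF x] by (metis of_int_of_nat_eq)
    then show ?thesis
      using val_cone[OF n Fs[OF x], of J] vFJ[OF x] unfolding g_def \<epsilon>_def[symmetric]
      by (auto simp: d_def)
  qed
  let ?p = "next_state_word T w q"
  have p: "?p \<in> states T" by (rule transducer_word(1)[OF SO_D(1)[OF T] q w])
  have "output_word T w q \<frown> induced_map T ?p x = \<gamma> \<frown> g x" if x: "x \<in> sequences n" for x
  proof -
    have "\<gamma> \<frown> g x = F x" unfolding \<gamma>[OF x, symmetric] g_def by (simp add: seq_take_eq_prefix)
    then show ?thesis unfolding F_def induced_map_conc[OF SO_D(1)[OF T] q w x] by simp
  qed
  moreover have "sequences n \<noteq> {}" using zeros_in_sequences[OF n] by blast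
  ultimately obtain w' where "\<And>x. x \<in> sequences n \<Longrightarrow> g x = w' \<frown> induced_map T ?p x"
    using drop_common_prefix[OF _ SO_D(5)[OF T p]] by metis
  then show ?thesis using that[OF p gc ballI[OF gv]] by blast
qed

text \<open>Choosing \<open>J\<close> and \<open>E\<close> large enough for a state of each transducer gives normal forms with the same values, hence the same map.\<close>

lemma iso_if_same_slope:
  assumes n: "n \<ge> 2" and T: "is_SO_transducer n T" and U: "is_SO_transducer n U"
    and rT: "has_slope n T r" and rU: "has_slope n U r"
  shows "transducer_iso n T U"
proof -
  have r: "r \<noteq> 0" by (rule has_slope_nonzero[OF n T rT])
  obtain p q where p: "p \<in> states T" and q: "q \<in> states U"
    using transducer_state_ex[OF SO_D(1)[OF T]] transducer_state_ex[OF SO_D(1)[OF U]] by blast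
  obtain \<alpha> k where a: "\<forall>x\<in>sequences n. val n (induced_map T p x) = \<alpha> + r * real n powi k * val n x"
    using rT p unfolding has_slope_def by blast
  obtain \<beta> l where b: "\<forall>x\<in>sequences n. val n (induced_map U q x) = \<beta> + r * real n powi l * val n x"
    using rU q unfolding has_slope_def by blast
  obtain I J where IJ: "\<alpha> * real n ^ I \<in> \<int>" "\<beta> * real n ^ J \<in> \<int>"
    using affine_nadic(1)[OF n T p a] affine_nadic(1)[OF n U q b] unfolding nadic_def by blast
  define M where "M = max I J"
  have M: "\<alpha> * real n ^ M \<in> \<int>" "\<beta> * real n ^ M \<in> \<int>"
    using nadic_mult_power[OF IJ(1), of M] nadic_mult_power[OF IJ(2), of M] by (simp_all add: M_def)
  obtain e where e: "2 * \<bar>r\<bar> * real n ^ M < real n ^ e" using real_arch_pow[of "real n"] n by auto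
  \<comment> \<open>The last two summands make both \<open>k + E\<close> and \<open>l + E\<close> nonnegative.\<close>
  define E where "E = e + nat (- k) + nat (- l)"
  have E: "k + int E \<ge> 0" "l + int E \<ge> 0" by (simp_all add: E_def)
  have "real n ^ e \<le> real n ^ Suc E" using n by (intro power_increasing) (simp_all add: E_def)
  with e have small: "2 * \<bar>r\<bar> * real n ^ M < real n ^ Suc E" by simp
  obtain p' g where P: "p' \<in> states T" "seq_continuous n g"
    "\<forall>x\<in>sequences n. val n (g x) = (if r > 0 then 0 else 1) + r * real n ^ M / real n ^ Suc E * (1 + val n x)"
    "\<exists>w. \<forall>x\<in>sequences n. g x = w \<frown> induced_map T p' x"
    by (rule slope_state_normal_form[OF n T p bspec[OF a] M(1) E(1) small r])
  obtain q' h where Q: "q' \<in> states U" "seq_continuous n h"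
    "\<forall>x\<in>sequences n. val n (h x) = (if r > 0 then 0 else 1) + r * real n ^ M / real n ^ Suc E * (1 + val n x)"
    "\<exists>w. \<forall>x\<in>sequences n. h x = w \<frown> induced_map U q' x"
    by (rule slope_state_normal_form[OF n U q bspec[OF b] M(2) E(2) small r])
  let ?s = "r * real n ^ M / real n ^ Suc E"
  have s: "?s \<noteq> 0" using r n by simp
  have gh: "g x = h x" if "x \<in> sequences n" for x
    by (rule affine_determines_map[OF n P(2) Q(2) _ _ s that, of "(if r > 0 then 0 else 1) + ?s"])
      (simp_all only: bspec[OF P(3)] bspec[OF Q(3)] distrib_left mult_1_right add.assoc)
  obtain u v where "\<forall>x\<in>sequences n. g x = u \<frown> induced_map T p' x" "\<forall>x\<in>sequences n. h x = v \<frown> induced_map U q' x"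
    using P(4) Q(4) by blast
  then have uv: "u \<frown> induced_map T p' x = v \<frown> induced_map U q' x" if "x \<in> sequences n" for x
    using gh that by auto
  have ne: "sequences n \<noteq> {}" using zeros_in_sequences[OF n] by blast
  have "same_map n T p' U q'"
    unfolding same_map_def
    by (intro ballI) (rule complete_response_cancel(2)[OF uv SO_D(5)[OF T P(1)] SO_D(5)[OF U Q(1)] ne])
  then show ?thesis by (rule transducer_iso_if_common_state[OF T U P(1) Q(1)])
qed

section \<open>Slopes, order and lengths\<close>

lemma less_fun_open:
  assumes "less_fun x (y :: nat \<Rightarrow> nat)"
  obtains N where "\<forall>y'. seq_take N y' = seq_take N y \<longrightarrow> less_fun x y'"
    "\<forall>x'. seq_take N x' = seq_take N x \<longrightarrow> less_fun x' y"
proof -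
  obtain k where k: "x k < y k" "\<forall>j<k. x j = y j" using assms by (auto simp: less_fun_def)
  have "less_fun x y'" if "seq_take (Suc k) y' = seq_take (Suc k) y" for y'
    using that k unfolding seq_take_eq_iff by (intro less_funI exI[of _ k]) simp
  moreover have "less_fun x' y" if "seq_take (Suc k) x' = seq_take (Suc k) x" for x'
    using that k unfolding seq_take_eq_iff by (intro less_funI exI[of _ k]) simp
  ultimately show ?thesis using that by blast
qed

lemma val_less_imp_less_fun:
  assumes n: "n \<ge> 2" and "x \<in> sequences n" "y \<in> sequences n" "val n x < val n y" shows "less_fun x y"
  using less_fun_total[of x y] less_fun_val_le[OF n, of y x] assms by auto

text \<open>A sequence that has a larger neighbour ends in \<open>(n-1)(n-1)...\<close>; cutting off this tail lowers the value
  strictly and changes only far digits.\<close>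

lemma approximate_from_below:
  assumes n: "n \<ge> 2" and lt: "less_fun x y" and x: "x \<in> sequences n" and y: "y \<in> sequences n"
    and eq: "val n x = val n y"
  obtains x' where "x' \<in> sequences n" "seq_take K x' = seq_take K x" "val n x' < val n x"
  using lt x y
proof (cases rule: less_fun_split)
  case (1 u a b x0 y0)
  have a: "a < n" using 1 by simp
  have "val n (a ## x0) = val n (b ## y0)"
    using eq val_conc[OF n \<open>u \<in> words n\<close>, of "a ## x0"] val_conc[OF n \<open>u \<in> words n\<close>, of "b ## y0"] 1 a n by simp
  then have "real a + val n x0 = real b + val n y0"
    using val_build[OF n, of a x0] val_build[OF n, of b y0] 1 a n by simp
  then have one: "val n x0 \<ge> 1" using val_ge_0[OF n \<open>y0 \<in> sequences n\<close>] \<open>a < b\<close> by linarith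
  define z where "z = seq_take K x0 \<frown> (\<lambda>_. 0)"
  have z: "z \<in> sequences n" using 1 zeros_in_sequences[OF n] by (simp add: z_def)
  have w: "seq_take K x0 \<in> words n" using 1 by simp
  have "real (num n (seq_take K x0)) < real n ^ K"
    using num_less[OF w] by (simp flip: of_nat_power)
  then have "val n z < 1"
    using val_conc[OF n w zeros_in_sequences[OF n]] n by (simp add: z_def val_zeros[OF n])
  then have "val n (a ## z) < val n (a ## x0)"
    using one val_build[OF n, of a z] val_build[OF n, of a x0] 1 a z n by (simp add: divide_strict_right_mono)
  then have v: "val n (u \<frown> a ## z) < val n x"
    using val_conc[OF n \<open>u \<in> words n\<close>, of "a ## z"] val_conc[OF n \<open>u \<in> words n\<close>, of "a ## x0"] 1 a z n
    by (simp add: divide_strict_right_mono)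
  have "seq_take K (v \<frown> z) = seq_take K (v \<frown> x0)" for v
    by (auto simp: seq_take_eq_iff conc_def z_def seq_take_def)
  from this[of "u @ [a]"] have "seq_take K (u \<frown> a ## z) = seq_take K (u \<frown> a ## x0)" by simp
  then have "seq_take K (u \<frown> a ## z) = seq_take K x" using 1 by simp
  then show ?thesis using that[OF _ _ v] 1 a z by simp
qed

text \<open>For sequences with different values this is clear. If \<open>x\<close> and \<open>y\<close> are neighbours with the same value, then their images
  have the same value too, and a wrong order of the images would persist for sequences near \<open>x\<close> of smaller
  value.\<close>

lemma slope_order:
  assumes n: "n \<ge> 2" and T: "is_SO_transducer n T" and slope: "has_slope n T r" and q: "q \<in> states T"
  shows "r > 0 \<Longrightarrow> preserves_lex n (induced_map T q)" "r < 0 \<Longrightarrow> reverses_lex n (induced_map T q)"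
proof -
  let ?h = "induced_map T q"
  obtain \<alpha> k where aff: "\<forall>x\<in>sequences n. val n (?h x) = \<alpha> + r * real n powi k * val n x"
    using slope q unfolding has_slope_def by blast
  define s where "s = r * real n powi k"
  have aff: "val n (?h x) = \<alpha> + s * val n x" if "x \<in> sequences n" for x using aff that by (simp add: s_def)
  have hs: "?h x \<in> sequences n" if "x \<in> sequences n" for x by (rule induced_map_in_sequences[OF SO_D(1)[OF T] q that])
  have npow: "real n powi k > 0" using n by simp
  have main: "(s > 0 \<longrightarrow> less_fun (?h x) (?h y)) \<and> (s < 0 \<longrightarrow> less_fun (?h y) (?h x))"
    if x: "x \<in> sequences n" and y: "y \<in> sequences n" and lt: "less_fun x y" for x y
  proof (cases "val n x < val n y")
    case True
    then have "s > 0 \<longrightarrow> val n (?h x) < val n (?h y)" "s < 0 \<longrightarrow> val n (?h y) < val n (?h x)"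
      unfolding aff[OF x] aff[OF y] by auto
    then show ?thesis using val_less_imp_less_fun[OF n] hs x y by blast
  next
    case False
    then have eq: "val n x = val n y" using less_fun_val_le[OF n lt x y] by simp
    have veq: "val n (?h x) = val n (?h y)" using eq aff x y by simp
    have "x \<noteq> y" using lt less_fun_irrefl by blast
    then have "?h x \<noteq> ?h y" using inj_onD[OF SO_D(7)[OF T q]] x y by blast
    then consider "less_fun (?h x) (?h y)" | "less_fun (?h y) (?h x)" using less_fun_total by blast
    then show ?thesis
    proof cases
      case 1
      obtain N where N: "\<forall>y'. seq_take N y' = seq_take N (?h x) \<longrightarrow> less_fun y' (?h y)"
        using less_fun_open[OF 1] by metis
      obtain K where K: "\<And>z. z \<in> sequences n \<Longrightarrow> seq_take K z = seq_take K x \<Longrightarrow> seq_take N (?h z) = seq_take N (?h x)"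
        using induced_map_continuous[OF SO_D(1)[OF T] q x] by blast
      obtain x' where x': "x' \<in> sequences n" "seq_take K x' = seq_take K x" "val n x' < val n x"
        by (rule approximate_from_below[OF n lt x y eq])
      have "less_fun (?h x') (?h y)" using N K x' by blast
      then have "val n (?h x') \<le> val n (?h x)" using less_fun_val_le[OF n _ hs[OF x'(1)] hs[OF y]] veq by simp
      then have "s * val n x' \<le> s * val n x" unfolding aff[OF x] aff[OF x'(1)] by simp
      then have "\<not> s < 0" using x'(3) by (auto simp: mult_le_cancel_left)
      then show ?thesis using 1 by simp
    next
      case 2
      obtain N where N: "\<forall>y'. seq_take N y' = seq_take N (?h x) \<longrightarrow> less_fun (?h y) y'"
        using less_fun_open[OF 2] by metis
      obtain K where K: "\<And>z. z \<in> sequences n \<Longrightarrow> seq_take K z = seq_take K x \<Longrightarrow> seq_take N (?h z) = seq_take N (?h x)"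
        using induced_map_continuous[OF SO_D(1)[OF T] q x] by blast
      obtain x' where x': "x' \<in> sequences n" "seq_take K x' = seq_take K x" "val n x' < val n x"
        by (rule approximate_from_below[OF n lt x y eq])
      have "less_fun (?h y) (?h x')" using N K x' by blast
      then have "val n (?h x) \<le> val n (?h x')" using less_fun_val_le[OF n _ hs[OF y] hs[OF x'(1)]] veq by simp
      then have "s * val n x \<le> s * val n x'" unfolding aff[OF x] aff[OF x'(1)] by simp
      then have "\<not> s > 0" using x'(3) by (auto simp: mult_le_cancel_left)
      then show ?thesis using 2 by simp
    qed
  qed
  show "preserves_lex n ?h" if "r > 0"
    using main that npow unfolding preserves_lex_def s_def by simp
  show "reverses_lex n ?h" if "r < 0"
  proof -
    have "s < 0" using that npow by (simp add: s_def mult_less_0_iff)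
    then show ?thesis using main unfolding reverses_lex_def by blast
  qed
qed

text \<open>Reading the loop shrinks the input by \<open>n ^ |w|\<close> and the output by \<open>n ^ |\<lambda>(w,q)|\<close>, while the slope of the state is the
  same before and after; so both factors agree.\<close>

lemma slope_length_preserving:
  assumes n: "n \<ge> 2" and T: "is_SO_transducer n T" and slope: "has_slope n T r"
    and w: "w \<in> words n" and q: "q \<in> states T" and loop: "next_state_word T w q = q"
  shows "length (output_word T w q) = length w"
proof -
  obtain \<alpha> k where aff: "\<forall>x\<in>sequences n. val n (induced_map T q x) = \<alpha> + r * real n powi k * val n x"
    using slope q unfolding has_slope_def by blast
  define s where "s = r * real n powi k"
  have s: "s \<noteq> 0" using has_slope_nonzero[OF n T slope] n by (simp add: s_def)
  note zs = zeros_in_sequences[OF n] and ns = nines_in_sequences[OF n]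
  let ?v = "\<lambda>x. val n (induced_map T q (w \<frown> x))"
  have "?v (nines n) - ?v (\<lambda>_. 0) = s / real n ^ length w"
    using bspec[OF aff, of "w \<frown> nines n"] bspec[OF aff, of "w \<frown> (\<lambda>_. 0)"] w zs ns
      val_conc[OF n w zs] val_conc[OF n w ns]
    by (simp add: s_def val_zeros[OF n] val_nines[OF n] add_divide_distrib algebra_simps)
  moreover have "?v (nines n) - ?v (\<lambda>_. 0) = s / real n ^ length (output_word T w q)"
    using bspec[OF aff zs] bspec[OF aff ns]
      val_induced_map_conc[OF n SO_D(1)[OF T] q w zs] val_induced_map_conc[OF n SO_D(1)[OF T] q w ns]
    unfolding loop by (simp add: s_def val_zeros[OF n] val_nines[OF n] add_divide_distrib)
  ultimately have "real n ^ length w = real n ^ length (output_word T w q)" using s n by (simp add: field_simps)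
  then show ?thesis using n by simp
qed

section \<open>Arithmetic of slopes\<close>

lemma has_slope_scale:
  assumes n: "n \<ge> 2" and slope: "has_slope n T r" shows "has_slope n T (r * real n powi j)"
  unfolding has_slope_def
proof
  fix q assume "q \<in> states T"
  then obtain \<alpha> k where aff: "\<forall>x\<in>sequences n. val n (induced_map T q x) = \<alpha> + r * real n powi k * val n x"
    using slope unfolding has_slope_def by blast
  have eq: "r * real n powi j * real n powi (k - j) = r * real n powi k"
    using n by (simp add: power_int_diff)
  then show "\<exists>\<alpha>. \<exists>k. \<forall>x\<in>sequences n. val n (induced_map T q x) = \<alpha> + r * real n powi j * real n powi k * val n x"
    by (intro exI[of _ \<alpha>] exI[of _ "k - j"]) (use aff in \<open>simp only: eq\<close>)
qed

lemma has_slope_unique: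
  assumes n: "n \<ge> 2" and T: "is_transducer n T" and r: "has_slope n T r" and s: "has_slope n T s"
  obtains j where "s = r * real n powi j"
proof -
  obtain q where q: "q \<in> states T" using transducer_state_ex[OF T] by blast
  obtain \<alpha> k where a: "\<forall>x\<in>sequences n. val n (induced_map T q x) = \<alpha> + r * real n powi k * val n x"
    using r q unfolding has_slope_def by blast
  obtain \<beta> l where b: "\<forall>x\<in>sequences n. val n (induced_map T q x) = \<beta> + s * real n powi l * val n x"
    using s q unfolding has_slope_def by blast
  have "r * real n powi k = s * real n powi l"
    using bspec[OF a zeros_in_sequences[OF n]] bspec[OF a nines_in_sequences[OF n]]
      bspec[OF b zeros_in_sequences[OF n]] bspec[OF b nines_in_sequences[OF n]]
    by (simp add: val_zeros[OF n] val_nines[OF n])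
  then have "s = r * real n powi (k - l)" using n by (simp add: power_int_diff field_simps)
  then show ?thesis by (rule that)
qed

lemma has_slope_iso:
  assumes "transducer_iso n T U" "has_slope n U r" shows "has_slope n T r"
proof -
  obtain f where f: "bij_betw f (states T) (states U)"
    "\<forall>q\<in>states T. \<forall>x\<in>sequences n. induced_map T q x = induced_map U (f q) x"
    using assms(1) unfolding transducer_iso_def by blast
  show ?thesis
    unfolding has_slope_def
  proof
    fix q assume q: "q \<in> states T"
    then have "f q \<in> states U" using f(1) by (simp add: bij_betw_apply)
    then obtain \<alpha> k where "\<forall>x\<in>sequences n. val n (induced_map U (f q) x) = \<alpha> + r * real n powi k * val n x"
      using assms(2) unfolding has_slope_def by blast
    then show "\<exists>\<alpha>. \<exists>k. \<forall>x\<in>sequences n. val n (induced_map T q x) = \<alpha> + r * real n powi k * val n x"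
      using f(2) q by (intro exI[of _ \<alpha>] exI[of _ k]) simp
  qed
qed

lemma transducer_iso_sym:
  assumes "transducer_iso n T U" shows "transducer_iso n U T"
proof -
  obtain f where f: "bij_betw f (states T) (states U)"
    "\<forall>q\<in>states T. \<forall>x\<in>sequences n. induced_map T q x = induced_map U (f q) x"
    using assms unfolding transducer_iso_def by blast
  have "\<forall>q\<in>states U. \<forall>x\<in>sequences n. induced_map U q x = induced_map T (inv_into (states T) f q) x"
    using f(2) bij_betw_inv_into_right[OF f(1)] bij_betw_apply[OF bij_betw_inv_into[OF f(1)]] by simp
  then show ?thesis using bij_betw_inv_into[OF f(1)] unfolding transducer_iso_def by blast
qed

lemma transducer_iso_trans:
  assumes "transducer_iso n T U" "transducer_iso n U V" shows "transducer_iso n T V"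
proof -
  obtain f where f: "bij_betw f (states T) (states U)"
    "\<forall>q\<in>states T. \<forall>x\<in>sequences n. induced_map T q x = induced_map U (f q) x"
    using assms(1) unfolding transducer_iso_def by blast
  obtain g where g: "bij_betw g (states U) (states V)"
    "\<forall>q\<in>states U. \<forall>x\<in>sequences n. induced_map U q x = induced_map V (g q) x"
    using assms(2) unfolding transducer_iso_def by blast
  have "\<forall>q\<in>states T. \<forall>x\<in>sequences n. induced_map T q x = induced_map V ((g \<circ> f) q) x"
    using f g bij_betw_apply[OF f(1)] by simp
  then show ?thesis using bij_betw_trans[OF f(1) g(1)] unfolding transducer_iso_def by blast
qed

lemma has_slope_reduced_product:
  assumes n: "n \<ge> 2" and T: "is_SO_transducer n T" and U: "is_SO_transducer n U"
    and r: "has_slope n T r" and s: "has_slope n U s"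
  shows "has_slope n (reduced_product n T U) (r * s)"
  unfolding has_slope_def
proof
  let ?R = "reduced_product n T U"
  fix C assume C: "C \<in> states ?R"
  obtain p q u where pq: "p \<in> states T" "q \<in> states U" "u \<in> words n"
    "\<forall>x\<in>sequences n. u \<frown> induced_map ?R C x = induced_map U q (induced_map T p x)"
    using reduced_product(2)[OF n T U C] by blast
  obtain \<alpha> k where a: "\<forall>x\<in>sequences n. val n (induced_map T p x) = \<alpha> + r * real n powi k * val n x"
    using r pq unfolding has_slope_def by blast
  obtain \<beta> l where b: "\<forall>x\<in>sequences n. val n (induced_map U q x) = \<beta> + s * real n powi l * val n x"
    using s pq unfolding has_slope_def by blast
  have n0: "real n \<noteq> 0" using n by simp
  have "val n (induced_map ?R C x) = ((\<beta> + s * real n powi l * \<alpha>) * real n ^ length u - real (num n u))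
      + r * s * real n powi (k + l + int (length u)) * val n x" if x: "x \<in> sequences n" for x
  proof -
    have Tx: "induced_map T p x \<in> sequences n" by (rule induced_map_in_sequences[OF SO_D(1)[OF T] pq(1) x])
    have Cx: "induced_map ?R C x \<in> sequences n"
      by (rule induced_map_in_sequences[OF SO_D(1)[OF reduced_product(1)[OF n T U]] C x])
    have "(real (num n u) + val n (induced_map ?R C x)) / real n ^ length u
        = \<beta> + s * real n powi l * (\<alpha> + r * real n powi k * val n x)"
      using val_conc[OF n pq(3) Cx] pq(4) a b x Tx by simp
    then have "real (num n u) + val n (induced_map ?R C x)
        = (\<beta> + s * real n powi l * (\<alpha> + r * real n powi k * val n x)) * real n ^ length u"
      using n0 by (simp add: field_simps)
    moreover have "real n powi (k + l + int (length u)) = real n powi k * real n powi l * real n ^ length u"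
      using n0 by (simp add: power_int_add)
    ultimately show ?thesis by (simp add: algebra_simps)
  qed
  then show "\<exists>\<alpha>. \<exists>k. \<forall>x\<in>sequences n. val n (induced_map ?R C x) = \<alpha> + r * s * real n powi k * val n x"
    by blast
qed

section \<open>Transducers on the natural numbers\<close>

text \<open>Renames the states along an injection, which is needed because elements of the monoid are classes of transducers on
  natural numbers while reduced products live on sets of pairs.\<close>

definition relabel :: "('p \<Rightarrow> 'q) \<Rightarrow> 'p transducer \<Rightarrow> 'q transducer" where
  "relabel f T = \<lparr>states = f ` states T,
     next_state = (\<lambda>a k. f (next_state T a (inv_into (states T) f k))),
     out = (\<lambda>a k. out T a (inv_into (states T) f k))\<rparr>"

lemma relabel_word:
  assumes T: "is_transducer n T" and f: "inj_on f (states T)" and "q \<in> states T" "w \<in> words n"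
  shows "next_state_word (relabel f T) w (f q) = f (next_state_word T w q)
    \<and> output_word (relabel f T) w (f q) = output_word T w q"
  using assms(3,4)
proof (induction w arbitrary: q)
  case (Cons a w)
  then have a: "a < n" "w \<in> words n" by auto
  have "next_state (relabel f T) a (f q) = f (next_state T a q)" "out (relabel f T) a (f q) = out T a q"
    using inv_into_f_f[OF f Cons.prems(1)] by (simp_all add: relabel_def)
  then show ?case using Cons.IH[OF transducer_step(1)[OF T Cons.prems(1) a(1)] a(2)] by simp
qed simp

lemma relabel:
  assumes T: "is_SO_transducer n T" and f: "inj_on f (states T)" and n: "n > 0"
  shows "is_SO_transducer n (relabel f T)" "transducer_iso n (relabel f T) T"
proof -
  let ?R = "relabel f T"
  note TD = SO_D[OF T]
  note word = relabel_word[OF TD(1) f]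
  have st: "states ?R = f ` states T" by (simp add: relabel_def)
  have step: "next_state ?R a (f q) = f (next_state T a q)" "out ?R a (f q) = out T a q" if "q \<in> states T" for a q
    using inv_into_f_f[OF f that] by (simp_all add: relabel_def)
  have map: "induced_map ?R (f q) x = induced_map T q x" if q: "q \<in> states T" and x: "x \<in> sequences n" for q x
    unfolding induced_map_def using word[OF q seq_take_in_words[OF x]] by simp
  have im: "state_image n ?R (f q) = state_image n T q" if "q \<in> states T" for q
    unfolding state_image_def using map[OF that] by (intro image_cong) auto
  have R: "is_transducer n ?R"
    unfolding is_transducer_def st
  proof (intro conjI ballI allI impI)
    show "countable (f ` states T)" "f ` states T \<noteq> {}" using TD(1) by (auto simp: is_transducer_def)
  next
    fix a s assume a: "a < n" and "s \<in> f ` states T"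
    then obtain q where q: "q \<in> states T" "s = f q" by blast
    show "next_state ?R a s \<in> f ` states T" "out ?R a s \<in> words n"
      unfolding q(2) step[OF q(1)] using transducer_step[OF TD(1) q(1) a] by blast+
  next
    fix s x N assume s: "s \<in> f ` states T" and x: "x \<in> sequences n"
    then obtain q where q: "q \<in> states T" "s = f q" by blast
    show "\<exists>k. N \<le> length (output_word ?R (seq_take k x) s)"
      using TD(1) q x word[OF q(1) seq_take_in_words[OF x]] unfolding is_transducer_def by auto
  qed
  obtain k where k: "synchronizing_at_level n T k" using TD(2) by (auto simp: strongly_synchronizing_def)
  have kR: "synchronizing_at_level n ?R k"
    unfolding synchronizing_at_level_def
  proof (intro ballI impI)
    fix w s t assume w: "w \<in> words n" "length w = k" and s: "s \<in> states ?R" and t: "t \<in> states ?R"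
    obtain p q where pq: "p \<in> states T" "q \<in> states T" "s = f p" "t = f q" using s t unfolding st by blast
    show "next_state_word ?R w s = next_state_word ?R w t"
      unfolding pq(3,4) conjunct1[OF word[OF pq(1) w(1)]] conjunct1[OF word[OF pq(2) w(1)]]
      by (rule arg_cong[OF synchronizing_at_levelD[OF k w pq(1,2)]])
  qed
  have core: "core_states n ?R = states ?R"
  proof (intro equalityI subsetI)
    fix s assume "s \<in> core_states n ?R"
    then show "s \<in> states ?R"
      unfolding core_states_eq[OF kR R n] using transducer_word(1)[OF R] by blast
  next
    fix s assume "s \<in> states ?R"
    then obtain t where t: "t \<in> states T" "s = f t" unfolding st by blast
    then have "t \<in> core_states n T" using TD(3) by (simp add: is_core_iff)
    then obtain w q where w: "w \<in> words n" "length w = k" "q \<in> states T" "t = next_state_word T w q"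
      unfolding core_states_eq[OF k TD(1) n] by blast
    have "s = next_state_word ?R w (f q)" using conjunct1[OF word[OF w(3,1)]] w(4) t(2) by simp
    then show "s \<in> core_states n ?R" unfolding core_states_eq[OF kR R n] st using w(1-3) by blast
  qed
  show "is_SO_transducer n ?R"
    unfolding is_SO_transducer_def minimal_transducer_def
  proof (intro conjI ballI impI)
    show "is_transducer n ?R" by (rule R)
    show "strongly_synchronizing n ?R" using kR by (auto simp: strongly_synchronizing_def)
    show "is_core n ?R" using core by (simp add: is_core_iff)
    show "strongly_connected n ?R"
      unfolding strongly_connected_def st
    proof (intro ballI)
      fix s t assume "s \<in> f ` states T" "t \<in> f ` states T"
      then obtain p q where pq: "p \<in> states T" "q \<in> states T" "s = f p" "t = f q" by blast
      obtain w where w: "w \<in> words n" "next_state_word T w p = q"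
        using TD(4) pq unfolding strongly_connected_def by blast
      have "next_state_word ?R w s = t" using conjunct1[OF word[OF pq(1) w(1)]] w(2) pq(3,4) by simp
      then show "\<exists>w\<in>words n. next_state_word ?R w s = t" using w(1) by blast
    qed
  next
    fix s t assume "s \<in> states ?R" "t \<in> states ?R" and eq: "omega_equiv n ?R s t"
    then obtain p q where pq: "p \<in> states T" "q \<in> states T" "s = f p" "t = f q" unfolding st by blast
    have "omega_equiv n T p q" using eq map[OF pq(1)] map[OF pq(2)] unfolding omega_equiv_def pq(3,4) by simp
    then show "s = t" using TD(6)[OF pq(1,2)] pq(3,4) by simp
  next
    fix s assume "s \<in> states ?R"
    then obtain q where q: "q \<in> states T" "s = f q" unfolding st by blast
    show "\<not> incomplete_response n ?R s"
      using TD(5)[OF q(1)] unfolding incomplete_response_def q(2) im[OF q(1)] .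
    show "openin (sequence_space n) (state_image n ?R s)" "closedin (sequence_space n) (state_image n ?R s)"
      unfolding q(2) im[OF q(1)] by (rule TD(8,9)[OF q(1)])+
    show "inj_on (induced_map ?R s) (sequences n)"
      unfolding q(2) by (rule inj_on_cong[THEN iffD2, OF map[OF q(1)] TD(7)[OF q(1)]])
  qed
  have "transducer_iso n T ?R"
    unfolding transducer_iso_def st
    by (intro exI[of _ f] conjI ballI) (simp_all add: f inj_on_imp_bij_betw map)
  then show "transducer_iso n ?R T" by (rule transducer_iso_sym)
qed

lemma nat_representative:
  assumes T: "is_SO_transducer n T" and n: "n > 0"
  obtains V :: "nat transducer" where "is_SO_transducer n V" "transducer_iso n V T"
proof -
  have "countable (states T)" using SO_D(1)[OF T] by (simp add: is_transducer_def)
  then have "inj_on (to_nat_on (states T)) (states T)" by (rule inj_on_to_nat_on)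
  from relabel[OF T this n] show ?thesis by (rule that)
qed

section \<open>Long division and reflection\<close>

text \<open>Long division by \<open>d\<close> in base \<open>n\<close> with the remainders as states: in state \<open>j\<close> the letter \<open>a\<close> produces the quotient of \<open>n j + a\<close>
  by \<open>d\<close>, which is \<open>(n div d) * j + a div d\<close> as \<open>d\<close> divides \<open>n\<close>, and for the same reason the new remainder
  depends only on \<open>a\<close>. The permutation \<open>\<tau>\<close> of the alphabet allows for a reflection of the output.\<close>

definition division_transducer :: "nat \<Rightarrow> nat \<Rightarrow> (nat \<Rightarrow> nat) \<Rightarrow> nat transducer" where
  "division_transducer n d \<tau> = \<lparr>states = {..<d}, next_state = (\<lambda>a j. a mod d),
     out = (\<lambda>a j. [\<tau> (n div d * j + a div d)])\<rparr>"

context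
  fixes n d e :: nat and \<tau> :: "nat \<Rightarrow> nat"
  assumes n: "n = e * d" and d: "d > 0" and e: "e \<ge> 2" and \<tau>: "bij_betw \<tau> {..<n} {..<n}"
begin

private abbreviation (input) D where "D \<equiv> division_transducer n d \<tau>"

lemma division_letter_less: "j < d \<Longrightarrow> a < n \<Longrightarrow> e * j + a div d < n"
proof -
  assume j: "j < d" and a: "a < n"
  have "a div d < e" using a n d by (simp add: less_mult_imp_div_less)
  then have "e * j + a div d < e * (j + 1)" by simp
  also have "\<dots> \<le> e * d" using j by (intro mult_le_mono2) simp
  finally show ?thesis using n by simp
qed

lemma division_simps:
  "states D = {..<d}" "next_state D a j = a mod d" "out D a j = [\<tau> (e * j + a div d)]"
  using n d by (simp_all add: division_transducer_def)

lemma \<tau>_less: "b < n \<Longrightarrow> \<tau> b < n"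
  using bij_betw_apply[OF \<tau>] by simp

lemma \<tau>_inject: "a < n \<Longrightarrow> b < n \<Longrightarrow> \<tau> a = \<tau> b \<longleftrightarrow> a = b"
  using bij_betw_imp_inj_on[OF \<tau>] by (auto dest: inj_onD)

lemma division_length: "length (output_word D w j) = length w"
  by (induction w arbitrary: j) (simp_all add: division_simps)

lemma division_is_transducer: "is_transducer n D"
  unfolding is_transducer_def division_length
proof (intro conjI ballI allI impI)
  show "countable (states D)" "states D \<noteq> {}" using d by (auto simp: division_simps)
  show "next_state D a j \<in> states D" for a j using d by (simp add: division_simps)
  show "out D a j \<in> words n" if "a < n" "j \<in> states D" for a j
    using \<tau>_less division_letter_less that by (simp add: division_simps)
  show "\<exists>k. N \<le> length (seq_take k x)" for N and x :: "nat \<Rightarrow> nat" by (intro exI[of _ N]) simp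
qed

lemma division_map:
  assumes "x \<in> sequences n" "j < d"
  shows "induced_map D j x i = \<tau> (e * (if i = 0 then j else x (i - 1) mod d) + x i div d)"
  using assms
proof (induction i arbitrary: x j)
  case 0
  obtain a y where x: "x = a ## y" "a < n" "y \<in> sequences n" using 0(1) by (rule seq_cases)
  have "induced_map D j x = out D a j \<frown> induced_map D (next_state D a j) y"
    unfolding x(1) by (rule induced_map_build[OF division_is_transducer _ x(2,3)]) (simp add: division_simps 0)
  then show ?case using x(1) by (simp add: division_simps)
next
  case (Suc i)
  obtain a y where x: "x = a ## y" "a < n" "y \<in> sequences n" using Suc.prems(1) by (rule seq_cases)
  have "induced_map D j x = out D a j \<frown> induced_map D (next_state D a j) y"
    unfolding x(1) by (rule induced_map_build[OF division_is_transducer _ x(2,3)]) (simp add: division_simps Suc.prems)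
  then have "induced_map D j x (Suc i) = induced_map D (a mod d) y i" by (simp add: division_simps)
  also have "\<dots> = \<tau> (e * (if i = 0 then a mod d else y (i - 1) mod d) + y i div d)"
    by (rule Suc.IH[OF x(3)]) (use d in simp)
  finally show ?case using x(1) by (cases i) simp_all
qed

lemma division_inj: assumes j: "j < d" shows "inj_on (induced_map D j) (sequences n)"
proof (rule inj_onI)
  fix x y assume x: "x \<in> sequences n" and y: "y \<in> sequences n" and eq: "induced_map D j x = induced_map D j y"
  let ?s = "\<lambda>x i. if i = 0 then j else x (i - 1) mod d"
  have xi: "x i < n" "y i < n" for i using x y by (simp_all add: sequences_eq)
  have s: "?s x i < d" "?s y i < d" for i using j d by simp_all
  have "?s x i = ?s y i \<and> x i div d = y i div d" for i
  proof -
    have "\<tau> (e * ?s x i + x i div d) = \<tau> (e * ?s y i + y i div d)"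
      using fun_cong[OF eq, of i] unfolding division_map[OF x j] division_map[OF y j] .
    then have eq': "e * ?s x i + x i div d = e * ?s y i + y i div d"
      using \<tau>_inject[OF division_letter_less[OF s(1) xi(1)] division_letter_less[OF s(2) xi(2)]] by blast
    have lt: "x i div d < e" "y i div d < e" using xi[of i] n d by (simp_all add: less_mult_imp_div_less)
    have "u = v \<and> p = q" if "e * u + p = e * v + q" "p < e" "q < e" for u v p q
    proof -
      have "u = (e * u + p) div e" using that(2) by simp
      also have "\<dots> = (e * v + q) div e" unfolding that(1) ..
      also have "\<dots> = v" using that(3) by simp
      finally have "u = v" .
      then show ?thesis using that(1) by simp
    qed
    from this[OF eq' lt] show ?thesis .
  qed
  note eqs = this
  show "x = y"
  proof
    fix i
    have "x i mod d = y i mod d" using conjunct1[OF eqs[of "Suc i"]] by simp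
    moreover have "x i div d = y i div d" using conjunct2[OF eqs[of i]] .
    ultimately show "x i = y i" by (metis div_mult_mod_eq)
  qed
qed

text \<open>A sequence in the right hand side is the quotient of the sequence with digits \<open>(t i mod e) * d + t (i + 1) div e\<close>, where
  \<open>t\<close> is the sequence before the permutation of the alphabet: its digits record a remainder and the next
  partial quotient.\<close>

lemma division_image:
  assumes j: "j < d"
  shows "state_image n D j = {y \<in> sequences n. \<exists>b<e. y 0 = \<tau> (e * j + b)}"
proof (intro equalityI subsetI)
  fix y assume "y \<in> state_image n D j"
  then obtain x where x: "x \<in> sequences n" "y = induced_map D j x" unfolding state_image_def by blast
  have "x 0 div d < e" using x(1) n d by (simp add: less_mult_imp_div_less sequences_eq)
  then show "y \<in> {y \<in> sequences n. \<exists>b<e. y 0 = \<tau> (e * j + b)}"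
    using division_map[OF x(1) j, of 0] x induced_map_in_sequences[OF division_is_transducer _ x(1), of j] j
    by (auto simp: division_simps)
next
  fix y assume "y \<in> {y \<in> sequences n. \<exists>b<e. y 0 = \<tau> (e * j + b)}"
  then obtain b where y: "y \<in> sequences n" and b: "b < e" "y 0 = \<tau> (e * j + b)" by blast
  define t where "t i = inv_into {..<n} \<tau> (y i)" for i
  have t: "t i < n" "\<tau> (t i) = y i" for i
  proof -
    have "y i \<in> \<tau> ` {..<n}" using \<tau> y by (simp add: bij_betw_def sequences_eq)
    then show "t i < n" "\<tau> (t i) = y i"
      unfolding t_def using inv_into_into[of "y i" \<tau> "{..<n}"] f_inv_into_f[of "y i" \<tau> "{..<n}"] by auto
  qed
  have "e * j + b < n" 
  proof -
    have "e * j + b < e * (j + 1)" using b by simp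
    also have "\<dots> \<le> e * d" using j by (intro mult_le_mono2) simp
    finally show ?thesis using n by simp
  qed
  then have t0: "t 0 = e * j + b" using \<tau>_inject[OF t(1)[of 0], of "e * j + b"] t(2)[of 0] b(2) by simp
  have te: "t i div e < d" for i using t(1)[of i] n by (simp add: less_mult_imp_div_less mult.commute)
  define x where "x i = (t i mod e) * d + t (Suc i) div e" for i
  have x_div: "x i div d = t i mod e" and x_mod: "x i mod d = t (Suc i) div e" for i
    using te[of "Suc i"] d by (simp_all add: x_def)
  have "x i < n" for i
  proof -
    have "x i < (t i mod e + 1) * d" using te[of "Suc i"] by (simp add: x_def)
    also have "\<dots> \<le> e * d" using e by (intro mult_le_mono1) (simp add: Suc_leI)
    finally show ?thesis using n by simp
  qed
  then have x: "x \<in> sequences n" by (simp add: sequences_eq)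
  have "induced_map D j x i = y i" for i
  proof -
    have "(if i = 0 then j else x (i - 1) mod d) = t i div e"
    proof (cases i)
      case 0
      then show ?thesis using t0 b by simp
    next
      case (Suc k)
      then show ?thesis using x_mod[of k] by simp
    qed
    then show ?thesis unfolding division_map[OF x j] x_div using t(2)[of i] by simp
  qed
  then have "induced_map D j x = y" by (rule ext)
  then show "y \<in> state_image n D j" using x unfolding state_image_def by blast
qed

lemma openin_first_letter: "openin (sequence_space n) {y \<in> sequences n. P (y 0)}"
  unfolding openin_sequence_space by (auto intro!: exI[of _ 1] simp: seq_take_def)

text \<open>Complete response uses \<open>e \<ge> 2\<close>: the image of a state then meets two different cones of length one.\<close>

lemma division_SO: "is_SO_transducer n D"
proof -
  have n0: "n > 0" using n d e by simp
  have sync: "synchronizing_at_level n D 1"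
    unfolding synchronizing_at_level_def
  proof (intro ballI impI)
    fix w p q assume "length (w :: nat list) = 1"
    then obtain a where "w = [a]" by (auto simp: length_Suc_conv)
    then show "next_state_word D w p = next_state_word D w q" by (simp add: division_simps)
  qed
  have letter: "[a] \<in> words n" "next_state_word D [a] q = a" if "a < d" for a q
  proof -
    have "d \<le> n" using n e by simp
    then show "[a] \<in> words n" "next_state_word D [a] q = a" using that by (simp_all add: division_simps)
  qed
  show ?thesis
    unfolding is_SO_transducer_def minimal_transducer_def division_simps
  proof (intro conjI ballI impI)
    show "is_transducer n D" by (rule division_is_transducer)
    show "strongly_synchronizing n D" using sync unfolding strongly_synchronizing_def by blast
    show "strongly_connected n D"
      unfolding strongly_connected_def division_simps using letter by blast
    show "is_core n D"
      unfolding is_core_iff core_states_eq[OF sync division_is_transducer n0] division_simps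
    proof (intro equalityI subsetI)
      fix s assume "s \<in> {next_state_word D w q |w q. w \<in> words n \<and> length w = 1 \<and> q \<in> {..<d}}"
      then show "s \<in> {..<d}"
        using transducer_word(1)[OF division_is_transducer] unfolding division_simps by blast
    next
      fix s assume "s \<in> {..<d}"
      then have "s = next_state_word D [s] 0 \<and> [s] \<in> words n \<and> length [s] = 1 \<and> (0::nat) \<in> {..<d}"
        using letter d by simp
      then show "s \<in> {next_state_word D w q |w q. w \<in> words n \<and> length w = 1 \<and> q \<in> {..<d}}" by blast
    qed
  next
    fix p q assume p: "p \<in> {..<d}" and q: "q \<in> {..<d}" and eq: "omega_equiv n D p q"
    let ?z = "\<lambda>_::nat. 0::nat"
    have z: "?z \<in> sequences n" using n0 by (simp add: sequences_eq)
    have "induced_map D p ?z 0 = induced_map D q ?z 0" using eq z unfolding omega_equiv_def by metis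
    then have "\<tau> (e * p) = \<tau> (e * q)" using division_map[OF z, of _ 0] p q by simp
    then show "p = q"
      using \<tau>_inject[of "e * p" "e * q"] division_letter_less[of p 0] division_letter_less[of q 0] p q e n0 by simp
  next
    fix j assume "j \<in> {..<d}"
    then have j: "j < d" by simp
    note im = division_image[OF j]
    show "inj_on (induced_map D j) (sequences n)" by (rule division_inj[OF j])
    show "openin (sequence_space n) (state_image n D j)" unfolding im by (rule openin_first_letter)
    have "sequences n - {y \<in> sequences n. \<exists>b<e. y 0 = \<tau> (e * j + b)}
        = {y \<in> sequences n. \<not> (\<exists>b<e. y 0 = \<tau> (e * j + b))}" by blast
    then have "openin (sequence_space n) (sequences n - {y \<in> sequences n. \<exists>b<e. y 0 = \<tau> (e * j + b)})"
      using openin_first_letter by simp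
    then show "closedin (sequence_space n) (state_image n D j)" unfolding im closedin_def by blast
    show "\<not> incomplete_response n D j"
    proof
      assume "incomplete_response n D j"
      then obtain u where u: "u \<noteq> []" "\<forall>y\<in>state_image n D j. is_prefix_of u y"
        unfolding incomplete_response_def by blast
      define y where "y b = (\<lambda>_::nat. \<tau> (e * j + b))" for b
      have lt: "e * j + b < n" if "b < 2" for b
      proof -
        have "e * j + b < e * (j + 1)" using e that by simp
        also have "\<dots> \<le> e * d" using j by (intro mult_le_mono2) simp
        finally show ?thesis using n by simp
      qed
      have "y b \<in> state_image n D j" if b: "b < 2" for b
        unfolding im using \<tau>_less[OF lt[OF b]] e b by (auto simp: y_def sequences_eq intro!: exI[of _ b])
      then have "is_prefix_of u (y 0)" "is_prefix_of u (y 1)" using u(2) by simp_all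
      then have "y 0 0 = y 1 0" using u(1) by (simp add: is_prefix_of_nth)
      then show False using \<tau>_inject[OF lt[of 0] lt[of 1]] by (simp add: y_def)
    qed
  qed
qed

text \<open>State \<open>j\<close> acts as \<open>t \<mapsto> (j + t) / d\<close>, or as one minus this after reflection.\<close>

lemma division_slope:
  assumes \<tau>_eq: "(\<forall>b<n. \<tau> b = b) \<and> \<sigma> = 1 \<or> (\<forall>b<n. \<tau> b = n - 1 - b) \<and> \<sigma> = - 1"
  shows "has_slope n D (\<sigma> / real d)"
  unfolding has_slope_def
proof
  fix j assume j: "j \<in> states D"
  have n2: "n \<ge> 2" using n d e by (metis Suc_leI le_trans mult_le_mono2 mult.right_neutral One_nat_def)
  define A where "A j = (if \<sigma> = 1 then real j / real d else 1 - real j / real d)" for j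
  have nr: "real n = real e * real d" using n by simp
  have d0: "real d > 0" "real e > 0" using d e by simp_all
  have "val n (induced_map D j x) = A j + \<sigma> / real d * val n x" if x: "x \<in> sequences n" for x
  proof (rule affine_by_recursion[OF n2 division_is_transducer _ _ _ j x, where m = "\<lambda>_. \<sigma> / real d"])
    show "finite (states D)" by (simp add: division_simps)
    fix j a assume j: "j \<in> states D" and a: "a < n"
    let ?b = "e * j + a div d"
    have b: "?b < n" using division_letter_less[OF _ a] j by (simp add: division_simps)
    have ra: "real a = real d * real (a div d) + real (a mod d)" by (simp flip: of_nat_mult of_nat_add)
    show "\<sigma> / real d / real n ^ length (out D a j) = \<sigma> / real d / real n" by (simp add: division_simps)
    from \<tau>_eq show "(real (num n (out D a j)) + A (next_state D a j)) / real n ^ length (out D a j)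
        = A j + real a / real n * (\<sigma> / real d)"
    proof
      assume "(\<forall>b<n. \<tau> b = b) \<and> \<sigma> = 1"
      then show ?thesis using b d0 unfolding nr by (simp add: division_simps A_def ra field_simps)
    next
      assume *: "(\<forall>b<n. \<tau> b = n - 1 - b) \<and> \<sigma> = - 1"
      have "real (\<tau> ?b) = real n - 1 - real ?b" using * b by (simp add: of_nat_diff)
      then have r\<tau>: "real (\<tau> ?b) = real e * real d - 1 - (real e * real j + real (a div d))" unfolding nr by simp
      show ?thesis using * d0 unfolding nr by (simp add: division_simps A_def ra r\<tau>) (simp add: field_simps)
    qed
  qed
  moreover have "\<sigma> / real d * val n x = \<sigma> / real d * real n powi 0 * val n x" for x by simp
  ultimately show "\<exists>\<alpha>. \<exists>k. \<forall>x\<in>sequences n. val n (induced_map D j x) = \<alpha> + \<sigma> / real d * real n powi k * val n x"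
    by (intro exI[of _ "A j"] exI[of _ 0]) simp
qed

end

lemma ex_slope_inverse_divisor:
  assumes n: "n \<ge> 2" and d: "d dvd n" "d < n"
  shows "\<exists>V :: nat transducer. is_SO_transducer n V \<and> has_slope n V (1 / real d)"
proof -
  obtain e where e: "n = e * d" using d by (metis dvdE mult.commute)
  have "d > 0" "e \<ge> 2" using e n d
    by (metis gr0I mult_0_right not_numeral_le_zero, metis One_nat_def less_2_cases_iff mult_0 mult_1 nat_neq_iff not_le not_numeral_le_zero)
  moreover have "bij_betw (\<lambda>b. b) {..<n} {..<n}" by (simp add: bij_betw_def)
  ultimately show ?thesis
    using division_SO[OF e] division_slope[OF e, of "\<lambda>b. b" 1] by blast
qed

lemma ex_slope_minus_one:
  assumes n: "n \<ge> 2"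
  shows "\<exists>V :: nat transducer. is_SO_transducer n V \<and> has_slope n V (- 1)"
proof -
  have "bij_betw (\<lambda>b. n - 1 - b) {..<n} {..<n}"
    by (rule bij_betw_byWitness[where f' = "\<lambda>b. n - 1 - b"]) auto
  then show ?thesis
    using division_SO[of n n 1 "\<lambda>b. n - 1 - b"] division_slope[of n n 1 "\<lambda>b. n - 1 - b" "- 1"] n by auto
qed

section \<open>Classes of transducers of a given slope\<close>

text \<open>The elements of the group, indexed by slopes. The empty set arises for numbers that are not slopes.\<close>

definition slope_class :: "nat \<Rightarrow> real \<Rightarrow> nat transducer set" where
  "slope_class n r = {V. is_SO_transducer n V \<and> has_slope n V r}"

lemma transducer_class_eq_slope_class:
  assumes n: "n \<ge> 2" and T: "is_SO_transducer n T" and r: "has_slope n T r"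
  shows "transducer_class n T = slope_class n r"
  using has_slope_iso[OF _ r] iso_if_same_slope[OF n _ T _ r]
  unfolding transducer_class_def slope_class_def by blast

lemma identity_map:
  assumes x: "x \<in> sequences n" shows "induced_map identity_transducer 0 x = x"
proof -
  have len: "output_word identity_transducer w q = w" for w q
    by (induction w arbitrary: q) (simp_all add: identity_transducer_def)
  have tr: "is_transducer n identity_transducer"
    unfolding is_transducer_def len by (auto simp: identity_transducer_def)
  show ?thesis
    by (rule induced_map_unique[OF tr _ x])
       (simp_all add: len identity_transducer_def[THEN arg_cong, of states] is_prefix_of_def)
qed

lemma states_identity [simp]: "states identity_transducer = {0}"
  by (simp add: identity_transducer_def)

lemma one_SO_eq_slope_class:
  assumes n: "n \<ge> 2" shows "transducer_class n identity_transducer = slope_class n 1"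
proof -
  let ?D = "division_transducer n 1 (\<lambda>b. b)"
  have bij: "bij_betw (\<lambda>b. b) {..<n} {..<n}" by (simp add: bij_betw_def)
  have D: "is_SO_transducer n ?D" "has_slope n ?D 1"
    using division_SO[of n n 1 "\<lambda>b. b"] division_slope[of n n 1 "\<lambda>b. b" 1] n bij by simp_all
  have Dmap: "induced_map ?D 0 x = x" if x: "x \<in> sequences n" for x
  proof
    show "induced_map ?D 0 x i = x i" for i
      using division_map[of n n 1 "\<lambda>b. b" x 0 i] n bij x by simp
  qed
  have "transducer_iso n identity_transducer ?D"
    unfolding transducer_iso_def
    by (rule exI[of _ "\<lambda>q. q"]) (auto simp: identity_map Dmap[unfolded One_nat_def] division_transducer_def[THEN arg_cong, of states] bij_betw_def)
  note iso = this
  show ?thesis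
    unfolding transducer_class_eq_slope_class[OF n D, symmetric] transducer_class_def
    using transducer_iso_trans[OF _ iso] transducer_iso_trans[OF _ transducer_iso_sym[OF iso]] by blast
qed

lemma mult_slope_class:
  assumes n: "n \<ge> 2" and r: "slope_class n r \<noteq> {}" and s: "slope_class n s \<noteq> {}"
  shows "mult (SO n) (slope_class n r) (slope_class n s) = slope_class n (r * s)"
proof -
  have "transducer_class n (reduced_product n T U) = slope_class n (r * s)"
    if "T \<in> slope_class n r" "U \<in> slope_class n s" for T U
  proof -
    have T: "is_SO_transducer n T" "has_slope n T r" and U: "is_SO_transducer n U" "has_slope n U s"
      using that by (simp_all add: slope_class_def)
    show ?thesis
      by (rule transducer_class_eq_slope_class[OF n reduced_product(1)[OF n T(1) U(1)]
            has_slope_reduced_product[OF n T(1) U(1) T(2) U(2)]])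
  qed
  then show ?thesis using r s by (auto simp: SO_def)
qed

lemma slope_class_nonempty_mult:
  assumes n: "n \<ge> 2" and r: "slope_class n r \<noteq> {}" and s: "slope_class n s \<noteq> {}"
  shows "slope_class n (r * s) \<noteq> {}"
proof -
  obtain T U where T: "is_SO_transducer n T" "has_slope n T r" and U: "is_SO_transducer n U" "has_slope n U s"
    and TU: "T \<in> slope_class n r" "U \<in> slope_class n s"
    using r s by (auto simp: slope_class_def)
  obtain V :: "nat transducer" where V: "is_SO_transducer n V" "transducer_iso n V (reduced_product n T U)"
    using nat_representative[OF reduced_product(1)[OF n T(1) U(1)]] n by auto
  have "V \<in> slope_class n (r * s)"
    using V has_slope_iso[OF V(2) has_slope_reduced_product[OF n T(1) U(1) T(2) U(2)]]
    by (simp add: slope_class_def)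
  then show ?thesis by blast
qed

lemma slope_class_eq_iff:
  assumes n: "n \<ge> 2" and r: "slope_class n r \<noteq> {}"
  shows "slope_class n r = slope_class n s \<longleftrightarrow> (\<exists>j. s = r * real n powi j)"
proof
  assume eq: "slope_class n r = slope_class n s"
  obtain T where T: "T \<in> slope_class n r" using r by blast
  then have "is_transducer n T" "has_slope n T r" "has_slope n T s"
    using eq SO_D(1) by (auto simp: slope_class_def)
  from has_slope_unique[OF n this] show "\<exists>j. s = r * real n powi j" by blast
next
  assume "\<exists>j. s = r * real n powi j"
  then obtain j where j: "s = r * real n powi j" by blast
  have "s * real n powi (- j) = r" unfolding j using n by (simp add: power_int_minus)
  then have "has_slope n V r \<longleftrightarrow> has_slope n V s" for V :: "nat transducer"
    using has_slope_scale[OF n, of V r j] has_slope_scale[OF n, of V s "- j"] j by metis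
  then show "slope_class n r = slope_class n s" unfolding slope_class_def by simp
qed

lemma slope_class_in_SO:
  assumes n: "n \<ge> 2" and r: "slope_class n r \<noteq> {}" shows "slope_class n r \<in> carrier (SO n)"
proof -
  obtain T :: "nat transducer" where T: "is_SO_transducer n T" "has_slope n T r"
    using r by (auto simp: slope_class_def)
  then show ?thesis using transducer_class_eq_slope_class[OF n T] unfolding SO_def by auto
qed

lemma one_SO: assumes "n \<ge> 2" shows "one (SO n) = slope_class n 1"
  using one_SO_eq_slope_class[OF assms] by (simp add: SO_def)

text \<open>The inverse is the class of the inverse slope; the remaining conditions are \<open>slope_order\<close> and
  \<open>slope_length_preserving\<close>.\<close>

lemma slope_class_in_TO_L:
  assumes n: "n \<ge> 2" and r: "slope_class n r \<noteq> {}" and r': "slope_class n (1 / r) \<noteq> {}"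
  shows "slope_class n r \<in> TO n \<inter> L n"
proof -
  have r0: "r \<noteq> 0" using r has_slope_nonzero[OF n] by (auto simp: slope_class_def)
  have "slope_class n r \<in> Units (SO n)"
    unfolding Units_def one_SO[OF n]
    using slope_class_in_SO[OF n r] slope_class_in_SO[OF n r'] mult_slope_class[OF n r r']
      mult_slope_class[OF n r' r] r0 by auto
  then have O: "slope_class n r \<in> carrier (O_group n)" by (simp add: O_group_def units_of_def)
  have "(\<forall>t\<in>states T. preserves_lex n (induced_map T t)) \<or> (\<forall>t\<in>states T. reverses_lex n (induced_map T t))"
    if "T \<in> slope_class n r" for T
  proof -
    have T: "is_SO_transducer n T" "has_slope n T r" using that by (simp_all add: slope_class_def)
    show ?thesis using slope_order[OF n T] r0 by (cases "r > 0") auto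
  qed
  moreover have "length (output_word T w q) = length w"
    if "T \<in> slope_class n r" "w \<in> words n" "q \<in> states T" "next_state_word T w q = q" for T w q
    using slope_length_preserving[OF n _ _ that(2-4), of r] that(1) by (simp add: slope_class_def)
  ultimately show ?thesis using O by (simp add: TO_def L_def)
qed

section \<open>Invertible order-preserving transducers have a slope\<close>

text \<open>If the product of two classes is the identity, the states of the reduced product induce the identity, and undoing the
  removal of prefixes leaves a prefix \<open>u\<close>.\<close>

lemma inverse_maps:
  assumes n: "n \<ge> 2" and T: "is_SO_transducer n T" and U: "is_SO_transducer n U"
    and sub: "transducer_class n (reduced_product n T U) \<subseteq> transducer_class n identity_transducer"
    and p: "p \<in> states T"
  shows "\<exists>q\<in>states U. \<exists>u\<in>words n. \<forall>x\<in>sequences n. induced_map U q (induced_map T p x) = u \<frown> x"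
proof -
  let ?R = "reduced_product n T U"
  obtain V :: "nat transducer" where V: "is_SO_transducer n V" "transducer_iso n V ?R"
    using nat_representative[OF reduced_product(1)[OF n T U]] n by auto
  then have "transducer_iso n V identity_transducer" using sub unfolding transducer_class_def by blast
  then have "transducer_iso n ?R identity_transducer"
    by (rule transducer_iso_trans[OF transducer_iso_sym[OF V(2)]])
  then obtain f where f: "bij_betw f (states ?R) {0}"
    "\<forall>C\<in>states ?R. \<forall>x\<in>sequences n. induced_map ?R C x = induced_map identity_transducer (f C) x"
    unfolding transducer_iso_def states_identity by blast
  have id: "induced_map ?R C x = x" if "C \<in> states ?R" "x \<in> sequences n" for C x
    using f(2) that bij_betw_apply[OF f(1) that(1)] identity_map[OF that(2)] by simp
  obtain q C u where "q \<in> states U" "C \<in> states ?R" "u \<in> words n"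
    "\<forall>x\<in>sequences n. u \<frown> induced_map ?R C x = induced_map U q (induced_map T p x)"
    using reduced_product(3)[OF n T U p] by blast
  then show ?thesis using id by (intro bexI[of _ q] bexI[of _ u]) simp_all
qed

lemma less_fun_sandwich:
  assumes "less_fun (u \<frown> x) z" "less_fun z (u \<frown> (y :: nat \<Rightarrow> nat))"
  obtains z' where "z = u \<frown> z'"
proof -
  have "z i = u ! i" if "i < length u" for i
    using that
  proof (induction i rule: less_induct)
    case (less i)
    then have eq: "\<forall>j<i. z j = u ! j" by simp
    obtain k where k: "(u \<frown> x) k < z k" "\<forall>j<k. (u \<frown> x) j = z j" using assms(1) by (auto simp: less_fun_def)
    obtain m where m: "z m < (u \<frown> y) m" "\<forall>j<m. z j = (u \<frown> y) j" using assms(2) by (auto simp: less_fun_def)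
    have "\<not> k < i" "\<not> m < i" using k(1) m(1) eq less.prems by auto
    have "u ! i \<le> z i"
    proof (cases "k = i")
      case True
      then show ?thesis using k(1) less.prems by simp
    next
      case False
      then show ?thesis using k(2)[rule_format, of i] \<open>\<not> k < i\<close> less.prems by simp
    qed
    moreover have "z i \<le> u ! i"
    proof (cases "m = i")
      case True
      then show ?thesis using m(1) less.prems by simp
    next
      case False
      then show ?thesis using m(2)[rule_format, of i] \<open>\<not> m < i\<close> less.prems by simp
    qed
    ultimately show ?case by simp
  qed
  then have "is_prefix_of u z" by (simp add: is_prefix_of_nth)
  then show ?thesis using that is_prefix_of_iff by blast
qed

text \<open>A strictly monotone map on a linear order reflects the order, so whatever it takes back to the identity, here up to the
  prefix \<open>v\<close>, is monotone in the same direction.\<close>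

lemma lex_inverse:
  assumes comp: "\<And>x. x \<in> sequences n \<Longrightarrow> h (g x) = v \<frown> x"
    and g: "\<And>x. x \<in> sequences n \<Longrightarrow> g x \<in> sequences n"
  shows "preserves_lex n h \<Longrightarrow> preserves_lex n g" "reverses_lex n h \<Longrightarrow> reverses_lex n g"
proof -
  have ne: "g x \<noteq> g y" if "x \<in> sequences n" "y \<in> sequences n" "less_fun x y" for x y
  proof
    assume "g x = g y"
    then have "v \<frown> x = v \<frown> y" using comp that by metis
    then have "x = y" by (simp only: same_concat_eq)
    then show False using that(3) less_fun_irrefl by blast
  qed
  have hg: "less_fun (h (g x)) (h (g y)) \<longleftrightarrow> less_fun x y" if "x \<in> sequences n" "y \<in> sequences n" for x y
    using comp that by simp
  show "preserves_lex n g" if h: "preserves_lex n h"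
    unfolding preserves_lex_def
  proof (intro ballI impI)
    fix x y assume xy: "x \<in> sequences n" "y \<in> sequences n" "less_fun x y"
    have "\<not> less_fun (g y) (g x)"
    proof
      assume "less_fun (g y) (g x)"
      then have "less_fun y x" using h g xy hg unfolding preserves_lex_def by blast
      then show False using xy(3) less_fun_asym by blast
    qed
    then show "less_fun (g x) (g y)" using less_fun_total ne[OF xy] by blast
  qed
  show "reverses_lex n g" if h: "reverses_lex n h"
    unfolding reverses_lex_def
  proof (intro ballI impI)
    fix x y assume xy: "x \<in> sequences n" "y \<in> sequences n" "less_fun x y"
    have "\<not> less_fun (g x) (g y)"
    proof
      assume "less_fun (g x) (g y)"
      then have "less_fun y x" using h g xy hg unfolding reverses_lex_def by blast
      then show False using xy(3) less_fun_asym by blast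
    qed
    then show "less_fun (g y) (g x)" using less_fun_total ne[OF xy] by blast
  qed
qed

text \<open>Anything between the images of two neighbours would be mapped by \<open>g\<close> to something between the neighbours, with the
  prefix \<open>u\<close> in front.\<close>

lemma adjacent_if_invertible:
  assumes n: "n \<ge> 2" and comp: "\<And>x. x \<in> sequences n \<Longrightarrow> g (h x) = u \<frown> x"
    and h: "\<And>x. x \<in> sequences n \<Longrightarrow> h x \<in> sequences n" and g: "\<And>x. x \<in> sequences n \<Longrightarrow> g x \<in> sequences n"
    and mono: "preserves_lex n h \<and> preserves_lex n g \<or> reverses_lex n h \<and> reverses_lex n g"
    and a: "a + 1 < n"
  shows "val n (h (a ## nines n)) = val n (h ((a + 1) ## (\<lambda>_. 0)))"
proof (rule ccontr)
  let ?x = "a ## nines n" and ?y = "(a + 1) ## (\<lambda>_. 0)"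
  have xs: "?x \<in> sequences n" and ys: "?y \<in> sequences n"
    using a nines_in_sequences[OF n] zeros_in_sequences[OF n] by simp_all
  have lt: "less_fun ?x ?y" by simp
  assume ne: "val n (h ?x) \<noteq> val n (h ?y)"
  have contra: False if z: "z \<in> sequences n" and lo: "less_fun (u \<frown> ?x) (g z)" and hi: "less_fun (g z) (u \<frown> ?y)" for z
  proof -
    obtain z' where z': "g z = u \<frown> z'" using less_fun_sandwich[OF lo hi] .
    then have "z' \<in> sequences n" using g[OF z] by simp
    moreover have "less_fun ?x z'" "less_fun z' ?y" using lo hi unfolding z' by (simp_all only: less_fun_conc)
    ultimately show False using no_seq_between_adjacent by blast
  qed
  from mono show False
  proof
    assume m: "preserves_lex n h \<and> preserves_lex n g"
    then have "less_fun (h ?x) (h ?y)" using xs ys lt unfolding preserves_lex_def by blast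
    then obtain z where z: "z \<in> sequences n" "less_fun (h ?x) z" "less_fun z (h ?y)"
      using less_fun_gap[OF n _ h[OF xs] h[OF ys] ne] by blast
    then have "less_fun (g (h ?x)) (g z)" "less_fun (g z) (g (h ?y))"
      using m h[OF xs] h[OF ys] unfolding preserves_lex_def by blast+
    then show False using contra[OF z(1)] unfolding comp[OF xs] comp[OF ys] by blast
  next
    assume m: "reverses_lex n h \<and> reverses_lex n g"
    then have "less_fun (h ?y) (h ?x)" using xs ys lt unfolding reverses_lex_def by blast
    then obtain z where z: "z \<in> sequences n" "less_fun (h ?y) z" "less_fun z (h ?x)"
      using less_fun_gap[OF n _ h[OF ys] h[OF xs]] ne by metis
    then have "less_fun (g (h ?x)) (g z)" "less_fun (g z) (g (h ?y))"
      using m h[OF xs] h[OF ys] unfolding reverses_lex_def by blast+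
    then show False using contra[OF z(1)] unfolding comp[OF xs] comp[OF ys] by blast
  qed
qed

text \<open>Solving \<open>\<alpha> + r n\<^sup>k val (h\<^sub>q x) = val (v x)\<close> for \<open>val (h\<^sub>q x)\<close>.\<close>

lemma has_slope_inverse:
  assumes n: "n \<ge> 2" and T: "is_SO_transducer n T" and U: "is_SO_transducer n U" and slope: "has_slope n T r"
    and inv: "\<And>q. q \<in> states U \<Longrightarrow> \<exists>p\<in>states T. \<exists>v\<in>words n. \<forall>x\<in>sequences n. induced_map T p (induced_map U q x) = v \<frown> x"
  shows "has_slope n U (1 / r)"
  unfolding has_slope_def
proof
  fix q assume q: "q \<in> states U"
  obtain p v where p: "p \<in> states T" "v \<in> words n"
    "\<forall>x\<in>sequences n. induced_map T p (induced_map U q x) = v \<frown> x" using inv[OF q] by blast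
  obtain \<alpha> k where aff: "\<forall>x\<in>sequences n. val n (induced_map T p x) = \<alpha> + r * real n powi k * val n x"
    using slope p unfolding has_slope_def by blast
  have r: "r \<noteq> 0" by (rule has_slope_nonzero[OF n T slope])
  have n0: "real n \<noteq> 0" using n by simp
  let ?N = "real n ^ length v" and ?K = "real n powi k"
  have "val n (induced_map U q x) = (real (num n v) / ?N - \<alpha>) / (r * ?K) + 1 / r * real n powi (- k - int (length v)) * val n x"
    if x: "x \<in> sequences n" for x
  proof -
    have Ux: "induced_map U q x \<in> sequences n" by (rule induced_map_in_sequences[OF SO_D(1)[OF U] q x])
    have "\<alpha> + r * ?K * val n (induced_map U q x) = (real (num n v) + val n x) / ?N"
      using bspec[OF aff Ux] val_conc[OF n p(2) x] unfolding bspec[OF p(3) x] by simp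
    then have "val n (induced_map U q x) = ((real (num n v) + val n x) / ?N - \<alpha>) / (r * ?K)"
      using r n0 by (simp add: field_simps)
    moreover have "real n powi (- k - int (length v)) = 1 / (?K * ?N)"
      using n0 by (simp add: power_int_diff power_int_minus field_simps)
    ultimately show ?thesis using r n0 by (simp add: add_divide_distrib diff_divide_distrib)
  qed
  then show "\<exists>\<alpha>. \<exists>k. \<forall>x\<in>sequences n. val n (induced_map U q x) = \<alpha> + 1 / r * real n powi k * val n x" by blast
qed

lemma slope_nadic:
  assumes n: "n \<ge> 2" and T: "is_SO_transducer n T" and slope: "has_slope n T r"
  shows "nadic n r"
proof -
  obtain q where q: "q \<in> states T" using transducer_state_ex[OF SO_D(1)[OF T]] by blast
  obtain \<alpha> k where aff: "\<forall>x\<in>sequences n. val n (induced_map T q x) = \<alpha> + r * real n powi k * val n x"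
    using slope q unfolding has_slope_def by blast
  have "nadic n (r * real n powi k * real n powi (- k))"
    using nadic_mult[OF affine_nadic(2)[OF n T q aff] nadic_powi[of n "- k"]] n by simp
  moreover have "r * real n powi k * real n powi (- k) = r" using n by (simp add: power_int_minus)
  ultimately show ?thesis by (simp only:)
qed

lemma transducer_iso_refl: "transducer_iso n T T"
  unfolding transducer_iso_def by (rule exI[of _ "\<lambda>q. q"]) (auto simp: bij_betw_def)

lemma TO_L_slope:
  assumes n: "n \<ge> 2" and A: "A \<in> TO n \<inter> L n"
  obtains r where "A = slope_class n r" "slope_class n r \<noteq> {}" "r \<noteq> 0" "nadic n r" "nadic n (1 / r)"
proof -
  have AU: "A \<in> Units (SO n)" using A by (simp add: TO_def O_group_def units_of_def)
  then obtain B where B: "A \<in> carrier (SO n)" "B \<in> carrier (SO n)" "B \<otimes>\<^bsub>SO n\<^esub> A = \<one>\<^bsub>SO n\<^esub>" "A \<otimes>\<^bsub>SO n\<^esub> B = \<one>\<^bsub>SO n\<^esub>"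
    unfolding Units_def by blast
  obtain T :: "nat transducer" where T: "is_SO_transducer n T" "A = transducer_class n T"
    using B(1) unfolding SO_def by auto
  obtain U :: "nat transducer" where U: "is_SO_transducer n U" "B = transducer_class n U"
    using B(2) unfolding SO_def by auto
  have TA: "T \<in> A" and UB: "U \<in> B" using T U transducer_iso_refl unfolding transducer_class_def by auto
  have "transducer_class n (reduced_product n T U) \<subseteq> transducer_class n identity_transducer"
    using B(4) TA UB unfolding SO_def by auto
  note TU = inverse_maps[OF n T(1) U(1) this]
  have "transducer_class n (reduced_product n U T) \<subseteq> transducer_class n identity_transducer"
    using B(3) TA UB unfolding SO_def by auto
  note UT = inverse_maps[OF n U(1) T(1) this]
  note Tin = induced_map_in_sequences[OF SO_D(1)[OF T(1)]] and Uin = induced_map_in_sequences[OF SO_D(1)[OF U(1)]]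
  have lex: "(\<forall>t\<in>states T. preserves_lex n (induced_map T t)) \<or> (\<forall>t\<in>states T. reverses_lex n (induced_map T t))"
    using A TA by (simp add: TO_def)
  have U_lex: "(\<forall>t\<in>states T. preserves_lex n (induced_map T t)) \<longrightarrow> preserves_lex n (induced_map U q)"
    "(\<forall>t\<in>states T. reverses_lex n (induced_map T t)) \<longrightarrow> reverses_lex n (induced_map U q)"
    if q: "q \<in> states U" for q
  proof -
    obtain p v where p: "p \<in> states T" "\<forall>x\<in>sequences n. induced_map T p (induced_map U q x) = v \<frown> x"
      using UT[OF q] by blast
    show "(\<forall>t\<in>states T. preserves_lex n (induced_map T t)) \<longrightarrow> preserves_lex n (induced_map U q)"
      using lex_inverse(1)[OF bspec[OF p(2)] Uin[OF q]] p(1) by blast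
    show "(\<forall>t\<in>states T. reverses_lex n (induced_map T t)) \<longrightarrow> reverses_lex n (induced_map U q)"
      using lex_inverse(2)[OF bspec[OF p(2)] Uin[OF q]] p(1) by blast
  qed
  have L: "\<forall>w\<in>words n. \<forall>q\<in>states T. next_state_word T w q = q \<longrightarrow> length (output_word T w q) = length w"
    using A TA by (simp add: L_def)
  have adj: "val n (induced_map T t (a ## nines n)) = val n (induced_map T t ((a + 1) ## (\<lambda>_. 0)))"
    if t: "t \<in> states T" and a: "a + 1 < n" for t a
  proof -
    obtain q u where q: "q \<in> states U" "\<forall>x\<in>sequences n. induced_map U q (induced_map T t x) = u \<frown> x"
      using TU[OF t] by blast
    have "preserves_lex n (induced_map T t) \<and> preserves_lex n (induced_map U q)
        \<or> reverses_lex n (induced_map T t) \<and> reverses_lex n (induced_map U q)"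
      using lex U_lex[OF q(1)] t by blast
    from adjacent_if_invertible[OF n bspec[OF q(2)] Tin[OF t] Uin[OF q(1)] this a] show ?thesis .
  qed
  obtain r where r: "has_slope n T r" using has_slope_if_adjacent[OF n T(1) L adj] by blast
  have "A = slope_class n r" using transducer_class_eq_slope_class[OF n T(1) r] T(2) by simp
  moreover have "slope_class n r \<noteq> {}" using T(1) r by (auto simp: slope_class_def)
  moreover have "nadic n (1 / r)" by (rule slope_nadic[OF n U(1) has_slope_inverse[OF n T(1) U(1) r UT]])
  ultimately show ?thesis using that has_slope_nonzero[OF n T(1) r] slope_nadic[OF n T(1) r] by blast
qed

section \<open>Units of the ring of n-adic rationals\<close>

text \<open>Clearing denominators of \<open>r\<close> and \<open>1/r\<close> gives natural numbers whose product is a power of \<open>n\<close>; so they have no prime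
  factors other than those of \<open>n\<close>.\<close>

lemma nadic_unit_factorization:
  assumes n: "n \<ge> 2" and r: "r \<noteq> 0" and nr: "nadic n r" and nr': "nadic n (1 / r)"
  obtains e :: "nat \<Rightarrow> int" where "\<bar>r\<bar> = (\<Prod>p\<in>prime_factors n. real p powi e p)"
proof -
  obtain j where j: "r * real n ^ j \<in> \<int>" using nr by (auto simp: nadic_def)
  obtain k where k: "1 / r * real n ^ k \<in> \<int>" using nr' by (auto simp: nadic_def)
  obtain a' where a': "r * real n ^ j = of_int a'" using j by (auto elim: Ints_cases)
  obtain b' where b': "1 / r * real n ^ k = of_int b'" using k by (auto elim: Ints_cases)
  define a b where "a = nat \<bar>a'\<bar>" and "b = nat \<bar>b'\<bar>"
  have a: "\<bar>r\<bar> * real n ^ j = real a"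
    using arg_cong[OF a', of abs] by (simp add: a_def abs_mult)
  have b: "1 / \<bar>r\<bar> * real n ^ k = real b"
    using arg_cong[OF b', of abs] by (simp add: b_def abs_mult)
  have "real (a * b) = real (n ^ (j + k))"
    using r by (simp add: a[symmetric] b[symmetric] power_add)
  then have ab: "a * b = n ^ (j + k)" by (simp only: of_nat_eq_iff)
  have n0: "n \<noteq> 0" using n by simp
  then have a0: "a \<noteq> 0" using ab by (metis mult_zero_left power_not_zero)
  have sub: "prime_factors a \<subseteq> prime_factors n"
  proof
    fix p assume p: "p \<in> prime_factors a"
    then have "p dvd n ^ (j + k)" using ab by (metis dvd_mult2 in_prime_factors_imp_dvd)
    then have "p dvd n" using p in_prime_factors_imp_prime prime_dvd_power by blast
    then show "p \<in> prime_factors n" using p n0 by (simp add: in_prime_factors_iff)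
  qed
  have "a = (\<Prod>p\<in>prime_factors a. p ^ multiplicity p a)" using prime_factorization_nat a0 by simp
  also have "\<dots> = (\<Prod>p\<in>prime_factors n. p ^ multiplicity p a)"
  proof (rule prod.mono_neutral_left)
    show "\<forall>p\<in>prime_factors n - prime_factors a. p ^ multiplicity p a = 1"
      by (auto simp: prime_factors_multiplicity in_prime_factors_iff not_dvd_imp_multiplicity_0)
  qed (use sub in auto)
  finally have a_prod: "real a = (\<Prod>p\<in>prime_factors n. real p ^ multiplicity p a)"
    by (metis (no_types, lifting) of_nat_power of_nat_prod prod.cong)
  have "n = (\<Prod>p\<in>prime_factors n. p ^ multiplicity p n)" using prime_factorization_nat n0 by simp
  then have n_prod: "real n = (\<Prod>p\<in>prime_factors n. real p ^ multiplicity p n)"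
    by (metis (no_types, lifting) of_nat_power of_nat_prod prod.cong)
  have "\<bar>r\<bar> = real a / real n ^ j" using a n0 by (simp add: field_simps)
  also have "real n ^ j = (\<Prod>p\<in>prime_factors n. (real p ^ multiplicity p n) ^ j)"
    unfolding n_prod prod_power_distrib ..
  also have "real a / \<dots> = (\<Prod>p\<in>prime_factors n. real p ^ multiplicity p a / (real p ^ multiplicity p n) ^ j)"
    unfolding a_prod prod_dividef ..
  also have "\<dots> = (\<Prod>p\<in>prime_factors n. real p powi (int (multiplicity p a) - int (multiplicity p n * j)))"
  proof (rule prod.cong[OF refl])
    fix p assume "p \<in> prime_factors n"
    then have "real p \<noteq> 0" using in_prime_factors_imp_prime not_prime_0 by (metis of_nat_eq_0_iff)
    then have "real p powi (int (multiplicity p a) - int (multiplicity p n * j))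
        = real p powi int (multiplicity p a) / real p powi int (multiplicity p n * j)"
      by (intro power_int_diff) simp
    then show "real p ^ multiplicity p a / (real p ^ multiplicity p n) ^ j
        = real p powi (int (multiplicity p a) - int (multiplicity p n * j))"
      by (simp only: power_int_of_nat power_mult)
  qed
  finally show ?thesis by (rule that)
qed

lemma prime_powers_independent:
  assumes fin: "finite S" and S: "\<And>p. p \<in> S \<Longrightarrow> Factorial_Ring.prime (p :: nat)"
    and eq: "(\<Prod>p\<in>S. real p powi e p) = (\<Prod>p\<in>S. real p powi f p)" and p: "p \<in> S"
  shows "e p = f p"
proof -
  \<comment> \<open>Multiplying by \<open>p ^ M\<close> for all \<open>p\<close> makes all exponents natural numbers.\<close>
  define M where "M = nat (\<Sum>p\<in>S. \<bar>e p\<bar> + \<bar>f p\<bar>)"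
  have le: "\<bar>e q\<bar> + \<bar>f q\<bar> \<le> int M" if "q \<in> S" for q
  proof -
    have "\<bar>e q\<bar> + \<bar>f q\<bar> \<le> (\<Sum>p\<in>S. \<bar>e p\<bar> + \<bar>f p\<bar>)"
      by (rule member_le_sum[OF that _ fin]) simp
    then show ?thesis by (simp add: M_def)
  qed
  have nat: "(\<Prod>p\<in>S. real p powi g p) * (\<Prod>p\<in>S. real p ^ M) = real (\<Prod>p\<in>S. p ^ nat (g p + int M))"
    if g: "\<And>q. q \<in> S \<Longrightarrow> g q + int M \<ge> 0" for g
    unfolding prod.distrib[symmetric] of_nat_prod
  proof (rule prod.cong[OF refl])
    fix q assume q: "q \<in> S"
    have q0: "real q \<noteq> 0" using S[OF q] by (metis not_prime_0 of_nat_eq_0_iff)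
    have "real (q ^ nat (g q + int M)) = real q powi (g q + int M)"
      using g[OF q] by (simp add: power_int_def)
    also have "\<dots> = real q powi g q * real q ^ M" using power_int_add[of "real q" "g q" "int M"] q0 by simp
    finally show "real q powi g q * real q ^ M = real (q ^ nat (g q + int M))" by simp
  qed
  have e0: "e q + int M \<ge> 0" "f q + int M \<ge> 0" if "q \<in> S" for q using le[OF that] by linarith+
  have "real (\<Prod>p\<in>S. p ^ nat (e p + int M)) = real (\<Prod>p\<in>S. p ^ nat (f p + int M))"
    using nat[of e] nat[of f] e0 eq by simp
  then have "(\<Prod>p\<in>S. p ^ nat (e p + int M)) = (\<Prod>p\<in>S. p ^ nat (f p + int M))" by (simp only: of_nat_eq_iff)
  then have "nat (e p + int M) = nat (f p + int M)"
    using multiplicity_prod_prime_powers[OF fin S S[OF p], of "\<lambda>p. nat (e p + int M)"]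
      multiplicity_prod_prime_powers[OF fin S S[OF p], of "\<lambda>p. nat (f p + int M)"] p by simp
  then show ?thesis using e0[OF p] by linarith
qed

text \<open>For a prime factor \<open>p\<close> of \<open>n\<close>, division by \<open>n / p\<close> has slope \<open>p / n\<close>, which counts as \<open>p\<close>, and division by \<open>p\<close> has slope
  \<open>1 / p\<close>; for \<open>p = n\<close> the latter counts as 1, the slope of the identity.\<close>

lemma slope_class_exists:
  assumes n: "n \<ge> 2" and \<sigma>: "\<sigma> = 1 \<or> \<sigma> = - 1"
  shows "slope_class n (\<sigma> * (\<Prod>p\<in>prime_factors n. real p powi e p)) \<noteq> {}"
proof -
  define G where "G = {r. slope_class n r \<noteq> {}}"
  have mult: "r * s \<in> G" if "r \<in> G" "s \<in> G" for r s
    using slope_class_nonempty_mult[OF n] that by (simp add: G_def)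
  have scale: "r * real n powi j \<in> G" if "r \<in> G" for r j
    using slope_class_eq_iff[OF n, of r "r * real n powi j"] that unfolding G_def by force
  have one: "1 \<in> G" using ex_slope_inverse_divisor[OF n, of 1] n by (auto simp: G_def slope_class_def)
  have minus: "- 1 \<in> G" using ex_slope_minus_one[OF n] by (auto simp: G_def slope_class_def)
  have inv: "1 / real d \<in> G" if "d dvd n" "d < n" for d
    using ex_slope_inverse_divisor[OF n that] by (auto simp: G_def slope_class_def)
  have prime: "real p \<in> G \<and> 1 / real p \<in> G" if "p \<in> prime_factors n" for p
  proof -
    have p: "Factorial_Ring.prime p" "p dvd n" using that by auto
    then obtain d where d: "n = p * d" by blast
    have p2: "p \<ge> 2" using p(1) prime_ge_2_nat by blast
    have d0: "d > 0" using d n by (cases d) auto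
    have "d < n" using d p2 d0 by simp
    then have "1 / real d \<in> G" using inv d by simp
    from scale[OF this, of 1] have "real p \<in> G" using d d0 by simp
    moreover have "1 / real p \<in> G"
    proof (cases "p = n")
      case True
      then show ?thesis using scale[OF one, of "- 1"] by (simp add: power_int_minus inverse_eq_divide)
    next
      case False
      then have "p < n" using p(2) n by (simp add: dvd_imp_le le_neq_implies_less)
      then show ?thesis using inv p(2) by blast
    qed
    ultimately show ?thesis ..
  qed
  have pow: "s ^ m \<in> G" if "s \<in> G" for s and m :: nat
    using that one mult by (induction m) simp_all
  have powi: "real p powi j \<in> G" if "p \<in> prime_factors n" for p j
    using pow[of "real p"] pow[of "1 / real p"] prime[OF that]
    by (cases "j \<ge> 0") (simp_all add: power_int_def inverse_eq_divide)
  have "(\<Prod>p\<in>S. real p powi e p) \<in> G" if "finite S" "S \<subseteq> prime_factors n" for S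
    using that by (induction S rule: finite_induct) (simp_all add: one mult powi)
  then have "(\<Prod>p\<in>prime_factors n. real p powi e p) \<in> G" by simp
  then have "\<sigma> * (\<Prod>p\<in>prime_factors n. real p powi e p) \<in> G"
    using \<sigma> mult[OF minus] by auto
  then show ?thesis by (simp add: G_def)
qed

section \<open>Unimodular completion\<close>

text \<open>The lattice \<open>\<int>\<^sup>k\<close>, as the functions that vanish from \<open>k\<close> on. Unlike extensional functions these are closed under
  pointwise operations.\<close>

definition supported :: "nat \<Rightarrow> (nat \<Rightarrow> int) set" where
  "supported k = {f. \<forall>i\<ge>k. f i = 0}"

text \<open>The automorphism is built coordinate by coordinate. Given one for the first \<open>k\<close> entries, with gcd \<open>g\<close>, write
  \<open>d = gcd g (v k) = a g + b (v k)\<close> and precede it by the matrix with rows \<open>(b, g/d)\<close> and \<open>(-a, v k/d)\<close>, of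
  determinant 1, in the last two coordinates. It takes \<open>(0,d)\<close> to \<open>(g, v k)\<close>.\<close>

lemma unimodular_completion:
  fixes v :: "nat \<Rightarrow> nat"
  assumes "k > 0" "\<forall>i<k. v i > 0"
  shows "\<exists>B. bij_betw B (supported k) (supported k) \<and>
     (\<forall>f\<in>supported k. \<forall>g\<in>supported k. \<forall>c. B (\<lambda>i. f i + c * g i) = (\<lambda>i. B f i + c * B g i)) \<and>
     B (\<lambda>i. if i = k - 1 then int (Gcd (v ` {..<k})) else 0) = (\<lambda>i. if i < k then int (v i) else 0)"
  using assms
proof (induction k rule: nat_induct_non_zero)
  case 1
  show ?case by (rule exI[of _ "\<lambda>f. f"]) (auto simp: bij_betw_def lessThan_Suc)
next
  case (Suc k)
  have pos: "\<forall>i<k. v i > 0" using Suc.prems by simp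
  obtain B where bij: "bij_betw B (supported k) (supported k)"
    and lin': "\<forall>f\<in>supported k. \<forall>g\<in>supported k. \<forall>c. B (\<lambda>i. f i + c * g i) = (\<lambda>i. B f i + c * B g i)"
    and Bv: "B (\<lambda>i. if i = k - 1 then int (Gcd (v ` {..<k})) else 0) = (\<lambda>i. if i < k then int (v i) else 0)"
    using Suc.IH[OF pos] by (elim exE conjE)
  note lin = lin'[rule_format]
  define g where "g = Gcd (v ` {..<k})"
  define d where "d = gcd (int g) (int (v k))"
  have d0: "d > 0" using Suc.prems by (simp add: d_def)
  have Gcd: "int (Gcd (v ` {..<Suc k})) = d"
    by (simp add: lessThan_Suc d_def g_def gcd.commute)
  obtain a b where ab: "a * int g + b * int (v k) = d" using bezout_int d_def by metis
  obtain x where x: "int g = d * x" using d_def by (meson dvdE gcd_dvd1)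
  obtain y where y: "int (v k) = d * y" using d_def by (meson dvdE gcd_dvd2)
  have det: "a * x + b * y = 1"
  proof -
    have "d * (a * x + b * y) = d * 1" using ab x y by (simp add: algebra_simps)
    then show ?thesis using d0 by (simp only: mult_cancel_left) simp
  qed
  have k: "k > 0" by (rule Suc.hyps)
  define lo where "lo f = (\<lambda>i. if i < k - 1 then f i else if i = k - 1 then b * f (k - 1) + x * f k else 0)" for f :: "nat \<Rightarrow> int"
  \<comment> \<open>\<open>lo\<close> and the entry at \<open>k\<close> of \<open>C\<close> apply the 2 by 2 matrix, with \<open>x = g/d\<close> and \<open>y = v k/d\<close>.\<close>
  define C where "C f = (\<lambda>i. if i = k then y * f k - a * f (k - 1) else B (lo f) i)" for f :: "nat \<Rightarrow> int"
  have lo: "lo f \<in> supported k" for f using k by (auto simp: lo_def supported_def)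
  have B_in: "B h \<in> supported k" if "h \<in> supported k" for h using bij_betw_apply[OF bij that] .
  have C_in: "C f \<in> supported (Suc k)" for f
    using B_in[OF lo[of f]] by (auto simp: C_def supported_def)
  have inj: "inj_on C (supported (Suc k))"
  proof (rule inj_onI)
    fix f h assume f: "f \<in> supported (Suc k)" and h: "h \<in> supported (Suc k)" and eq: "C f = C h"
    have "B (lo f) i = B (lo h) i" for i
      using fun_cong[OF eq, of i] B_in[OF lo[of f]] B_in[OF lo[of h]]
      by (cases "i = k") (auto simp: C_def supported_def)
    then have "B (lo f) = B (lo h)" by (rule ext)
    then have lo_eq: "lo f = lo h" using inj_onD[OF bij_betw_imp_inj_on[OF bij] _ lo lo] by blast
    have 1: "b * f (k - 1) + x * f k = b * h (k - 1) + x * h k" using fun_cong[OF lo_eq, of "k - 1"] by (simp add: lo_def)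
    have 2: "y * f k - a * f (k - 1) = y * h k - a * h (k - 1)" using fun_cong[OF eq, of k] by (simp add: C_def)
    \<comment> \<open>The inverse matrix.\<close>
    have id: "u = y * (b * u + x * w) - x * (y * w - a * u)" "w = a * (b * u + x * w) + b * (y * w - a * u)" for u w
    proof -
      have "y * (b * u + x * w) - x * (y * w - a * u) = (a * x + b * y) * u" by (simp add: algebra_simps)
      then show "u = y * (b * u + x * w) - x * (y * w - a * u)" by (simp add: det)
      have "a * (b * u + x * w) + b * (y * w - a * u) = (a * x + b * y) * w" by (simp add: algebra_simps)
      then show "w = a * (b * u + x * w) + b * (y * w - a * u)" by (simp add: det)
    qed
    have "f (k - 1) = h (k - 1)" "f k = h k"
      using id(1)[of "f (k - 1)" "f k"] id(1)[of "h (k - 1)" "h k"]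
        id(2)[of "f k" "f (k - 1)"] id(2)[of "h k" "h (k - 1)"] unfolding 1 2 by (simp_all only:)
    moreover have "f i = h i" if "i < k - 1" for i using fun_cong[OF lo_eq, of i] that by (simp add: lo_def)
    moreover have "f i = h i" if "i > k" for i using f h that by (simp add: supported_def)
    moreover have "i < k - 1 \<or> i = k - 1 \<or> i = k \<or> i > k" for i by linarith
    ultimately show "f = h" by (intro ext) metis
  qed
  have surj: "h \<in> C ` supported (Suc k)" if h: "h \<in> supported (Suc k)" for h
  proof -
    have "(\<lambda>i. if i < k then h i else 0) \<in> supported k" by (simp add: supported_def)
    then have "(\<lambda>i. if i < k then h i else 0) \<in> B ` supported k"
      unfolding bij_betw_imp_surj_on[OF bij] .
    then obtain f0 where f0: "(\<lambda>i. if i < k then h i else 0) = B f0" "f0 \<in> supported k"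
      by (rule imageE)
    define f where "f = (\<lambda>i. if i < k - 1 then f0 i else if i = k - 1 then y * f0 (k - 1) - x * h k
      else if i = k then a * f0 (k - 1) + b * h k else 0)"
    have "f \<in> supported (Suc k)" using k by (auto simp: f_def supported_def)
    moreover have "lo f = f0"
    proof
      fix i
      have "b * (y * f0 (k - 1) - x * h k) + x * (a * f0 (k - 1) + b * h k) = (a * x + b * y) * f0 (k - 1)"
        by (simp add: algebra_simps)
      then have "b * (y * f0 (k - 1) - x * h k) + x * (a * f0 (k - 1) + b * h k) = f0 (k - 1)" by (simp add: det)
      then show "lo f i = f0 i" using f0(2) k by (auto simp: lo_def f_def supported_def)
    qed
    moreover have "y * f k - a * f (k - 1) = h k"
    proof -
      have "y * (a * f0 (k - 1) + b * h k) - a * (y * f0 (k - 1) - x * h k) = (a * x + b * y) * h k"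
        by (simp add: algebra_simps)
      moreover have "f k = a * f0 (k - 1) + b * h k" "f (k - 1) = y * f0 (k - 1) - x * h k"
        using k by (auto simp: f_def)
      ultimately show ?thesis by (simp add: det)
    qed
    ultimately have C: "C f = (\<lambda>i. if i = k then h k else if i < k then h i else 0)"
      by (simp only: C_def f0(1)[symmetric] cong: if_cong)
    have "C f i = h i" for i
      using h unfolding C by (cases i k rule: linorder_cases) (auto simp: supported_def)
    then have "C f = h" by (rule ext)
    then show ?thesis using \<open>f \<in> supported (Suc k)\<close> by blast
  qed
  have "bij_betw C (supported (Suc k)) (supported (Suc k))"
    unfolding bij_betw_def using inj surj C_in by blast
  moreover have "C (\<lambda>i. f i + c * h i) = (\<lambda>i. C f i + c * C h i)" for f h c
  proof -
    have "lo (\<lambda>i. f i + c * h i) = (\<lambda>i. lo f i + c * lo h i)" by (auto simp: lo_def algebra_simps)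
    then show ?thesis using lin[OF lo[of f] lo[of h], of c] by (auto simp: C_def algebra_simps)
  qed
  moreover have "C (\<lambda>i. if i = Suc k - 1 then int (Gcd (v ` {..<Suc k})) else 0) = (\<lambda>i. if i < Suc k then int (v i) else 0)"
  proof -
    have "lo (\<lambda>i. if i = k then d else 0) = (\<lambda>i. if i = k - 1 then int g else 0)"
    proof
      show "lo (\<lambda>i. if i = k then d else 0) i = (if i = k - 1 then int g else 0)" for i
        using k by (auto simp: lo_def x)
    qed
    then have "B (lo (\<lambda>i. if i = k then d else 0)) = (\<lambda>i. if i < k then int (v i) else 0)"
      using Bv unfolding g_def by (simp only:)
    then have "C (\<lambda>i. if i = k then d else 0) = (\<lambda>i. if i = k then y * d else if i < k then int (v i) else 0)"
      using k by (auto simp: C_def fun_eq_iff)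
    then show ?thesis unfolding Gcd diff_Suc_1 by (auto simp: y fun_eq_iff)
  qed
  ultimately show ?case by blast
qed

section \<open>The isomorphism\<close>

lemma TO_L_group_simps:
  "carrier (TO_L_group n) = TO n \<inter> L n" "mult (TO_L_group n) = mult (SO n)" "one (TO_L_group n) = one (SO n)"
  by (simp_all add: TO_L_group_def O_group_def units_of_def)

theorem theorem1p1:
  fixes n \<Omega> l :: nat
  assumes "n \<ge> 2"
    and "\<Omega> = card (prime_factors n)"
    and "l = (GCD p\<in>prime_factors n. multiplicity p n)"
  shows "group (TO_L_group n) \<and>
    TO_L_group n \<cong>
      integer_mod_group 2 \<times>\<times> product_group {..<\<Omega> - 1} (\<lambda>_. integer_group) \<times>\<times> integer_mod_group l"
proof -
  note n = assms(1)
  have n0: "real n \<noteq> 0" using n by simp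
  obtain ps where ps: "bij_betw ps {..<\<Omega>} (prime_factors n)"
    using ex_bij_betw_nat_finite[of "prime_factors n"] assms(2) by (auto simp: atLeast0LessThan)
  define v where "v i = multiplicity (ps i) n" for i
  have ps_prime: "ps i \<in> prime_factors n" if "i < \<Omega>" for i using bij_betw_apply[OF ps] that by simp
  have v_pos: "\<forall>i<\<Omega>. v i > 0" using ps_prime by (auto simp: v_def prime_factors_multiplicity)
  obtain p where p: "p \<in> prime_factors n"
    using n prime_factor_nat[of n] by (auto simp: in_prime_factors_iff)
  then have \<Omega>: "\<Omega> > 0" using assms(2) by (auto simp: card_gt_0_iff)
  have l_eq: "l = Gcd (v ` {..<\<Omega>})"
    unfolding assms(3) bij_betw_imp_surj_on[OF ps, symmetric] image_image v_def ..
  have l: "l > 0"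
  proof -
    have "v 0 \<noteq> 0" "v 0 \<in> v ` {..<\<Omega>}" using v_pos \<Omega> by auto
    then show ?thesis unfolding l_eq by (metis Gcd_dvd_nat dvd_0_left_iff gr0I)
  qed
  \<comment> \<open>\<open>E\<close> turns exponent vectors into positive units of \<open>\<int>[1/n]\<close>; it takes the vector \<open>v\<close> to \<open>n\<close>.\<close>
  define E where "E f = (\<Prod>i<\<Omega>. real (ps i) powi f i)" for f
  have E_factors: "(\<Prod>p\<in>prime_factors n. real p powi e p) = E (\<lambda>i. e (ps i))" for e
    unfolding E_def by (rule prod.reindex_bij_betw[OF ps, symmetric])
  have ps0: "real (ps i) \<noteq> 0" if "i < \<Omega>" for i
    using in_prime_factors_imp_prime[OF ps_prime[OF that]] not_prime_0 by (metis of_nat_eq_0_iff)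
  have E_lin: "E (\<lambda>i. f i + c * g i) = E f * E g powi c" for f g c
  proof -
    have "E (\<lambda>i. f i + c * g i) = (\<Prod>i<\<Omega>. real (ps i) powi f i * (real (ps i) powi g i) powi c)"
      unfolding E_def
    proof (rule prod.cong[OF refl])
      fix i assume "i \<in> {..<\<Omega>}"
      then have "real (ps i) powi (f i + c * g i) = real (ps i) powi f i * real (ps i) powi (g i * c)"
        using ps0[of i] by (simp add: power_int_add mult.commute[of c])
      then show "real (ps i) powi (f i + c * g i) = real (ps i) powi f i * (real (ps i) powi g i) powi c"
        by (simp only: power_int_mult)
    qed
    also have "\<dots> = E f * (\<Prod>i<\<Omega>. (real (ps i) powi g i) powi c)" by (simp add: E_def prod.distrib)
    also have "(\<Prod>i<\<Omega>. (real (ps i) powi g i) powi c) = E g powi c"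
      unfolding E_def by (induction \<Omega>) (simp_all add: power_int_mult_distrib)
    finally show ?thesis .
  qed
  have E_pos: "E f > 0" for f
    unfolding E_def using ps0 by (intro prod_pos) (simp add: zero_less_power_int)
  have E_inj: "f i = g i" if "E f = E g" "i < \<Omega>" for f g i
  proof -
    define q where "q = inv_into {..<\<Omega>} ps"
    have q: "q (ps i) = i" if "i < \<Omega>" for i
      unfolding q_def using bij_betw_inv_into_left[OF ps] that by simp
    have "E h = (\<Prod>p\<in>prime_factors n. real p powi h (q p))" for h
      unfolding E_factors unfolding E_def by (rule prod.cong) (simp_all add: q)
    then have "f (q (ps i)) = g (q (ps i))"
      using prime_powers_independent[of "prime_factors n" "\<lambda>p. f (q p)" "\<lambda>p. g (q p)" "ps i"] that ps_prime by auto
    then show ?thesis using q that by simp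
  qed
  have E_cong: "E f = E g" if "\<And>i. i < \<Omega> \<Longrightarrow> f i = g i" for f g unfolding E_def using that by (intro prod.cong) auto
  have E_v: "E (\<lambda>i. if i < \<Omega> then int (v i) else 0) = real n"
  proof -
    have "n = (\<Prod>p\<in>prime_factors n. p ^ multiplicity p n)" using prime_factorization_nat n by simp
    then have "real n = (\<Prod>p\<in>prime_factors n. real p powi int (multiplicity p n))"
      by (metis (no_types, lifting) of_nat_power of_nat_prod power_int_of_nat prod.cong)
    then show ?thesis unfolding E_factors by (simp only: v_def[symmetric]) (auto intro: E_cong)
  qed
  \<comment> \<open>The automorphism \<open>B\<close> of \<open>\<int>\<^sup>\<Omega>\<close> takes \<open>l\<close> times the last unit vector to \<open>v\<close>, so that shifting the last coordinate by \<open>l\<close>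
    multiplies the unit by \<open>n\<close>.\<close>
  obtain B where bij: "bij_betw B (supported \<Omega>) (supported \<Omega>)"
    and lin': "\<forall>f\<in>supported \<Omega>. \<forall>g\<in>supported \<Omega>. \<forall>c. B (\<lambda>i. f i + c * g i) = (\<lambda>i. B f i + c * B g i)"
    and Bv: "B (\<lambda>i. if i = \<Omega> - 1 then int l else 0) = (\<lambda>i. if i < \<Omega> then int (v i) else 0)"
    using unimodular_completion[OF \<Omega> v_pos] unfolding l_eq by (elim exE conjE)
  define top where "top = (\<lambda>i. if i = \<Omega> - 1 then int l else 0)"
  have top: "top \<in> supported \<Omega>" using \<Omega> by (auto simp: top_def supported_def)
  have EB_shift: "E (B (\<lambda>i. f i + c * top i)) = E (B f) * real n powi c" if "f \<in> supported \<Omega>" for f c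
    using lin' that top Bv E_lin[of "B f" c "B top"] E_v by (simp add: top_def)
  have EB_add: "E (B (\<lambda>i. f i + g i)) = E (B f) * E (B g)" if "f \<in> supported \<Omega>" "g \<in> supported \<Omega>" for f g
    using lin'[rule_format, OF that, of 1] E_lin[of "B f" 1 "B g"] by simp
  have EB_inj: "f = g" if "f \<in> supported \<Omega>" "g \<in> supported \<Omega>" "E (B f) = E (B g)" for f g
  proof -
    have "B f \<in> supported \<Omega>" "B g \<in> supported \<Omega>" using bij_betw_apply[OF bij] that by blast+
    then have "B f i = B g i" for i
      using E_inj[OF that(3), of i] by (cases "i < \<Omega>") (simp_all add: supported_def)
    then have "B f = B g" by (rule ext)
    then show ?thesis using inj_onD[OF bij_betw_imp_inj_on[OF bij]] that by blast
  qed
  \<comment> \<open>A chosen representative \<open>\<rho> h\<close> among the units, one for each element \<open>h\<close> of the target group.\<close>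
  define emb where "emb f c = (\<lambda>i. if i < \<Omega> - 1 then f i else if i = \<Omega> - 1 then c else 0)" for f :: "nat \<Rightarrow> int" and c :: int
  have emb: "emb f c \<in> supported \<Omega>" for f c using \<Omega> by (auto simp: emb_def supported_def)
  define sgn' where "sgn' s = (if s = 0 then 1 else - 1 :: real)" for s :: int
  define \<rho> where "\<rho> = (\<lambda>(s, f, c). sgn' s * E (B (emb f c)))"
  let ?H = "integer_mod_group 2 \<times>\<times> product_group {..<\<Omega> - 1} (\<lambda>_. integer_group) \<times>\<times> integer_mod_group l"
  let ?G = "TO_L_group n"
  define \<Psi> where "\<Psi> h = slope_class n (\<rho> h)" for h
  have carrier_H: "carrier ?H = {0..<2} \<times> ({..<\<Omega> - 1} \<rightarrow>\<^sub>E UNIV) \<times> {0..<int l}"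
    using l by (simp add: DirProd_def carrier_integer_mod_group)
  have H: "group ?H" by (intro DirProd_group) simp_all
  have ex: "slope_class n (\<sigma> * E f) \<noteq> {}" if "\<sigma> = 1 \<or> \<sigma> = - 1" for \<sigma> f
  proof -
    have "E f = (\<Prod>p\<in>prime_factors n. real p powi f (inv_into {..<\<Omega>} ps p))"
      unfolding E_factors using bij_betw_inv_into_left[OF ps] by (intro E_cong) simp
    then show ?thesis using slope_class_exists[OF n that] by simp
  qed
  have sgn': "sgn' s = 1 \<or> sgn' s = - 1" for s by (simp add: sgn'_def)
  have ex_\<rho>: "slope_class n (\<rho> h) \<noteq> {}" for h using ex[OF sgn'] by (simp add: \<rho>_def split_beta)
  have inverse_ex: "slope_class n (1 / \<rho> h) \<noteq> {}" for h
  proof -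
    obtain s f c where h: "h = (s, f, c)" by (cases h)
    have "E (\<lambda>i. 0 + (- 1) * B (emb f c) i) = 1 / E (B (emb f c))"
      unfolding E_lin by (simp add: E_def power_int_minus inverse_eq_divide)
    moreover have "1 / \<rho> h = sgn' s * (1 / E (B (emb f c)))" using sgn'[of s] by (auto simp: \<rho>_def h)
    ultimately show ?thesis using ex[OF sgn'[of s]] by metis
  qed
  have \<Psi>_mem: "\<Psi> h \<in> carrier ?G" for h
    unfolding TO_L_group_simps \<Psi>_def by (rule slope_class_in_TO_L[OF n ex_\<rho> inverse_ex])
  have \<Psi>_eqI: "\<Psi> h = slope_class n r" if "r = \<rho> h * real n powi j" for h r j
    using slope_class_eq_iff[OF n ex_\<rho>] that unfolding \<Psi>_def by blast
  have hom: "\<Psi> \<in> hom ?H ?G"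
  proof (rule homI)
    fix h h' assume h: "h \<in> carrier ?H" and h': "h' \<in> carrier ?H"
    obtain s f c where hh: "h = (s, f, c)" by (cases h)
    obtain s' f' c' where hh': "h' = (s', f', c')" by (cases h')
    have r: "s \<in> {0..<2}" "s' \<in> {0..<2}" "c \<in> {0..<int l}" "c' \<in> {0..<int l}"
      using h h' unfolding carrier_H hh hh' by auto
    define f'' where "f'' = (\<lambda>i\<in>{..<\<Omega> - 1}. f i + f' i)"
    have prod: "h \<otimes>\<^bsub>?H\<^esub> h' = ((s + s') mod 2, f'', (c + c') mod int l)"
      by (simp add: hh hh' f''_def integer_group_def)
    have sg: "sgn' ((s + s') mod 2) = sgn' s * sgn' s'"
    proof -
      have "s = 0 \<or> s = 1" "s' = 0 \<or> s' = 1" using r by auto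
      then show ?thesis by (auto simp: sgn'_def)
    qed
    have "(\<lambda>i. emb f c i + emb f' c' i) = (\<lambda>i. emb f'' ((c + c') mod int l) i + (c + c') div int l * top i)"
      by (auto simp: emb_def top_def f''_def fun_eq_iff)
    then have "E (B (emb f c)) * E (B (emb f' c')) = E (B (emb f'' ((c + c') mod int l))) * real n powi ((c + c') div int l)"
      using EB_add[OF emb emb, of f c f' c'] EB_shift[OF emb, of f'' "(c + c') mod int l" "(c + c') div int l"] by simp
    then have "\<rho> h * \<rho> h' = \<rho> (h \<otimes>\<^bsub>?H\<^esub> h') * real n powi ((c + c') div int l)"
      unfolding prod by (simp add: \<rho>_def hh hh' sg)
    from \<Psi>_eqI[OF this] show "\<Psi> (h \<otimes>\<^bsub>?H\<^esub> h') = \<Psi> h \<otimes>\<^bsub>?G\<^esub> \<Psi> h'"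
      unfolding TO_L_group_simps \<Psi>_def[of h] \<Psi>_def[of h'] mult_slope_class[OF n ex_\<rho> ex_\<rho>] .
  qed (rule \<Psi>_mem)
  have inj: "inj_on \<Psi> (carrier ?H)"
  proof (rule inj_onI)
    fix h h' assume h: "h \<in> carrier ?H" and h': "h' \<in> carrier ?H" and eq: "\<Psi> h = \<Psi> h'"
    obtain s f c where hh: "h = (s, f, c)" by (cases h)
    obtain s' f' c' where hh': "h' = (s', f', c')" by (cases h')
    have r: "s \<in> {0..<2}" "s' \<in> {0..<2}" "c \<in> {0..<int l}" "c' \<in> {0..<int l}"
      "f \<in> {..<\<Omega> - 1} \<rightarrow>\<^sub>E UNIV" "f' \<in> {..<\<Omega> - 1} \<rightarrow>\<^sub>E UNIV"
      using h h' unfolding carrier_H hh hh' by auto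
    obtain j where j: "\<rho> h' = \<rho> h * real n powi j" using eq slope_class_eq_iff[OF n ex_\<rho>] unfolding \<Psi>_def by blast
    then have j': "sgn' s' * E (B (emb f' c')) = sgn' s * (E (B (emb f c)) * real n powi j)"
      by (simp add: \<rho>_def hh hh')
    have pos: "E (B (emb f' c')) > 0" "E (B (emb f c)) * real n powi j > 0"
      using E_pos n by simp_all
    have "a = b" if "a * x = b * y" "x > 0" "y > 0" "a = 1 \<or> a = - 1" "b = 1 \<or> b = - 1" for a b x y :: real
      using that by (elim disjE) simp_all
    from this[OF j' pos sgn' sgn'] have sg: "sgn' s' = sgn' s" .
    have "s = 0 \<or> s = 1" "s' = 0 \<or> s' = 1" using r(1,2) by auto
    then have s: "s = s'" using sg by (auto simp: sgn'_def)
    have "sgn' s \<noteq> 0" by (simp add: sgn'_def)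
    then have "E (B (emb f' c')) = E (B (emb f c)) * real n powi j" using j' unfolding sg by (simp only: mult_cancel_left) simp
    then have "E (B (emb f' c')) = E (B (\<lambda>i. emb f c i + j * top i))" unfolding EB_shift[OF emb] .
    moreover have "(\<lambda>i. emb f c i + j * top i) \<in> supported \<Omega>" using emb top by (simp add: supported_def)
    ultimately have e: "emb f' c' = (\<lambda>i. emb f c i + j * top i)" using EB_inj[OF emb] by blast
    have "c' = c + j * int l" using fun_cong[OF e, of "\<Omega> - 1"] by (simp add: emb_def top_def)
    then have "c' mod int l = c mod int l" by simp
    then have c: "c = c'" using r by simp
    have "f i = f' i" for i
    proof (cases "i < \<Omega> - 1")
      case True
      then show ?thesis using fun_cong[OF e, of i] by (simp add: emb_def top_def)
    next
      case False
      then show ?thesis using r by (simp add: PiE_def extensional_def)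
    qed
    then show "h = h'" using s c by (auto simp: hh hh')
  qed
  have surj: "A \<in> \<Psi> ` carrier ?H" if A: "A \<in> carrier ?G" for A
  proof -
    obtain r where r: "A = slope_class n r" "slope_class n r \<noteq> {}" "r \<noteq> 0" "nadic n r" "nadic n (1 / r)"
      using TO_L_slope[OF n] A unfolding TO_L_group_simps by blast
    obtain e where "\<bar>r\<bar> = (\<Prod>p\<in>prime_factors n. real p powi e p)"
      by (rule nadic_unit_factorization[OF n r(3-5)])
    then have abs_r: "\<bar>r\<bar> = E (\<lambda>i. if i < \<Omega> then e (ps i) else 0)"
      unfolding E_factors by (auto intro: E_cong)
    have "(\<lambda>i. if i < \<Omega> then e (ps i) else 0) \<in> supported \<Omega>" by (simp add: supported_def)
    then have "(\<lambda>i. if i < \<Omega> then e (ps i) else 0) \<in> B ` supported \<Omega>"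
      unfolding bij_betw_imp_surj_on[OF bij] .
    then obtain x where x: "(\<lambda>i. if i < \<Omega> then e (ps i) else 0) = B x" "x \<in> supported \<Omega>"
      by (rule imageE)
    define j where "j = x (\<Omega> - 1) div int l"
    define h where "h = (if r > 0 then 0 else 1 :: int, restrict x {..<\<Omega> - 1}, x (\<Omega> - 1) mod int l)"
    have "h \<in> carrier ?H" unfolding carrier_H h_def using l by auto
    have x_eq: "x = (\<lambda>i. emb (restrict x {..<\<Omega> - 1}) (x (\<Omega> - 1) mod int l) i + j * top i)"
    proof
      fix i
      consider "i < \<Omega> - 1" | "i = \<Omega> - 1" | "i \<ge> \<Omega>" by linarith
      then show "x i = emb (restrict x {..<\<Omega> - 1}) (x (\<Omega> - 1) mod int l) i + j * top i"
        using x(2) \<Omega> by cases (auto simp: emb_def top_def j_def supported_def)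
    qed
    have "\<bar>r\<bar> = E (B (emb (restrict x {..<\<Omega> - 1}) (x (\<Omega> - 1) mod int l))) * real n powi j"
      unfolding abs_r x(1) EB_shift[OF emb, symmetric] by (rule arg_cong[OF x_eq, of "\<lambda>z. E (B z)"])
    moreover have "r = sgn' (if r > 0 then 0 else 1) * \<bar>r\<bar>" using r(3) by (simp add: sgn'_def)
    ultimately have "r = \<rho> h * real n powi j" by (simp add: \<rho>_def h_def)
    then have "\<Psi> h = A" unfolding r(1) by (rule \<Psi>_eqI)
    then show ?thesis using \<open>h \<in> carrier ?H\<close> by blast
  qed
  have iso: "\<Psi> \<in> iso ?H ?G"
    unfolding iso_def bij_betw_def using hom inj surj \<Psi>_mem by blast
  have one: "\<Psi> \<one>\<^bsub>?H\<^esub> = \<one>\<^bsub>?G\<^esub>"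
  proof -
    have "E (B (\<lambda>_. 0)) * E (B (\<lambda>_. 0)) = E (B (\<lambda>_. 0))"
      using EB_add[of "\<lambda>_. 0" "\<lambda>_. 0"] by (simp add: supported_def)
    then have "E (B (\<lambda>_. 0)) = 1" using E_pos[of "B (\<lambda>_. 0)"] by simp
    moreover have "emb (\<lambda>i\<in>{..<\<Omega> - 1}. 0) 0 = (\<lambda>_. 0)" by (auto simp: emb_def)
    ultimately have "\<rho> \<one>\<^bsub>?H\<^esub> = 1" by (simp add: \<rho>_def sgn'_def integer_group_def)
    then show ?thesis unfolding \<Psi>_def TO_L_group_simps one_SO[OF n] by simp
  qed
  \<comment> \<open>Only now is \<open>?G\<close> known to be a group: it inherits the axioms from the bijection \<open>\<Psi>\<close> that respects multiplication.\<close>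
  have "group (?G \<lparr>one := \<Psi> \<one>\<^bsub>?H\<^esub>\<rparr>)" by (rule group.iso_imp_img_group[OF H iso])
  then have "group ?G" unfolding one by simp
  moreover have "?G \<cong> ?H" using group.iso_set_sym[OF H iso] unfolding is_iso_def by blast
  ultimately show ?thesis by blast
qed

end
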